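(* Let $\Omega\subset\mathbb{R}^N$ be a bounded domain with sufficiently smooth boundary, let $\lambda>0$, and let $\beta:\partial\Omega\to[0,\infty]$ be of class $C^{1+\alpha}$ ($\alpha>0$) wherever it is bounded. Let $f,K\in C^3(\mathbb{R})$ satisfy (i) $K(0)\ge 0$, $K(s)>0$ for $s>0$, and $K'(s)>0$, $K''(s)>0$ for $s\ge 0$; (ii) $f(s)>0$, $f'(s)>0$, $f''(s)>0$ for $s\ge 0$; (iii) $\int_0^\infty \frac{K'(s)}{f(s)}\,ds<\infty$ (which implies $\int_0^\infty \frac{ds}{f(s)}<\infty$). Let $\mu$ be the first eigenvalue of $$\Delta\phi+\mu\phi=0\ \text{ in }\Omega,\qquad \hat n\cdot\nabla\phi+\beta(x)\phi=0\ \text{ on }\partial\Omega,$$ and let $\phi$ be the corresponding eigenfunction, positive in $\Omega$ and normalised by $\int_\Omega\phi\,dx=1$. Let $u=u(x,t)$ denote the solution of $$u_t=\Delta K(u)+\lambda f(u)\ \ (x\in\Omega,\ t>0),\qquad \hat n\cdot\nabla K(u)+\beta(x)K(u)=0\ \ (x\in\partial\Omega,\ t>0),\qquad u(x,0)=u_0(x)\ge 0\ \ (x\in\Omega).$$ Assume that one of the following two conditions holds. (A) There exists a concave function $\psi:\mathbb{R}_+\to\mathbb{R}_+$ satisfying $\gamma:=\limsup_{s\to\infty}\frac{\psi(s)}{s}<\frac{\lambda}{\mu}$ and such that $$\int_\Omega\big[\psi(f(u(x,t)))-K(u(x,t))\big]\phi(x)\,dx\ge 0\qquad\text{for all } t>0.$$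 (B) There exists a convex function $\varphi:\mathbb{R}_+\to\mathbb{R}_+$ with $\varphi(0)=0$ and $\kappa:=\liminf_{r\to\infty}\frac{\varphi(r)}{r}>\frac{\mu}{\lambda}$ such that $$\int_\Omega\big[f(u(x,t))-\varphi(K(u(x,t)))\big]\phi(x)\,dx\ge 0\qquad\text{for all } t>0,$$ and moreover $\int_1^\infty\frac{ds}{K(s)}<\infty$. Then the solution $u(x,t)$ blows up in finite time, provided that the initial data $u_0\ge 0$ are sufficiently large.
   Context: $\mathbb{R}_+=[0,\infty)$. $\hat n$ denotes the outer unit normal to $\partial\Omega$. In the boundary conditions, $\beta\equiv 0$, $\beta\equiv\infty$ and $0<\beta<\infty$ mean homogeneous Neumann, Dirichlet and Robin conditions respectively; where $\beta=\infty$ the conditions read $K(u)=0$ and $\phi=0$. If $\mu=0$ (Neumann case), $\lambda/\mu$ is read as $+\infty$. The solution $u$ is the unique classical local-in-time solution, $u\in C^{2,1}(\Omega\times(0,T))$, where $T\in(0,\infty]$ is its maximal time of existence; its existence and uniqueness are taken as known. The integral conditions required "for all $t>0$" concern the times at which $u$ exists. Since $u_0\ge 0$ and $f>0$, one has $u>0$ in $\Omega$ for $t>0$. "Blows up in finite time" means that $T<\infty$ with $\|u(\cdot,t)\|_{L^\infty(\Omega)}$ unbounded as $t\to T^-$ (in particular $u$ is not a global-in-time solution). *)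

theory Defs
  imports "HOL-Probability.Essential_Supremum"
begin

section \<open>Differential operators and smoothness classes\<close>

definition pd :: "'a::euclidean_space \<Rightarrow> ('a \<Rightarrow> real) \<Rightarrow> 'a \<Rightarrow> real" where
  "pd b f x = frechet_derivative f (at x) b"

definition grad :: "('a::euclidean_space \<Rightarrow> real) \<Rightarrow> 'a \<Rightarrow> 'a" where
  "grad f x = (\<Sum>b\<in>Basis. pd b f x *\<^sub>R b)"

definition laplacian :: "('a::euclidean_space \<Rightarrow> real) \<Rightarrow> 'a \<Rightarrow> real" where
  "laplacian f x = (\<Sum>b\<in>Basis. pd b (pd b f) x)"

text \<open>The class $C^k(S)$; meant for open \<open>S\<close> only.\<close>

fun Ck_on :: "nat \<Rightarrow> 'a::euclidean_space set \<Rightarrow> ('a \<Rightarrow> real) \<Rightarrow> bool" where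
  "Ck_on 0 S f \<longleftrightarrow> continuous_on S f"
| "Ck_on (Suc k) S f \<longleftrightarrow> f differentiable_on S \<and> (\<forall>b\<in>Basis. Ck_on k S (pd b f))"

text \<open>The class $C^{1+\alpha}(S)$, $0 < \alpha \le 1$, again for open \<open>S\<close>.\<close>

definition C1_holder_on :: "real \<Rightarrow> 'a::euclidean_space set \<Rightarrow> ('a \<Rightarrow> real) \<Rightarrow> bool" where
  "C1_holder_on \<alpha> S f \<longleftrightarrow> f differentiable_on S \<and>
     (\<exists>C. \<forall>x\<in>S. \<forall>y\<in>S. norm (grad f x - grad f y) \<le> C * dist x y powr \<alpha>)"

text \<open>The parabolic class $C^{2,1}(S \times I)$ for open \<open>S\<close> and \<open>I\<close>.\<close>

definition C21_on :: "'a::euclidean_space set \<Rightarrow> real set \<Rightarrow> ('a \<Rightarrow> real \<Rightarrow> real) \<Rightarrow> bool" where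
  "C21_on S I u \<longleftrightarrow>
     (\<forall>t\<in>I. Ck_on 2 S (\<lambda>x. u x t)) \<and>
     (\<forall>x\<in>S. u x differentiable_on I) \<and>
     continuous_on (S \<times> I) (\<lambda>(x, t). u x t) \<and>
     continuous_on (S \<times> I) (\<lambda>(x, t). deriv (u x) t) \<and>
     (\<forall>b\<in>Basis. continuous_on (S \<times> I) (\<lambda>(x, t). pd b (\<lambda>y. u y t) x)) \<and>
     (\<forall>b\<in>Basis. \<forall>c\<in>Basis.
        continuous_on (S \<times> I) (\<lambda>(x, t). pd c (pd b (\<lambda>y. u y t)) x))"


section \<open>Smooth domains and the boundary operator\<close>

definition local_defining_function ::
    "nat \<Rightarrow> 'a::euclidean_space set \<Rightarrow> 'a \<Rightarrow> ('a \<Rightarrow> real) \<Rightarrow> bool" where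
  "local_defining_function k \<Omega> p \<rho> \<longleftrightarrow>
     (\<exists>U. open U \<and> p \<in> U \<and> Ck_on k U \<rho> \<and> grad \<rho> p \<noteq> 0 \<and> \<Omega> \<inter> U = {x \<in> U. \<rho> x < 0})"

definition Ck_boundary :: "nat \<Rightarrow> 'a::euclidean_space set \<Rightarrow> bool" where
  "Ck_boundary k \<Omega> \<longleftrightarrow> (\<forall>p\<in>frontier \<Omega>. \<exists>\<rho>. local_defining_function k \<Omega> p \<rho>)"

text \<open>At a boundary point of a domain with $C^1$ boundary, $\nabla\rho/|\nabla\rho|$ does not depend on
  the defining function.\<close>

definition outer_normal :: "'a::euclidean_space set \<Rightarrow> 'a \<Rightarrow> 'a" where
  "outer_normal \<Omega> p = (THE n. \<exists>\<rho>. local_defining_function 1 \<Omega> p \<rho> \<and> n = sgn (grad \<rho> p))"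

text \<open>\<open>\<beta>\<close> is of class $C^{1+\alpha}$ wherever it is bounded: around each boundary point at which it is
  finite, it is the restriction of a $C^{1+\alpha}$ function. In particular, the set where \<open>\<beta>\<close> is finite
  is relatively open in the boundary.\<close>

definition C1_holder_where_bounded ::
    "real \<Rightarrow> 'a::euclidean_space set \<Rightarrow> ('a \<Rightarrow> ennreal) \<Rightarrow> bool" where
  "C1_holder_where_bounded \<alpha> \<Omega> \<beta> \<longleftrightarrow>
     (\<forall>p\<in>frontier \<Omega>. \<beta> p \<noteq> \<infinity> \<longrightarrow>
        (\<exists>U b. open U \<and> p \<in> U \<and> C1_holder_on \<alpha> U b \<and>
           (\<forall>x\<in>frontier \<Omega> \<inter> U. \<beta> x \<noteq> \<infinity> \<and> enn2real (\<beta> x) = b x)))"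

text \<open>The condition $\hat n\cdot\nabla w + \beta w = 0$ at the boundary point \<open>x\<close>, read as \<open>w x = 0\<close>
  where \<open>\<beta> x = \<infinity>\<close>. The gradient at a boundary point is the limit of the gradient from inside.\<close>

definition boundary_condition ::
    "'a::euclidean_space set \<Rightarrow> ('a \<Rightarrow> ennreal) \<Rightarrow> ('a \<Rightarrow> real) \<Rightarrow> 'a \<Rightarrow> bool" where
  "boundary_condition \<Omega> \<beta> w x \<longleftrightarrow>
     (if \<beta> x = \<infinity> then w x = 0
      else \<exists>g. (grad w \<longlongrightarrow> g) (at x within \<Omega>) \<and>
               outer_normal \<Omega> x \<bullet> g + enn2real (\<beta> x) * w x = 0)"


section \<open>The eigenvalue problem\<close>

definition eigenfunction ::
    "'a::euclidean_space set \<Rightarrow> ('a \<Rightarrow> ennreal) \<Rightarrow> real \<Rightarrow> ('a \<Rightarrow> real) \<Rightarrow> bool" where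
  "eigenfunction \<Omega> \<beta> \<mu> w \<longleftrightarrow>
     Ck_on 2 \<Omega> w \<and> continuous_on (closure \<Omega>) w \<and> (\<exists>x\<in>\<Omega>. w x \<noteq> 0) \<and>
     (\<forall>x\<in>\<Omega>. laplacian w x + \<mu> * w x = 0) \<and>
     (\<forall>x\<in>frontier \<Omega>. boundary_condition \<Omega> \<beta> w x)"

definition first_eigenvalue ::
    "'a::euclidean_space set \<Rightarrow> ('a \<Rightarrow> ennreal) \<Rightarrow> real \<Rightarrow> bool" where
  "first_eigenvalue \<Omega> \<beta> \<mu> \<longleftrightarrow>
     (\<exists>w. eigenfunction \<Omega> \<beta> \<mu> w) \<and> (\<forall>\<nu> w. eigenfunction \<Omega> \<beta> \<nu> w \<longrightarrow> \<mu> \<le> \<nu>)"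


section \<open>The parabolic problem\<close>

definition existence_times :: "ereal \<Rightarrow> real set" where
  "existence_times T = {t. 0 < t \<and> ereal t < T}"

text \<open>Classical solutions on $\Omega\times(0,T)$ with initial value \<open>u0\<close>. Up to the boundary, \<open>u\<close> is
  continuous, and \<open>\<nabla>u\<close> is continuous at the points where \<open>\<beta>\<close> is finite, i.e. where the boundary
  condition involves it. The initial value is attained continuously inside \<open>\<Omega>\<close>, and \<open>u\<close> is bounded near
  \<open>t = 0\<close>: no compatibility of \<open>u0\<close> with the boundary condition is imposed, and without
  boundedness solutions would not be unique.\<close>

definition classical_solution ::
    "'a::euclidean_space set \<Rightarrow> ('a \<Rightarrow> ennreal) \<Rightarrow> real \<Rightarrow> (real \<Rightarrow> real) \<Rightarrow> (real \<Rightarrow> real) \<Rightarrow>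
     ('a \<Rightarrow> real) \<Rightarrow> ereal \<Rightarrow> ('a \<Rightarrow> real \<Rightarrow> real) \<Rightarrow> bool" where
  "classical_solution \<Omega> \<beta> lam f K u0 T u \<longleftrightarrow>
     0 < T \<and>
     C21_on \<Omega> (existence_times T) u \<and>
     continuous_on (closure \<Omega> \<times> existence_times T) (\<lambda>(x, t). u x t) \<and>
     (\<forall>x\<in>frontier \<Omega>. \<beta> x \<noteq> \<infinity> \<longrightarrow> (\<forall>t\<in>existence_times T.
        \<exists>g. ((\<lambda>(y, s). grad (\<lambda>z. u z s) y) \<longlongrightarrow> g) (at (x, t) within \<Omega> \<times> existence_times T))) \<and>
     (\<forall>x\<in>\<Omega>. \<forall>t\<in>existence_times T. deriv (u x) t = laplacian (\<lambda>y. K (u y t)) x + lam * f (u x t)) \<and>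
     (\<forall>x\<in>frontier \<Omega>. \<forall>t\<in>existence_times T. boundary_condition \<Omega> \<beta> (\<lambda>y. K (u y t)) x) \<and>
     continuous_on (\<Omega> \<times> insert 0 (existence_times T)) (\<lambda>(x, t). u x t) \<and>
     (\<forall>x\<in>\<Omega>. u x 0 = u0 x) \<and>
     (\<forall>s\<in>existence_times T. \<exists>C. \<forall>x\<in>\<Omega>. \<forall>t\<in>{0<..s}. \<bar>u x t\<bar> \<le> C)"

text \<open>\<open>T\<close> is the maximal time of existence of \<open>u\<close>: there is no continuation beyond \<open>T\<close>.\<close>

definition maximal_solution ::
    "'a::euclidean_space set \<Rightarrow> ('a \<Rightarrow> ennreal) \<Rightarrow> real \<Rightarrow> (real \<Rightarrow> real) \<Rightarrow> (real \<Rightarrow> real) \<Rightarrow>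
     ('a \<Rightarrow> real) \<Rightarrow> ereal \<Rightarrow> ('a \<Rightarrow> real \<Rightarrow> real) \<Rightarrow> bool" where
  "maximal_solution \<Omega> \<beta> lam f K u0 T u \<longleftrightarrow>
     classical_solution \<Omega> \<beta> lam f K u0 T u \<and>
     \<not> (\<exists>T' v. T < T' \<and> classical_solution \<Omega> \<beta> lam f K u0 T' v \<and>
              (\<forall>x\<in>\<Omega>. \<forall>t\<in>existence_times T. v x t = u x t))"

text \<open>Local existence and uniqueness for continuous nonnegative initial values which vanish under \<open>K\<close>
  on the Dirichlet part of the boundary, with a time of existence that depends only on a bound
  for the initial value. Uniqueness is asked for among nonnegative solutions only, as \<open>K\<close> need
  not be increasing on the negative half-line.\<close>

definition locally_well_posed ::
    "'a::euclidean_space set \<Rightarrow> ('a \<Rightarrow> ennreal) \<Rightarrow> real \<Rightarrow> (real \<Rightarrow> real) \<Rightarrow> (real \<Rightarrow> real) \<Rightarrow> bool" where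
  "locally_well_posed \<Omega> \<beta> lam f K \<longleftrightarrow>
     (\<forall>B. \<exists>\<tau>>0. \<forall>v0.
        continuous_on (closure \<Omega>) v0 \<and> (\<forall>x\<in>closure \<Omega>. 0 \<le> v0 x \<and> v0 x \<le> B) \<and>
        (\<forall>x\<in>frontier \<Omega>. \<beta> x = \<infinity> \<longrightarrow> K (v0 x) = 0) \<longrightarrow>
        (\<exists>v. classical_solution \<Omega> \<beta> lam f K v0 (ereal \<tau>) v \<and>
             (\<forall>T w. classical_solution \<Omega> \<beta> lam f K v0 T w \<and>
                     (\<forall>x\<in>\<Omega>. \<forall>t\<in>existence_times T. 0 \<le> w x t) \<longrightarrow>
                     (\<forall>x\<in>\<Omega>. \<forall>t\<in>existence_times (min (ereal \<tau>) T). w x t = v x t))))"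

definition Linf_norm :: "'a::euclidean_space set \<Rightarrow> ('a \<Rightarrow> real) \<Rightarrow> ereal" where
  "Linf_norm \<Omega> v = esssup (restrict_space lborel \<Omega>) (\<lambda>x. ereal \<bar>v x\<bar>)"

definition blows_up_in_finite_time ::
    "'a::euclidean_space set \<Rightarrow> ereal \<Rightarrow> ('a \<Rightarrow> real \<Rightarrow> real) \<Rightarrow> bool" where
  "blows_up_in_finite_time \<Omega> T u \<longleftrightarrow>
     T < \<infinity> \<and> Limsup (at_left (real_of_ereal T)) (\<lambda>t. Linf_norm \<Omega> (\<lambda>x. u x t)) = \<infinity>"

end

theory Submission
  imports Defs
begin

text \<open>Put $A(t) = \int_\Omega u\phi$. Green's identity gives $A' = \int_\Omega (\lambda f(u) - \mu K(u))\phi$, and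
  in both cases Jensen's inequality bounds the right-hand side below by a multiple of \<open>f A\<close> or \<open>K A\<close>
  once \<open>A\<close> is large, so that \<open>A\<close> cannot exist for all times. A solution that stays bounded up to a
  finite maximal time could be continued, by gluing on the local solution provided by well-posedness.

  Green's identity is the delicate point, because $u_t$ and the second derivatives need not be
  integrable up to the boundary, and gradients may be unbounded at Dirichlet points. Only the
  inequality $\ge$ is needed, and only for the increments of $A$. Replace $\phi$ by $\eta(\phi)$ with a
  convex $\eta$ that vanishes near $0$, which removes the Dirichlet part, and use interior cutoffs.
  The remaining boundary term has the right sign since $\eta'(s)s \ge \eta(s)$.\<close>

section \<open>Truncations\<close>

text \<open>With w = K(u) and a truncation \<eta>, everything runs on one vector field, V = w
  \<eta>'(\<phi>) grad \<phi> - \<eta>(\<phi>) grad w. By the eigenvalue equation, \<eta>(\<phi>)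
  times the Laplacian of w equals w \<eta>''(\<phi>) |grad \<phi>|^2 - \<mu> w \<eta>'(\<phi>)
  \<phi> - div V. The first term is nonnegative and is dropped, so the inequality wanted is that the
  integral of div V is at most 0. That integral need not exist; div V is tested against compactly
  supported cutoffs close to 1 in mean. One cutoff has to serve all times of a compact interval,
  because only a weight that is constant in time passes through the time derivative. The truncation
  is homogeneous in (s, \<epsilon>), so that \<eta>(s) and \<eta>'(s) s both stay within 3
  \<epsilon> of s for s \<ge> 0. What results are lower bounds for increments of A, not a
  differential inequality. The comparison with the ordinary differential equation therefore counts
  the time spent between consecutive unit levels of A, and the integral conditions on 1/f and 1/K
  enter as convergent series.\<close>

lemma has_real_derivative_max0_power:
  "((\<lambda>s::real. (max 0 s) ^ Suc (Suc n)) has_real_derivative real (Suc (Suc n)) * (max 0 s) ^ Suc n) (at s)"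
proof -
  consider "s < 0" | "s > 0" | "s = 0" by linarith
  then show ?thesis
  proof cases
    case 1
    then have "((\<lambda>s::real. 0) has_real_derivative real (Suc (Suc n)) * (max 0 s) ^ Suc n) (at s)"
      by simp
    then show ?thesis
      by (rule has_field_derivative_transform_within_open[where S="{..<0}"]) (use 1 in auto)
  next
    case 2
    have "((\<lambda>s::real. s ^ Suc (Suc n)) has_real_derivative real (Suc (Suc n)) * s ^ Suc n) (at s)"
      using DERIV_pow[of "Suc (Suc n)" s UNIV] by simp
    then have "((\<lambda>s::real. s ^ Suc (Suc n)) has_real_derivative real (Suc (Suc n)) * (max 0 s) ^ Suc n) (at s)"
      using 2 by simp
    then show ?thesis
      by (rule has_field_derivative_transform_within_open[where S="{0<..}"]) (use 2 in auto)
  next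
    \<comment> \<open>At the kink the difference quotient is at most
      \<open>\<bar>y\<bar> ^ Suc n\<close> in modulus, which tends to 0 because the exponent of the
      power is at least 2.\<close>
    case 3
    have "((\<lambda>y::real. (max 0 y ^ Suc (Suc n) - 0) / (y - 0)) \<longlongrightarrow> 0) (at 0)"
    proof (rule Lim_null_comparison)
      show "\<forall>\<^sub>F y in at 0. norm ((max 0 y ^ Suc (Suc n) - 0) / (y - 0)) \<le> \<bar>y\<bar> ^ Suc n"
      proof (rule always_eventually, rule allI)
        fix y :: real
        show "norm ((max 0 y ^ Suc (Suc n) - 0) / (y - 0)) \<le> \<bar>y\<bar> ^ Suc n"
          proof (cases "y > 0")
          case True
          then show ?thesis by simp
        next
          case False
          then have "norm ((max 0 y ^ Suc (Suc n) - 0) / (y - 0)) = 0" by simp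
          also have "0 \<le> \<bar>y\<bar> ^ Suc n" by (rule zero_le_power_abs)
          finally show ?thesis .
        qed
      qed
      show "((\<lambda>y::real. \<bar>y\<bar> ^ Suc n) \<longlongrightarrow> 0) (at 0)"
        by (rule tendsto_eq_intros refl | simp)+
    qed
    then show ?thesis
      using 3 by (simp add: has_field_derivative_iff)
  qed
qed

lemma has_real_derivative_max0_square:
  fixes g :: "real \<Rightarrow> real"
  assumes "(g has_real_derivative d) (at s)"
  shows "((\<lambda>s. (max 0 (g s))\<^sup>2) has_real_derivative 2 * max 0 (g s) * d) (at s)"
  using DERIV_chain2[OF has_real_derivative_max0_power[of 0 "g s"] assms] by (simp add: numeral_2_eq_2)

lemma has_real_derivative_max0_cube:
  fixes g :: "real \<Rightarrow> real"
  assumes "(g has_real_derivative d) (at s)"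
  shows "((\<lambda>s. (max 0 (g s)) ^ 3) has_real_derivative 3 * (max 0 (g s))\<^sup>2 * d) (at s)"
  using DERIV_chain2[OF has_real_derivative_max0_power[of 1 "g s"] assms]
  by (simp add: numeral_3_eq_3 numeral_2_eq_2)

text \<open>A convex $C^2$ approximation of the identity on the positive half-line that vanishes
  below \<open>\<epsilon>\<close>. At \<open>s = 0\<close> the junk value \<open>0 / 0 = 0\<close> is the right one.\<close>

definition trunc :: "real \<Rightarrow> real \<Rightarrow> real" where
  "trunc \<epsilon> s = (max 0 (s - \<epsilon>)) ^ 3 / s\<^sup>2"

definition trunc' :: "real \<Rightarrow> real \<Rightarrow> real" where
  "trunc' \<epsilon> s = (max 0 (s - \<epsilon>))\<^sup>2 * (s + 2 * \<epsilon>) / s ^ 3"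

text \<open>The remaining simple factor \<open>max 0 (s - \<epsilon>)\<close> makes this nonnegative
  and continuous. This is the reason for the cube in \<open>trunc\<close>: a square would leave a
  jump of the second derivative at \<open>\<epsilon>\<close>, and the divergence of the flux field
  would not be continuous.\<close>

definition trunc'' :: "real \<Rightarrow> real \<Rightarrow> real" where
  "trunc'' \<epsilon> s = 6 * \<epsilon>\<^sup>2 * max 0 (s - \<epsilon>) / s ^ 4"

lemma trunc_eq_0: "s \<le> \<epsilon> \<Longrightarrow> trunc \<epsilon> s = 0" "s \<le> \<epsilon> \<Longrightarrow> trunc' \<epsilon> s = 0"
  by (simp_all add: trunc_def trunc'_def max_def)

lemma trunc_derivs:
  assumes "0 < \<epsilon>"
  shows "(trunc \<epsilon> has_real_derivative trunc' \<epsilon> s) (at s)"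
    and "(trunc' \<epsilon> has_real_derivative trunc'' \<epsilon> s) (at s)"
    and "isCont (trunc'' \<epsilon>) s"
proof -
  have "(trunc \<epsilon> has_real_derivative trunc' \<epsilon> s) (at s) \<and>
        (trunc' \<epsilon> has_real_derivative trunc'' \<epsilon> s) (at s) \<and> isCont (trunc'' \<epsilon>) s"
  proof (cases "s < \<epsilon>")
    case True
    have "((\<lambda>s. 0) has_real_derivative trunc' \<epsilon> s) (at s)"
         "((\<lambda>s. 0) has_real_derivative trunc'' \<epsilon> s) (at s)"
      using True by (simp_all add: trunc'_def trunc''_def)
    moreover have "isCont (trunc'' \<epsilon>) s"
    proof -
      have "isCont (\<lambda>s::real. 0::real) s" by simp
      moreover have "\<forall>\<^sub>F x in nhds s. trunc'' \<epsilon> x = 0"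
        by (rule eventually_nhds_in_open[of "{..<\<epsilon>}", THEN eventually_mono])
           (use True in \<open>auto simp: trunc''_def\<close>)
      ultimately show ?thesis by (simp cong: isCont_cong)
    qed
    ultimately show ?thesis
      by (auto intro: has_field_derivative_transform_within_open[where S="{..<\<epsilon>}"]
          simp: True trunc_eq_0)
  next
    case False
    then have s: "s > 0" using assms by simp
    have d2: "((\<lambda>s. max 0 (s - \<epsilon>) ^ 2) has_real_derivative 2 * max 0 (s - \<epsilon>)) (at s)"
      by (rule DERIV_cong[OF has_real_derivative_max0_square], rule DERIV_diff[OF DERIV_ident DERIV_const]) simp
    have d3: "((\<lambda>s. max 0 (s - \<epsilon>) ^ 3) has_real_derivative 3 * max 0 (s - \<epsilon>) ^ 2) (at s)"
      by (rule DERIV_cong[OF has_real_derivative_max0_cube], rule DERIV_diff[OF DERIV_ident DERIV_const]) simp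
    \<comment> \<open>In the variables \<open>s\<close> and \<open>p\<close> both derivative
      formulas are identities of rational functions whose denominators are powers of
      \<open>s\<close>; clearing them leaves polynomial identities.\<close>
    define p where "p = s - \<epsilon>"
    have m: "max 0 (s - \<epsilon>) = p" and e: "\<epsilon> = s - p" using False by (auto simp: p_def)
    have s2: "((\<lambda>s. s\<^sup>2) has_real_derivative 2 * s) (at s)"
      and s3: "((\<lambda>s. s ^ 3) has_real_derivative 3 * s\<^sup>2) (at s)"
      and s1: "((\<lambda>s. s + 2 * \<epsilon>) has_real_derivative 1) (at s)"
      by (auto intro!: derivative_eq_intros)
    have s0: "s\<^sup>2 \<noteq> 0" "s ^ 3 \<noteq> 0" using s by simp_all
    have "(trunc \<epsilon> has_real_derivative trunc' \<epsilon> s) (at s)"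
      unfolding trunc_def
    proof (rule DERIV_cong[OF DERIV_divide[OF d3 s2 s0(1)]])
      have "(3 * p\<^sup>2 * s\<^sup>2 - p ^ 3 * (2 * s)) / (s\<^sup>2 * s\<^sup>2) = p\<^sup>2 * (s + 2 * (s - p)) / s ^ 3"
        using s by (simp add: frac_eq_eq) algebra
      then show "(3 * (max 0 (s - \<epsilon>))\<^sup>2 * s\<^sup>2 - max 0 (s - \<epsilon>) ^ 3 * (2 * s)) / (s\<^sup>2 * s\<^sup>2) = trunc' \<epsilon> s"
        unfolding trunc'_def m unfolding e .
    qed
    moreover have "(trunc' \<epsilon> has_real_derivative trunc'' \<epsilon> s) (at s)"
      unfolding trunc'_def
    proof (rule DERIV_cong[OF DERIV_divide[OF DERIV_mult[OF d2 s1] s3 s0(2)]])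
      have "((2 * p * (s + 2 * (s - p)) + 1 * p\<^sup>2) * s ^ 3 - p\<^sup>2 * (s + 2 * (s - p)) * (3 * s\<^sup>2)) / (s ^ 3 * s ^ 3)
          = 6 * (s - p)\<^sup>2 * p / s ^ 4"
        using s by (simp add: frac_eq_eq) algebra
      then show "((2 * max 0 (s - \<epsilon>) * (s + 2 * \<epsilon>) + 1 * (max 0 (s - \<epsilon>))\<^sup>2) * s ^ 3 -
          (max 0 (s - \<epsilon>))\<^sup>2 * (s + 2 * \<epsilon>) * (3 * s\<^sup>2)) / (s ^ 3 * s ^ 3) = trunc'' \<epsilon> s"
        unfolding trunc''_def m unfolding e .
    qed
    moreover have "isCont (trunc'' \<epsilon>) s"
      unfolding trunc''_def by (intro continuous_intros) (use s in auto)
    ultimately show ?thesis by blast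
  qed
  then show "(trunc \<epsilon> has_real_derivative trunc' \<epsilon> s) (at s)"
    "(trunc' \<epsilon> has_real_derivative trunc'' \<epsilon> s) (at s)" "isCont (trunc'' \<epsilon>) s" by auto
qed

text \<open>By homogeneity only \<open>r = \<epsilon> / s\<close> matters:
  \<open>trunc \<epsilon> s\<close> is s (1 - r)^3 and \<open>trunc' \<epsilon> s * s\<close> is s
  (1 - r)^2 (1 + 2 r), which leaves polynomial inequalities for 0 < r < 1. The constant 3 is the
  linear coefficient of (1 - r)^3. The bound
  \<open>trunc \<epsilon> s \<le> trunc' \<epsilon> s * s\<close> fixes the sign of the boundary
  flux; the bounds by \<open>s\<close> and \<open>s - 3 * \<epsilon>\<close> control the error when
  \<open>\<epsilon>\<close> tends to 0.\<close>

lemma trunc_bounds: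
  assumes "0 < \<epsilon>" "0 \<le> s"
  shows "0 \<le> trunc \<epsilon> s" "trunc \<epsilon> s \<le> s" "s - 3 * \<epsilon> \<le> trunc \<epsilon> s"
    and "0 \<le> trunc'' \<epsilon> s" "trunc \<epsilon> s \<le> trunc' \<epsilon> s * s" "trunc' \<epsilon> s * s \<le> s"
        "s - 3 * \<epsilon> \<le> trunc' \<epsilon> s * s"
proof -
  have "0 \<le> trunc \<epsilon> s \<and> trunc \<epsilon> s \<le> s \<and> s - 3 * \<epsilon> \<le> trunc \<epsilon> s \<and>
     trunc \<epsilon> s \<le> trunc' \<epsilon> s * s \<and> trunc' \<epsilon> s * s \<le> s \<and> s - 3 * \<epsilon> \<le> trunc' \<epsilon> s * s"
  proof (cases "s \<le> \<epsilon>")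
    case True
    then show ?thesis using assms by (simp add: trunc_eq_0)
  next
    case False
    then have s: "s > 0" "s > \<epsilon>" using assms by auto
    define r where "r = \<epsilon> / s"
    have r: "0 < r" "r < 1" and e: "\<epsilon> = r * s" using s assms by (auto simp: r_def)
    have m: "max 0 (s - \<epsilon>) = s * (1 - r)" using s e by (simp add: algebra_simps)
    have t: "trunc \<epsilon> s = s * (1 - r) ^ 3"
      unfolding trunc_def m using s by (simp add: field_simps power2_eq_square power3_eq_cube)
    have t': "trunc' \<epsilon> s * s = s * ((1 - r)^2 * (1 + 2 * r))"
      unfolding trunc'_def m using s by (simp add: e field_simps power2_eq_square power3_eq_cube)
    have 1: "(1 - r) ^ 3 \<le> 1" "0 \<le> (1-r)^3" using r by (auto intro: power_le_one)
    have "(1 - 3 * r) - (1 - r) ^ 3 = - (r\<^sup>2 * (3 - r))" by (simp add: power2_eq_square power3_eq_cube algebra_simps)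
    then have 2: "(1 - 3 * r) \<le> (1 - r) ^ 3" using r
      by (smt (verit) mult_nonneg_nonneg zero_le_power2 mult_minus_left)
    have 3: "(1 - r)^2 * (1 + 2 * r) = 1 - r^2 * (3 - 2 * r)" by (simp add: power2_eq_square algebra_simps)
    have 4: "(1 - r)^2 * (1 + 2 * r) = (1 - r)^3 + 3 * r * (1 - r)^2" by (simp add: power2_eq_square power3_eq_cube algebra_simps)
    have 5: "0 \<le> r^2 * (3 - 2 * r)" "0 \<le> 3 * r * (1 - r)^2" using r by auto
    have 6: "s - 3 * \<epsilon> = s * (1 - 3 * r)" by (simp add: e algebra_simps)
    have 7: "a \<le> b \<Longrightarrow> s * a \<le> s * b" for a b using s by (simp add: mult_left_mono)
    have 8: "(1 - r) ^ 3 \<le> (1 - r)\<^sup>2 * (1 + 2 * r)" using 4 5(2) by linarith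
    have 9: "(1 - r)\<^sup>2 * (1 + 2 * r) \<le> 1" using 3 5(1) by linarith
    show ?thesis unfolding t t' 6
      using 7[OF 1(2)] 7[OF 1(1)] 7[OF 2] 7[OF 8] 7[OF 9] 7[OF order_trans[OF 2 8]]
      unfolding mult_1_right mult_zero_right by blast
  qed
  then show "0 \<le> trunc \<epsilon> s" "trunc \<epsilon> s \<le> s" "s - 3 * \<epsilon> \<le> trunc \<epsilon> s"
    "trunc \<epsilon> s \<le> trunc' \<epsilon> s * s" "trunc' \<epsilon> s * s \<le> s" "s - 3 * \<epsilon> \<le> trunc' \<epsilon> s * s" by auto
  show "0 \<le> trunc'' \<epsilon> s" using assms by (simp add: trunc''_def)
qed

text \<open>A $C^1$ step from 0 on the left of 1 to 1 on the right of 2.\<close>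

definition step :: "real \<Rightarrow> real" where
  "step s = 1 - (max 0 (1 - (max 0 (s - 1))\<^sup>2))\<^sup>2"

definition step' :: "real \<Rightarrow> real" where
  "step' s = 4 * max 0 (1 - (max 0 (s - 1))\<^sup>2) * max 0 (s - 1)"

lemma step_deriv: "(step has_real_derivative step' s) (at s)"
proof -
  have "((\<lambda>s. (max 0 (s - 1))\<^sup>2) has_real_derivative 2 * max 0 (s - 1)) (at s)"
    by (rule DERIV_cong[OF has_real_derivative_max0_square], rule DERIV_diff[OF DERIV_ident DERIV_const]) simp
  then have "((\<lambda>s. 1 - (max 0 (s - 1))\<^sup>2) has_real_derivative - 2 * max 0 (s - 1)) (at s)"
    by (rule DERIV_cong[OF DERIV_diff[OF DERIV_const]]) simp
  from DERIV_cong[OF DERIV_diff[OF DERIV_const has_real_derivative_max0_square[OF this]], of "step' s" 1]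
  show ?thesis unfolding step_def step'_def by simp
qed

lemma continuous_on_step: "continuous_on S step"
  unfolding step_def by (intro continuous_intros)

lemma continuous_on_step': "continuous_on S step'"
  unfolding step'_def by (intro continuous_intros)

lemma step_bounds: "0 \<le> step s" "step s \<le> 1" "0 \<le> step' s"
proof -
  have "(max 0 (1 - (max 0 (s - 1))\<^sup>2))\<^sup>2 \<le> 1" by (rule power_le_one) auto
  then show "0 \<le> step s" "step s \<le> 1" by (simp_all add: step_def)
  show "0 \<le> step' s" unfolding step'_def by (intro mult_nonneg_nonneg) auto
qed

lemma step_eq: "s \<le> 1 \<Longrightarrow> step s = 0" "2 \<le> s \<Longrightarrow> step s = 1" "2 \<le> s \<Longrightarrow> step' s = 0" "s \<le> 1 \<Longrightarrow> step' s = 0"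
proof -
  assume "2 \<le> s"
  then have "1 \<le> max 0 (s - 1)" by simp
  then have "1 \<le> (max 0 (s - 1))\<^sup>2" using one_le_power by blast
  then show "step s = 1" "step' s = 0" by (auto simp: step_def step'_def)
qed (auto simp: step_def step'_def)

section \<open>Partial derivatives and integration by parts\<close>

lemma pd_eqI: "(f has_derivative D) (at x) \<Longrightarrow> pd b f x = D b"
  unfolding pd_def using frechet_derivative_at by metis

lemma pd_const [simp]: "pd b (\<lambda>x. c) x = 0"
  using pd_eqI[of "\<lambda>x. c" "\<lambda>x. 0"] by simp

lemma has_derivative_frechet:
  "f differentiable at x \<Longrightarrow> (f has_derivative frechet_derivative f (at x)) (at x)"
  by (simp add: frechet_derivative_works)

text \<open>\<open>grad\<close> is assembled from the coordinate directions; linearity of the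
  derivative carries it to every direction \<open>e\<close>. The boundary estimate uses it with
  \<open>e\<close> the gradient of a defining function.\<close>

lemma pd_linear:
  assumes "f differentiable at x"
  shows "pd e f x = grad f x \<bullet> e"
proof -
  interpret D: bounded_linear "frechet_derivative f (at x)"
    by (rule has_derivative_bounded_linear[OF has_derivative_frechet[OF assms]])
  have "pd e f x = frechet_derivative f (at x) (\<Sum>b\<in>Basis. (e \<bullet> b) *\<^sub>R b)"
    by (simp add: pd_def euclidean_representation)
  also have "\<dots> = grad f x \<bullet> e"
    by (simp add: D.sum D.scaleR grad_def pd_def inner_sum_left inner_commute[of e] mult.commute)
  finally show ?thesis .
qed

lemma grad_inner_Basis: "b \<in> Basis \<Longrightarrow> grad f x \<bullet> b = pd b f x"
  by (simp add: grad_def inner_sum_left inner_Basis if_distrib comm_monoid_add_class.sum.delta cong: if_cong)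

lemma pd_mult:
  assumes "f differentiable at x" "g differentiable at x"
  shows "pd b (\<lambda>x. f x * g x) x = f x * pd b g x + pd b f x * g x"
  using pd_eqI[OF has_derivative_mult[OF has_derivative_frechet[OF assms(1)] has_derivative_frechet[OF assms(2)]], of b]
  by (simp add: pd_def)

lemma pd_diff:
  assumes "f differentiable at x" "g differentiable at x"
  shows "pd b (\<lambda>x. f x - g x) x = pd b f x - pd b g x"
  using pd_eqI[OF has_derivative_diff[OF has_derivative_frechet[OF assms(1)] has_derivative_frechet[OF assms(2)]], of b]
  by (simp add: pd_def)

lemma pd_chain:
  assumes "f differentiable at x" "(h has_real_derivative d) (at (f x))"
  shows "(\<lambda>x. h (f x)) differentiable at x" "pd b (\<lambda>x. h (f x)) x = d * pd b f x"
proof -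
  have "((\<lambda>x. h (f x)) has_derivative (\<lambda>v. d * frechet_derivative f (at x) v)) (at x)"
    using has_derivative_compose[OF has_derivative_frechet[OF assms(1)], of h "(*) d"] assms(2)
    by (simp add: has_field_derivative_def)
  from pd_eqI[OF this] differentiableI[OF this]
  show "(\<lambda>x. h (f x)) differentiable at x" "pd b (\<lambda>x. h (f x)) x = d * pd b f x"
    by (auto simp: pd_def)
qed

lemma differentiable_transform_open:
  assumes "f differentiable at x" "open U" "x \<in> U" "\<And>y. y \<in> U \<Longrightarrow> f y = g y"
  shows "g differentiable at x"
proof -
  from assms(1) obtain D where "(f has_derivative D) (at x)" by (auto simp: differentiable_def)
  from has_derivative_transform_within_open[OF this assms(2-4)]
  show ?thesis by (auto simp: differentiable_def)
qed

text \<open>\<open>frechet_derivative\<close> chooses from the set of derivatives at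
  \<open>x\<close>, and this set is the same for both functions, even when it is empty. Rewriting
  under iterated \<open>pd\<close> therefore raises no differentiability questions.\<close>

lemma pd_cong_open:
  assumes "open U" "x \<in> U" "\<And>y. y \<in> U \<Longrightarrow> f y = g y"
  shows "pd b f x = pd b g x"
proof -
  have "(f has_derivative D) (at x) \<longleftrightarrow> (g has_derivative D) (at x)" for D
    using has_derivative_transform_within_open[OF _ assms(1,2), of f D UNIV g]
      has_derivative_transform_within_open[OF _ assms(1,2), of g D UNIV f] assms(3) by auto
  then show ?thesis by (simp add: pd_def frechet_derivative_def)
qed

lemma grad_cong_open:
  assumes "open U" "x \<in> U" "\<And>y. y \<in> U \<Longrightarrow> f y = g y"
  shows "grad f x = grad g x"
  unfolding grad_def using pd_cong_open[OF assms] by simp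

lemma laplacian_cong_open:
  assumes "open U" "x \<in> U" "\<And>y. y \<in> U \<Longrightarrow> f y = g y"
  shows "laplacian f x = laplacian g x"
  unfolding laplacian_def
  by (intro sum.cong refl pd_cong_open[OF assms(1,2)]) (use pd_cong_open[OF assms(1) _ assms(3)] in auto)

lemma Ck_on_cong_open:
  assumes "open U" "\<And>y. y \<in> U \<Longrightarrow> f y = g y" "Ck_on k U f"
  shows "Ck_on k U g"
  using assms(2,3)
proof (induction k arbitrary: f g)
  case 0
  then show ?case by (simp cong: continuous_on_cong)
next
  case (Suc k)
  have "g differentiable_on U"
    using Suc.prems assms(1) differentiable_transform_open[of f _ U g]
    by (auto simp: differentiable_on_eq_differentiable_at)
  moreover have "Ck_on k U (pd b g)" if "b \<in> Basis" for b
    by (rule Suc.IH[of "pd b f"]) (use Suc.prems that pd_cong_open[OF assms(1) _ Suc.prems(1)] in auto)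
  ultimately show ?case by simp
qed

lemma differentiable_at_imp_continuous_on:
  "(\<And>x. x \<in> S \<Longrightarrow> f differentiable at x) \<Longrightarrow> continuous_on S f"
  by (meson continuous_at_imp_continuous_on differentiable_imp_continuous_within)

lemma continuous_on_slice:
  assumes "continuous_on (S \<times> J) h"
  shows "t \<in> J \<Longrightarrow> continuous_on S (\<lambda>x. h (x, t))" "x \<in> S \<Longrightarrow> continuous_on J (\<lambda>t. h (x, t))"
  by (rule continuous_on_compose2[OF assms]; auto intro!: continuous_intros)+

section \<open>Integration over a bounded open set\<close>

abbreviation vol :: "'a::euclidean_space set \<Rightarrow> 'a measure" where
  "vol \<Omega> \<equiv> restrict_space lborel \<Omega>"

lemma space_vol [simp]: "space (vol \<Omega>) = \<Omega>"
  by (simp add: space_restrict_space)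

lemma finite_measure_vol:
  assumes "open \<Omega>" "bounded \<Omega>"
  shows "finite_measure (vol \<Omega>)"
proof (rule finite_measureI)
  show "emeasure (vol \<Omega>) (space (vol \<Omega>)) \<noteq> \<infinity>"
    using assms emeasure_bounded_finite[OF assms(2)]
    by (simp add: space_restrict_space emeasure_restrict_space)
qed

lemma measurable_vol:
  assumes "continuous_on \<Omega> f"
  shows "f \<in> borel_measurable (vol \<Omega>)"
  using borel_measurable_continuous_on_restrict[OF assms]
  by (simp add: measurable_def space_restrict_space sets_restrict_space)

lemma integrable_vol:
  fixes f :: "'a::euclidean_space \<Rightarrow> real"
  assumes "open \<Omega>" "bounded \<Omega>" "f \<in> borel_measurable (vol \<Omega>)"
    and "\<And>x. x \<in> \<Omega> \<Longrightarrow> \<bar>f x\<bar> \<le> B"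
  shows "integrable (vol \<Omega>) f"
proof -
  interpret finite_measure "vol \<Omega>" by (rule finite_measure_vol[OF assms(1,2)])
  show ?thesis
    by (rule integrable_const_bound[where B=B]) (use assms in auto)
qed

lemma set_integral_vol:
  fixes f :: "'a::euclidean_space \<Rightarrow> real"
  assumes "open \<Omega>"
  shows "(LINT x:\<Omega>|lborel. f x) = (\<integral>x. f x \<partial>vol \<Omega>)"
  using assms by (subst integral_restrict_space) (auto simp: set_lebesgue_integral_def)

lemma compact_abs_bound:
  fixes f :: "'a::topological_space \<Rightarrow> real"
  assumes "compact S" "continuous_on S f"
  obtains B where "0 \<le> B" "\<And>x. x \<in> S \<Longrightarrow> \<bar>f x\<bar> \<le> B"
proof -
  have "bounded (f ` S)"
    by (intro compact_imp_bounded compact_continuous_image assms)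
  then obtain B where "\<forall>x\<in>S. \<bar>f x\<bar> \<le> B" by (auto simp: bounded_iff)
  then show ?thesis using that[of "max B 0"] by fastforce
qed

text \<open>The integral of a directional derivative is the limit of integrals of difference quotients,
  which vanish by translation invariance.\<close>

lemma integral_pd_eq_0:
  fixes F :: "'a::euclidean_space \<Rightarrow> real"
  assumes diff: "\<And>x. F differentiable at x" and cont: "continuous_on UNIV (pd e F)"
    and zero: "\<And>x. R < norm x \<Longrightarrow> F x = 0"
  shows "(\<integral>x. pd e F x \<partial>lborel) = 0"
proof -
  have zero': "pd e F x = 0" if "R < norm x" for x
  proof -
    have "open {x::'a. R < norm x}" by (intro open_Collect_less continuous_intros)
    then have "pd e F x = pd e (\<lambda>x. 0) x"
      by (rule pd_cong_open) (use that zero in auto)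
    also have "\<dots> = 0" by simp
    finally show ?thesis .
  qed
  obtain B where M: "0 \<le> B" "\<And>x. x \<in> cball 0 R \<Longrightarrow> \<bar>pd e F x\<bar> \<le> B"
    using compact_abs_bound[OF compact_cball continuous_on_subset[OF cont]] by (metis subset_UNIV)
  have B: "\<bar>pd e F x\<bar> \<le> B" for x
    using M(1) M(2)[of x] zero'[of x] by (cases "R < norm x") auto
  have contF: "continuous_on UNIV F"
    using diff by (rule differentiable_at_imp_continuous_on)
  have meas: "F \<in> borel_measurable borel" "pd e F \<in> borel_measurable borel"
    by (rule borel_measurable_continuous_onI contF cont)+
  define q where "q n x = (F (inverse (real (Suc n)) *\<^sub>R e + x) - F x) * real (Suc n)" for n :: nat and x
  have line: "((\<lambda>s. F (s *\<^sub>R e + x)) has_real_derivative pd e F (s *\<^sub>R e + x)) (at s)" for s x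
  proof -
    interpret D: bounded_linear "frechet_derivative F (at (s *\<^sub>R e + x))"
      by (rule has_derivative_bounded_linear[OF has_derivative_frechet[OF diff]])
    have "((\<lambda>s. s *\<^sub>R e + x) has_derivative (\<lambda>h. h *\<^sub>R e)) (at s)"
      by (auto intro!: derivative_eq_intros)
    from has_derivative_compose[OF this has_derivative_frechet[OF diff]]
    have "((\<lambda>s. F (s *\<^sub>R e + x)) has_derivative (\<lambda>h. frechet_derivative F (at (s *\<^sub>R e + x)) (h *\<^sub>R e))) (at s)" .
    moreover have "(\<lambda>h. frechet_derivative F (at (s *\<^sub>R e + x)) (h *\<^sub>R e)) = (*) (pd e F (s *\<^sub>R e + x))"
      by (simp add: fun_eq_iff D.scaleR pd_def)
    ultimately show ?thesis by (simp add: has_field_derivative_def)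
  qed
  have qb: "\<bar>q n x\<bar> \<le> B" for n x
  proof -
    obtain z where "F (inverse (real (Suc n)) *\<^sub>R e + x) - F (0 *\<^sub>R e + x)
        = (inverse (real (Suc n)) - 0) * pd e F (z *\<^sub>R e + x)"
      using MVT2[of 0 "inverse (real (Suc n))" "\<lambda>s. F (s *\<^sub>R e + x)" "\<lambda>s. pd e F (s *\<^sub>R e + x)"] line by auto
    then have "q n x = pd e F (z *\<^sub>R e + x)" by (simp add: q_def field_simps)
    then show ?thesis using B by simp
  qed
  \<comment> \<open>The step lengths \<open>inverse (real (Suc n))\<close> are at most 1, so a shift
    moves points by at most \<open>norm e\<close>; all quotients vanish outside one fixed ball, and
    \<open>B\<close> times its indicator dominates them.\<close>
  have q0: "q n x = 0" if "R + norm e < norm x" for n x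
  proof -
    have "norm x \<le> norm (inverse (real (Suc n)) *\<^sub>R e + x) + norm (inverse (real (Suc n)) *\<^sub>R e)"
      using norm_triangle_ineq4[of "inverse (real (Suc n)) *\<^sub>R e + x" "inverse (real (Suc n)) *\<^sub>R e"]
      by (simp only: add_diff_cancel_left')
    also have "norm (inverse (real (Suc n)) *\<^sub>R e) \<le> norm e"
      by (simp add: field_simps mult_left_le_one_le)
    finally have "R < norm (inverse (real (Suc n)) *\<^sub>R e + x)" using that by simp
    moreover have "R < norm x" using that norm_ge_zero[of e] by linarith
    ultimately show ?thesis by (simp only: q_def zero) simp
  qed
  let ?w = "\<lambda>x::'a. B * indicat_real (cball 0 (R + norm e)) x"
  have w: "integrable lborel ?w"
    by (intro integrable_mult_right integrable_real_indicator)
       (use emeasure_bounded_finite[OF bounded_cball] in simp_all)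
  have lim: "(\<lambda>n. \<integral>x. q n x \<partial>lborel) \<longlonglongrightarrow> (\<integral>x. pd e F x \<partial>lborel)"
  proof (rule integral_dominated_convergence[where w="?w"])
    show "AE x in lborel. (\<lambda>n. q n x) \<longlonglongrightarrow> pd e F x"
    proof (rule AE_I2)
      fix x
      have "((\<lambda>h. (F (h *\<^sub>R e + x) - F x) / h) \<longlongrightarrow> pd e F x) (at 0)"
        using line[of x 0] by (simp add: has_field_derivative_iff)
      moreover have "filterlim (\<lambda>n. inverse (real (Suc n))) (at 0) sequentially"
        using LIMSEQ_inverse_real_of_nat by (simp add: filterlim_at)
      ultimately have "(\<lambda>n. (F (inverse (real (Suc n)) *\<^sub>R e + x) - F x) / inverse (real (Suc n))) \<longlonglongrightarrow> pd e F x"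
        by (rule filterlim_compose)
      then show "(\<lambda>n. q n x) \<longlonglongrightarrow> pd e F x" by (simp add: q_def field_simps)
    qed
    show "AE x in lborel. norm (q n x) \<le> ?w x" for n
      by (rule AE_I2) (use qb[of n] q0[of _ n] in \<open>auto simp: indicator_def not_le\<close>)
  qed (use meas w in \<open>auto simp: q_def\<close>)
  have "(\<integral>x. q n x \<partial>lborel) = 0" for n
  proof -
    obtain C where C: "0 \<le> C" "\<And>x. x \<in> cball 0 R \<Longrightarrow> \<bar>F x\<bar> \<le> C"
      using compact_abs_bound[OF compact_cball continuous_on_subset[OF contF]] by (metis subset_UNIV)
    have int: "integrable lborel F"
    proof (rule Bochner_Integration.integrable_bound)
      show "integrable lborel (\<lambda>x::'a. C * indicat_real (cball 0 R) x)"
        by (intro integrable_mult_right integrable_real_indicator) (use emeasure_bounded_finite[OF bounded_cball] in simp_all)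
      show "AE x in lborel. norm (F x) \<le> norm (C * indicat_real (cball 0 R) x)"
      proof (rule AE_I2)
        fix x show "norm (F x) \<le> norm (C * indicat_real (cball 0 R) x)"
          using C(1) C(2)[of x] zero[of x] by (cases "R < norm x") auto
      qed
    qed (use meas in auto)
    let ?c = "inverse (real (Suc n)) *\<^sub>R e"
    have int': "integrable (distr lborel borel ((+) ?c)) F" using int by (simp add: lborel_distr_plus)
    have "integrable lborel (\<lambda>x. F (?c + x))"
      using int' meas by (subst (asm) integrable_distr_eq) auto
    moreover have "(\<integral>x. F (?c + x) \<partial>lborel) = (\<integral>x. F x \<partial>lborel)"
    proof -
      have "(\<integral>x. F x \<partial>lborel) = (\<integral>x. F x \<partial>distr lborel borel ((+) ?c))" by (simp add: lborel_distr_plus)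
      also have "\<dots> = (\<integral>x. F (?c + x) \<partial>lborel)" by (rule integral_distr) (use meas in auto)
      finally show ?thesis by simp
    qed
    ultimately show ?thesis unfolding q_def using int by simp
  qed
  with lim show ?thesis by (simp add: LIMSEQ_const_iff)
qed

text \<open>Extending \<open>G\<close> by zero gives a function to which the result on the whole
  space applies: the open sets \<open>\<Omega>\<close> and \<open>- S\<close> cover the space, the
  extension is \<open>G\<close> on the first and 0 on the second.\<close>

lemma integral_pd_eq_0_compact_support:
  fixes G :: "'a::euclidean_space \<Rightarrow> real"
  assumes \<Omega>: "open \<Omega>" and S: "compact S" "S \<subseteq> \<Omega>"
    and diff: "\<And>x. x \<in> \<Omega> \<Longrightarrow> G differentiable at x" and cont: "continuous_on \<Omega> (pd e G)"
    and zero: "\<And>x. x \<in> \<Omega> - S \<Longrightarrow> G x = 0"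
  shows "(\<integral>x. pd e G x \<partial>vol \<Omega>) = 0"
proof -
  define F where "F x = (if x \<in> \<Omega> then G x else 0)" for x
  have oS: "open (- S)" using S(1) by (simp add: compact_imp_closed open_Compl)
  have U: "\<Omega> \<union> - S = UNIV" using S by auto
  have F0: "F x = 0" if "x \<in> - S" for x using that zero by (auto simp: F_def)
  have d1: "F differentiable at x" "pd e F x = pd e G x" if "x \<in> \<Omega>" for x
    by (rule differentiable_transform_open[OF diff[OF that] \<Omega> that], simp add: F_def)
       (rule pd_cong_open[OF \<Omega> that], simp add: F_def)
  have d2: "F differentiable at x" "pd e F x = 0" if "x \<in> - S" for x
  proof -
    show "F differentiable at x"
      by (rule differentiable_transform_open[OF differentiable_const oS that]) (simp add: F0)
    have "pd e F x = pd e (\<lambda>x. 0) x" by (rule pd_cong_open[OF oS that]) (simp add: F0)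
    then show "pd e F x = 0" by simp
  qed
  from S(1) obtain R where R: "\<And>x. x \<in> S \<Longrightarrow> norm x \<le> R"
    using compact_imp_bounded bounded_iff by metis
  have "continuous_on (\<Omega> \<union> - S) (pd e F)"
  proof (intro continuous_on_open_Un \<Omega> oS)
    show "continuous_on \<Omega> (pd e F)" using cont d1 by (simp cong: continuous_on_cong)
    show "continuous_on (- S) (pd e F)"
      using d2(2) continuous_on_const[of "- S" "0::real"] by (subst continuous_on_cong[OF refl]) auto
  qed
  then have "(\<integral>x. pd e F x \<partial>lborel) = 0"
    by (intro integral_pd_eq_0[where R=R]) (use U d1 d2 R F0 in \<open>auto, force\<close>)
  moreover have "pd e F x = indicat_real \<Omega> x *\<^sub>R pd e G x" for x
    using d1(2)[of x] d2(2)[of x] S by (cases "x \<in> \<Omega>") auto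
  ultimately show ?thesis using \<Omega> by (subst integral_restrict_space) auto
qed

text \<open>Differentiation under the integral sign by dominated convergence along sequences: the
  mean value inequality bounds every difference quotient by \<open>B\<close>, and a constant is
  integrable over a finite measure.\<close>

lemma has_real_derivative_integral:
  fixes g :: "'a \<Rightarrow> real \<Rightarrow> real"
  assumes "finite_measure M"
    and meas: "\<And>s. s \<in> {a<..<b} \<Longrightarrow> integrable M (\<lambda>x. g x s)" "(\<lambda>x. g' x t) \<in> borel_measurable M"
    and der: "\<And>x s. x \<in> space M \<Longrightarrow> s \<in> {a<..<b} \<Longrightarrow> ((\<lambda>s. g x s) has_real_derivative g' x s) (at s)"
    and bd: "\<And>x s. x \<in> space M \<Longrightarrow> s \<in> {a<..<b} \<Longrightarrow> \<bar>g' x s\<bar> \<le> B"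
    and t: "t \<in> {a<..<b}"
  shows "((\<lambda>s. \<integral>x. g x s \<partial>M) has_real_derivative (\<integral>x. g' x t \<partial>M)) (at t)"
proof -
  interpret finite_measure M by fact
  have "((\<lambda>y. ((\<integral>x. g x y \<partial>M) - (\<integral>x. g x t \<partial>M)) / (y - t)) \<longlongrightarrow> (\<integral>x. g' x t \<partial>M)) (at t within {a<..<b})"
  proof (subst tendsto_at_iff_sequentially, intro allI impI)
    fix X assume X: "\<forall>i::nat. X i \<in> {a<..<b} - {t}" "X \<longlonglongrightarrow> t"
    have eq: "((\<integral>x. g x (X n) \<partial>M) - (\<integral>x. g x t \<partial>M)) / (X n - t) = (\<integral>x. (g x (X n) - g x t) / (X n - t) \<partial>M)" for n
      using meas(1)[of "X n"] meas(1)[OF t] X by (simp add: Bochner_Integration.integral_diff)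
    have "(\<lambda>n. \<integral>x. (g x (X n) - g x t) / (X n - t) \<partial>M) \<longlonglongrightarrow> (\<integral>x. g' x t \<partial>M)"
    proof (rule integral_dominated_convergence[where w="\<lambda>x. B"])
      show "(\<lambda>x. g' x t) \<in> borel_measurable M" by fact
      show "(\<lambda>x. (g x (X n) - g x t) / (X n - t)) \<in> borel_measurable M" for n
        using borel_measurable_integrable[OF meas(1)[of "X n"]] borel_measurable_integrable[OF meas(1)[OF t]] X
        by auto
      show "AE x in M. (\<lambda>n. (g x (X n) - g x t) / (X n - t)) \<longlonglongrightarrow> g' x t"
      proof (rule AE_I2)
        fix x assume "x \<in> space M"
        from der[OF this t] have "((\<lambda>y. (g x y - g x t) / (y - t)) \<longlongrightarrow> g' x t) (at t)"
          by (simp add: has_field_derivative_iff)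
        moreover have "filterlim X (at t) sequentially" using X by (auto simp: filterlim_at)
        ultimately show "(\<lambda>n. (g x (X n) - g x t) / (X n - t)) \<longlonglongrightarrow> g' x t" by (rule filterlim_compose)
      qed
      show "AE x in M. norm ((g x (X n) - g x t) / (X n - t)) \<le> B" for n
      proof (rule AE_I2)
        fix x assume x: "x \<in> space M"
        have "norm (g x (X n) - g x t) \<le> B * norm (X n - t)"
        proof (rule field_differentiable_bound[of "{a<..<b}" "g x" "g' x"])
          show "(g x has_real_derivative g' x z) (at z within {a<..<b})" if "z \<in> {a<..<b}" for z
            using der[OF x that] by (rule has_field_derivative_at_within)
        qed (use X t bd[OF x] in auto)
        moreover have "X n \<noteq> t" using X by auto
        ultimately show "norm ((g x (X n) - g x t) / (X n - t)) \<le> B" by (simp add: field_simps)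
      qed
    qed simp
    then show "((\<lambda>y. ((\<integral>x. g x y \<partial>M) - (\<integral>x. g x t \<partial>M)) / (y - t)) \<circ> X) \<longlonglongrightarrow> (\<integral>x. g' x t \<partial>M)"
      by (simp add: o_def eq)
  qed
  then show ?thesis
    using t by (simp add: has_field_derivative_iff at_within_open[OF t])
qed

text \<open>Continuity of the extension at a boundary point also involves other boundary points
  \<open>y\<close>. Each \<open>g y\<close> is approximated by a value of \<open>f\<close> at a
  point of \<open>S\<close> near \<open>y\<close>, so two errors of half size add up. It serves to
  extend the flux field to the closed domain.\<close>

lemma continuous_extension_closure:
  fixes f :: "'a::metric_space \<Rightarrow> 'b::metric_space"
  assumes "\<And>x. x \<in> closure S \<Longrightarrow> \<exists>l. (f \<longlongrightarrow> l) (at x within S)" "continuous_on S f"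
  obtains g where "continuous_on (closure S) g" "\<And>x. x \<in> S \<Longrightarrow> g x = f x"
    "\<And>x. x \<in> closure S \<Longrightarrow> (f \<longlongrightarrow> g x) (at x within S)"
proof -
  define g where "g x = (if x \<in> S then f x else SOME l. (f \<longlongrightarrow> l) (at x within S))" for x
  have lim: "(f \<longlongrightarrow> g x) (at x within S)" if "x \<in> closure S" for x
    using someI_ex[OF assms(1)[OF that]] assms(2) by (auto simp: g_def continuous_on_def)
  have key: "\<exists>d>0. \<forall>y\<in>S. dist y x < d \<longrightarrow> dist (f y) (g x) < e" if "x \<in> closure S" "e > 0" for x e
  proof -
    from lim[OF that(1)] that(2) obtain d where "d > 0"
      "\<And>y. y \<in> S \<Longrightarrow> 0 < dist y x \<Longrightarrow> dist y x < d \<Longrightarrow> dist (f y) (g x) < e"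
      unfolding Lim_within by blast
    moreover have "dist (f x) (g x) < e" if "x \<in> S" using that \<open>e > 0\<close> by (simp add: g_def)
    ultimately show ?thesis by (metis zero_less_dist_iff)
  qed
  have "continuous_on (closure S) g"
    unfolding continuous_on_iff
  proof (intro ballI allI impI)
    fix x e assume x: "x \<in> closure S" and e: "(e::real) > 0"
    from key[OF x, of "e/2"] e obtain d where d: "d > 0" "\<And>y. y \<in> S \<Longrightarrow> dist y x < d \<Longrightarrow> dist (f y) (g x) < e/2"
      by auto
    have "dist (g y) (g x) < e" if y: "y \<in> closure S" "dist y x < d" for y
    proof -
      from key[OF y(1), of "e/2"] e obtain d' where d': "d' > 0" "\<And>z. z \<in> S \<Longrightarrow> dist z y < d' \<Longrightarrow> dist (f z) (g y) < e/2"
        by auto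
      \<comment> \<open>The second entry of the minimum keeps \<open>z\<close> within distance
        \<open>d\<close> of \<open>x\<close>, the first makes \<open>f z\<close> close to
        \<open>g y\<close>.\<close>
      from y(1) d'(1) y(2) obtain z where z: "z \<in> S" "dist z y < min d' (d - dist y x)"
        unfolding closure_approachable by (metis diff_gt_0_iff_gt min_less_iff_conj)
      have "dist z x < d" using z(2) dist_triangle[of z x y] by linarith
      then have "dist (f z) (g x) < e/2" "dist (f z) (g y) < e/2" using z d d' by auto
      then show ?thesis using dist_triangle_half_r by blast
    qed
    then show "\<exists>d>0. \<forall>y\<in>closure S. dist y x < d \<longrightarrow> dist (g y) (g x) < e" using d(1) by blast
  qed
  then show ?thesis using that[of g] lim by (auto simp: g_def)
qed

text \<open>The supporting line of \<open>g\<close> at the mean is integrated against the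
  probability density \<open>p\<close>. A function convex on the closed half-line may have no
  supporting line at 0, whence the assumption that the mean is positive.\<close>

lemma jensen_weighted:
  fixes v p :: "'a \<Rightarrow> real"
  assumes g: "convex_on {0..} g"
    and int: "integrable M p" "integrable M (\<lambda>x. v x * p x)" "integrable M (\<lambda>x. g (v x) * p x)"
    and p: "(\<integral>x. p x \<partial>M) = 1" "\<And>x. x \<in> space M \<Longrightarrow> 0 \<le> p x"
    and v: "\<And>x. x \<in> space M \<Longrightarrow> 0 \<le> v x" and m: "0 < (\<integral>x. v x * p x \<partial>M)"
  shows "g (\<integral>x. v x * p x \<partial>M) \<le> (\<integral>x. g (v x) * p x \<partial>M)"
proof -
  define m where "m = (\<integral>x. v x * p x \<partial>M)"
  \<comment> \<open>The infimum of the chord slopes to the right of \<open>m\<close>, that is, the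
    right derivative of \<open>g\<close> there.\<close>
  define k where "k = Inf ((\<lambda>t. (g m - g t) / (m - t)) ` ({m<..} \<inter> {0..}))"
  have k: "g y \<ge> g m + k * (y - m)" if "y \<ge> 0" for y
    unfolding k_def by (rule convex_le_Inf_differential[OF g]) (use that assms(8) m_def in auto)
  have "(\<integral>x. (g m - k * m) * p x + k * (v x * p x) \<partial>M) \<le> (\<integral>x. g (v x) * p x \<partial>M)"
  proof (rule integral_mono)
    fix x assume x: "x \<in> space M"
    have "(g m + k * (v x - m)) * p x \<le> g (v x) * p x"
      by (rule mult_right_mono[OF k[OF v[OF x]] p(2)[OF x]])
    then show "(g m - k * m) * p x + k * (v x * p x) \<le> g (v x) * p x" by (simp add: algebra_simps)
  qed (use int in auto)
  moreover have "(\<integral>x. (g m - k * m) * p x + k * (v x * p x) \<partial>M) = g m"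
    using int p(1) by (subst Bochner_Integration.integral_add) (auto simp: m_def[symmetric])
  ultimately show ?thesis by (simp add: m_def)
qed

lemma integrable_vol_compact_support:
  fixes h :: "'a::euclidean_space \<Rightarrow> real"
  assumes "open \<Omega>" "bounded \<Omega>" "compact S" "S \<subseteq> \<Omega>" "continuous_on \<Omega> h" "\<And>x. x \<in> \<Omega> - S \<Longrightarrow> h x = 0"
  shows "integrable (vol \<Omega>) h"
proof -
  obtain B where "0 \<le> B" "\<And>x. x \<in> S \<Longrightarrow> \<bar>h x\<bar> \<le> B"
    by (rule compact_abs_bound[OF assms(3) continuous_on_subset[OF assms(5,4)]]) blast
  with assms(6) have "\<bar>h x\<bar> \<le> B" if "x \<in> \<Omega>" for x using that by (cases "x \<in> S") auto
  then show ?thesis by (intro integrable_vol[OF assms(1,2) measurable_vol[OF assms(5)], of B])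
qed

text \<open>For each coordinate the product \<open>g x * (W x \<bullet> b)\<close> is supported in
  \<open>S\<close> and its partial derivative integrates to 0. Nothing is asked of \<open>W\<close>
  near the boundary, where the divergence may fail to be integrable.\<close>

lemma integral_by_parts_divergence:
  fixes g :: "'a::euclidean_space \<Rightarrow> real" and W :: "'a \<Rightarrow> 'a"
  assumes \<Omega>: "open \<Omega>" "bounded \<Omega>" and S: "compact S" "S \<subseteq> \<Omega>"
    and g: "\<And>x. x \<in> \<Omega> \<Longrightarrow> g differentiable at x" "\<And>b. b \<in> Basis \<Longrightarrow> continuous_on \<Omega> (pd b g)"
    and g0: "\<And>x. x \<in> \<Omega> - S \<Longrightarrow> g x = 0"
    and W: "\<And>x b. x \<in> \<Omega> \<Longrightarrow> b \<in> Basis \<Longrightarrow> (\<lambda>y. W y \<bullet> b) differentiable at x"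
           "\<And>b. b \<in> Basis \<Longrightarrow> continuous_on \<Omega> (pd b (\<lambda>y. W y \<bullet> b))"
  shows "integrable (vol \<Omega>) (\<lambda>x. g x * (\<Sum>b\<in>Basis. pd b (\<lambda>y. W y \<bullet> b) x))"
    and "(\<integral>x. g x * (\<Sum>b\<in>Basis. pd b (\<lambda>y. W y \<bullet> b) x) \<partial>vol \<Omega>)
       = - (\<integral>x. grad g x \<bullet> W x \<partial>vol \<Omega>)"
proof -
  let ?M = "vol \<Omega>"
  note int = integrable_vol_compact_support[OF \<Omega> S]
  have oS: "open (\<Omega> - S)" using \<Omega> S by (simp add: open_Diff compact_imp_closed)
  have pg0: "pd b g x = 0" if "x \<in> \<Omega> - S" for b x
  proof -
    have "pd b g x = pd b (\<lambda>x. 0) x" by (rule pd_cong_open[OF oS that]) (simp add: g0)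
    then show ?thesis by simp
  qed
  have cg: "continuous_on \<Omega> g" "continuous_on \<Omega> (\<lambda>y. W y \<bullet> b)" if "b \<in> Basis" for b
    using g(1) W(1) that by (auto intro!: differentiable_at_imp_continuous_on)
  have i1: "integrable ?M (\<lambda>x. g x * pd b (\<lambda>y. W y \<bullet> b) x)" and i2: "integrable ?M (\<lambda>x. pd b g x * (W x \<bullet> b))"
    if "b \<in> Basis" for b
    by (rule int; use that cg g W g0 pg0 in \<open>auto intro!: continuous_on_mult\<close>)+
  have b: "(\<integral>x. g x * pd b (\<lambda>y. W y \<bullet> b) x \<partial>?M) = - (\<integral>x. pd b g x * (W x \<bullet> b) \<partial>?M)" if "b \<in> Basis" for b
  proof -
    have pd: "pd b (\<lambda>x. g x * (W x \<bullet> b)) x = g x * pd b (\<lambda>y. W y \<bullet> b) x + pd b g x * (W x \<bullet> b)" if "x \<in> \<Omega>" for x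
      by (rule pd_mult) (use g W that \<open>b \<in> Basis\<close> in auto)
    have "(\<integral>x. pd b (\<lambda>x. g x * (W x \<bullet> b)) x \<partial>?M) = 0"
    proof (rule integral_pd_eq_0_compact_support[OF \<Omega>(1) S])
      show "continuous_on \<Omega> (pd b (\<lambda>x. g x * (W x \<bullet> b)))"
        using g W cg that
        by (simp add: pd cong: continuous_on_cong) (intro continuous_on_add continuous_on_mult; blast)
    qed (use g W g0 that in auto)
    also have "(\<integral>x. pd b (\<lambda>x. g x * (W x \<bullet> b)) x \<partial>?M)
        = (\<integral>x. g x * pd b (\<lambda>y. W y \<bullet> b) x + pd b g x * (W x \<bullet> b) \<partial>?M)"
      by (rule Bochner_Integration.integral_cong) (auto simp: pd)
    finally show ?thesis using i1[OF that] i2[OF that] by simp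
  qed
  show "integrable ?M (\<lambda>x. g x * (\<Sum>b\<in>Basis. pd b (\<lambda>y. W y \<bullet> b) x))"
    unfolding sum_distrib_left using i1 by auto
  have eq: "grad g x \<bullet> W x = (\<Sum>b\<in>Basis. pd b g x * (W x \<bullet> b))" for x
    by (simp add: grad_def inner_sum_left inner_commute[of "W x"])
  show "(\<integral>x. g x * (\<Sum>b\<in>Basis. pd b (\<lambda>y. W y \<bullet> b) x) \<partial>?M) = - (\<integral>x. grad g x \<bullet> W x \<partial>?M)"
    unfolding sum_distrib_left eq using i1 i2 b
    by (simp add: Bochner_Integration.integral_sum sum_negf)
qed

section \<open>Cutoffs near the boundary\<close>

lemma Ck_on_Suc_D: "open S \<Longrightarrow> Ck_on (Suc k) S f \<Longrightarrow> Ck_on k S f"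
proof (induction k arbitrary: f)
  case 0
  then show ?case by (auto intro: differentiable_imp_continuous_on)
next
  case (Suc k)
  then show ?case by (metis Ck_on.simps(2))
qed

text \<open>A negative value would put \<open>p\<close> into the open set \<open>\<Omega>\<close>; a
  positive one would give \<open>p\<close> a neighbourhood disjoint from
  \<open>\<Omega>\<close>.\<close>

lemma local_defining_function_zero:
  fixes \<rho> :: "'a::euclidean_space \<Rightarrow> real"
  assumes "open \<Omega>" "p \<in> frontier \<Omega>" "open U" "p \<in> U" "continuous_on U \<rho>" "\<Omega> \<inter> U = {x \<in> U. \<rho> x < 0}"
  shows "\<rho> p = 0"
proof -
  have "p \<notin> \<Omega>" using assms(1,2) by (simp add: frontier_def interior_open)
  then have "\<not> \<rho> p < 0" using assms by blast
  moreover have False if "\<rho> p > 0"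
  proof -
    have "open {x \<in> U. \<rho> x \<in> {0<..}}"
      using continuous_open_preimage[OF assms(5,3) open_greaterThan, of 0] by (simp add: vimage_def Int_def)
    moreover have "p \<in> closure \<Omega>" using assms(2) by (simp add: frontier_def)
    ultimately obtain x where x: "x \<in> \<Omega>" "x \<in> U" "\<rho> x > 0"
      using open_Int_closure_eq_empty[of "{x \<in> U. \<rho> x \<in> {0<..}}" \<Omega>] \<open>\<rho> p > 0\<close> assms(4) by blast
    then have "x \<in> {x \<in> U. \<rho> x < 0}" unfolding assms(6)[symmetric] by blast
    with x show False by simp
  qed
  ultimately show ?thesis by force
qed

text \<open>If the unit normals n1 and n2 differed, then along \<open>v = n2 - n1\<close> the first
  defining function would decrease from 0 and the second increase, so that
  \<open>p + h *\<^sub>R v\<close> with small positive \<open>h\<close> would lie both inside and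
  outside \<open>\<Omega>\<close>. This makes the description in \<open>outer_normal\<close> well
  defined.\<close>

lemma local_defining_function_normal_unique:
  fixes p :: "'a::euclidean_space"
  assumes \<Omega>: "open \<Omega>" "p \<in> frontier \<Omega>"
    and "local_defining_function 1 \<Omega> p \<rho>\<^sub>1" "local_defining_function 1 \<Omega> p \<rho>\<^sub>2"
  shows "sgn (grad \<rho>\<^sub>1 p) = sgn (grad \<rho>\<^sub>2 p)"
proof (rule ccontr)
  obtain U1 where 1: "open U1" "p \<in> U1" "Ck_on 1 U1 \<rho>\<^sub>1" "grad \<rho>\<^sub>1 p \<noteq> 0" "\<Omega> \<inter> U1 = {x \<in> U1. \<rho>\<^sub>1 x < 0}"
    using assms(3) by (auto simp: local_defining_function_def)
  obtain U2 where 2: "open U2" "p \<in> U2" "Ck_on 1 U2 \<rho>\<^sub>2" "grad \<rho>\<^sub>2 p \<noteq> 0" "\<Omega> \<inter> U2 = {x \<in> U2. \<rho>\<^sub>2 x < 0}"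
    using assms(4) by (auto simp: local_defining_function_def)
  define n1 n2 where "n1 = sgn (grad \<rho>\<^sub>1 p)" and "n2 = sgn (grad \<rho>\<^sub>2 p)"
  assume "sgn (grad \<rho>\<^sub>1 p) \<noteq> sgn (grad \<rho>\<^sub>2 p)"
  then have ne: "n1 \<noteq> n2" by (simp add: n1_def n2_def)
  have n: "norm n1 = 1" "norm n2 = 1" using 1 2 by (auto simp: n1_def n2_def norm_sgn)
  have "0 < norm (n1 - n2) ^ 2" using ne by simp
  also have "norm (n1 - n2) ^ 2 = 2 - 2 * (n1 \<bullet> n2)"
    using n by (simp add: power2_norm_eq_inner inner_diff_left inner_diff_right inner_commute norm_eq_1)
  finally have lt: "n1 \<bullet> n2 < 1" by simp
  define v where "v = n2 - n1"
  have g1: "grad \<rho>\<^sub>1 p = norm (grad \<rho>\<^sub>1 p) *\<^sub>R n1" and g2: "grad \<rho>\<^sub>2 p = norm (grad \<rho>\<^sub>2 p) *\<^sub>R n2"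
    using 1(4) 2(4) by (simp_all add: n1_def n2_def sgn_div_norm)
  have v1: "grad \<rho>\<^sub>1 p \<bullet> v < 0"
    by (subst g1) (use lt n 1(4) in \<open>simp add: v_def inner_diff_right norm_eq_1 mult_less_0_iff\<close>)
  have v2: "0 < grad \<rho>\<^sub>2 p \<bullet> v"
    by (subst g2) (use lt n 2(4) in \<open>simp add: v_def inner_diff_right norm_eq_1 inner_commute\<close>)
  have d: "((\<lambda>s. \<rho> (p + s *\<^sub>R v)) has_real_derivative grad \<rho> p \<bullet> v) (at 0)"
    if "open U" "p \<in> U" "Ck_on 1 U \<rho>" for \<rho> :: "'a \<Rightarrow> real" and U
  proof -
    have df: "\<rho> differentiable at p" using that by (simp add: differentiable_on_eq_differentiable_at)
    interpret D: bounded_linear "frechet_derivative \<rho> (at p)"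
      by (rule has_derivative_bounded_linear[OF has_derivative_frechet[OF df]])
    have "((\<lambda>s. p + s *\<^sub>R v) has_derivative (\<lambda>h. h *\<^sub>R v)) (at 0)"
      by (auto intro!: derivative_eq_intros)
    from has_derivative_compose[OF this, of \<rho> "frechet_derivative \<rho> (at p)"] has_derivative_frechet[OF df]
    have "((\<lambda>s. \<rho> (p + s *\<^sub>R v)) has_derivative (\<lambda>h. frechet_derivative \<rho> (at p) (h *\<^sub>R v))) (at 0)" by simp
    moreover have "(\<lambda>h. frechet_derivative \<rho> (at p) (h *\<^sub>R v)) = (*) (grad \<rho> p \<bullet> v)"
      using pd_linear[OF df, of v] by (simp add: fun_eq_iff D.scaleR pd_def)
    ultimately show ?thesis by (simp add: has_field_derivative_def)
  qed
  have z: "\<rho>\<^sub>1 p = 0" "\<rho>\<^sub>2 p = 0"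
    by (rule local_defining_function_zero[OF \<Omega> 1(1,2) _ 1(5)] local_defining_function_zero[OF \<Omega> 2(1,2) _ 2(5)],
        use Ck_on_Suc_D[of _ 0] 1 2 in auto)+
  obtain d1 where d1: "d1 > 0" "\<And>h. 0 < h \<Longrightarrow> h < d1 \<Longrightarrow> \<rho>\<^sub>1 (p + h *\<^sub>R v) < 0"
    using DERIV_neg_dec_right[OF d[OF 1(1-3)] v1] z by auto
  obtain d2 where d2: "d2 > 0" "\<And>h. 0 < h \<Longrightarrow> h < d2 \<Longrightarrow> 0 < \<rho>\<^sub>2 (p + h *\<^sub>R v)"
    using DERIV_pos_inc_right[OF d[OF 2(1-3)] v2] z by auto
  have "((\<lambda>h. p + h *\<^sub>R v) \<longlongrightarrow> p + 0 *\<^sub>R v) (at_right 0)" by (intro tendsto_intros)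
  then have "\<forall>\<^sub>F h in at_right 0. p + h *\<^sub>R v \<in> U1 \<inter> U2"
    using 1(1,2) 2(1,2) by (auto simp: tendsto_def)
  moreover have "\<forall>\<^sub>F h in at_right 0. 0 < h \<and> h < min d1 d2"
    using d1 d2 by (auto simp: eventually_at_right intro!: exI[of _ "min d1 d2"])
  ultimately have "\<forall>\<^sub>F h in at_right (0::real). False"
  proof eventually_elim
    case (elim h)
    then have "\<rho>\<^sub>1 (p + h *\<^sub>R v) < 0" "0 < \<rho>\<^sub>2 (p + h *\<^sub>R v)" using d1 d2 by auto
    then have "p + h *\<^sub>R v \<in> {x \<in> U1. \<rho>\<^sub>1 x < 0}" "p + h *\<^sub>R v \<notin> {x \<in> U2. \<rho>\<^sub>2 x < 0}"
      using elim by auto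
    then show False using elim unfolding 1(5)[symmetric] 2(5)[symmetric] by blast
  qed
  then show False by simp
qed

lemma outer_normal_eq:
  assumes "open \<Omega>" "p \<in> frontier \<Omega>" "local_defining_function 1 \<Omega> p \<rho>"
  shows "outer_normal \<Omega> p = sgn (grad \<rho> p)"
  unfolding outer_normal_def
  by (rule the_equality) (use assms local_defining_function_normal_unique[OF assms(1,2)] in blast)+

text \<open>\<open>\<Omega> \<inter> U\<close> and \<open>\<Omega> - C\<close> form an open cover of
  \<open>\<Omega>\<close>. The lemma is needed because a defining function is under control only on
  its neighbourhood \<open>U\<close>, while the cutoffs built from it live on all of
  \<open>\<Omega>\<close>.\<close>

lemma continuous_on_zero_extension:
  fixes h :: "'a::topological_space \<Rightarrow> real"
  assumes "open \<Omega>" "open U" "closed C" "C \<subseteq> U" "continuous_on (\<Omega> \<inter> U) h"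
    and "\<And>x. x \<in> \<Omega> - C \<Longrightarrow> h x = 0"
  shows "continuous_on \<Omega> h"
proof -
  have "continuous_on ((\<Omega> \<inter> U) \<union> (\<Omega> - C)) h"
  proof (rule continuous_on_open_Un)
    show "continuous_on (\<Omega> - C) h" using assms(6) continuous_on_const by (subst continuous_on_cong[OF refl]) auto
  qed (use assms in auto)
  moreover have "(\<Omega> \<inter> U) \<union> (\<Omega> - C) = \<Omega>" using assms(4) by auto
  ultimately show ?thesis by simp
qed

text \<open>A compactly supported replacement of \<open>\<zeta>\<close> from below, close to it in
  mean. The same \<open>g\<close> has to satisfy the flux inequality at all times in
  \<open>J\<close>: it becomes part of a weight that does not depend on time.\<close>

definition flux_cutoff ::
    "'a::euclidean_space set \<Rightarrow> real set \<Rightarrow> ('a \<times> real \<Rightarrow> 'a) \<Rightarrow> ('a \<Rightarrow> real) \<Rightarrow> real \<Rightarrow> ('a \<Rightarrow> real) \<Rightarrow> 'a set \<Rightarrow> bool" where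
  "flux_cutoff \<Omega> J V \<zeta> e g S \<longleftrightarrow>
     compact S \<and> S \<subseteq> \<Omega> \<and> continuous_on \<Omega> g \<and> (\<forall>x\<in>\<Omega>. 0 \<le> g x \<and> g x \<le> \<zeta> x) \<and>
     (\<forall>x\<in>\<Omega>-S. g x = 0) \<and> (\<integral>x. \<zeta> x - g x \<partial>vol \<Omega>) \<le> e \<and>
     (\<forall>t\<in>J. (\<integral>x. grad \<zeta> x \<bullet> V (x, t) \<partial>vol \<Omega>) - e
        \<le> - (\<integral>x. g x * (\<Sum>b\<in>Basis. pd b (\<lambda>y. V (y, t) \<bullet> b) x) \<partial>vol \<Omega>))"

text \<open>The radius is fixed before \<open>\<zeta>\<close> and \<open>e\<close>. The functions
  \<open>\<zeta>\<close> are the members of a partition of unity subordinate to these balls and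
  exist only after the radii have been chosen.\<close>

definition cutoff_ball :: "'a::euclidean_space set \<Rightarrow> real set \<Rightarrow> ('a \<times> real \<Rightarrow> 'a) \<Rightarrow> 'a \<Rightarrow> real \<Rightarrow> bool" where
  "cutoff_ball \<Omega> J V p r \<longleftrightarrow> 0 < r \<and>
     (\<forall>\<zeta> Q e. open Q \<and> closure \<Omega> \<subseteq> Q \<and> (\<forall>x\<in>Q. \<zeta> differentiable at x) \<and> (\<forall>b. continuous_on Q (pd b \<zeta>)) \<and>
        (\<forall>x. 0 \<le> \<zeta> x) \<and> (\<forall>x. x \<notin> ball p r \<longrightarrow> \<zeta> x = 0) \<and> 0 < e \<longrightarrow>
        (\<exists>g S. flux_cutoff \<Omega> J V \<zeta> e g S))"

text \<open>The inequality in \<open>flux_cutoff\<close> is the weak form of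
  $-\int_\Omega \zeta\,\mathrm{div} V \ge \int_\Omega \nabla\zeta\cdot V$, which holds when \<open>V\<close> points
  inwards on the boundary. The cutoff \<open>\<zeta> * step (- \<rho> / \<delta>)\<close> contributes a boundary layer term
  $\frac1\delta\int \zeta\, step'(-\rho/\delta)\,\nabla\rho\cdot V$; its total mass is controlled by one more
  integration by parts, in the normal direction at \<open>p\<close>.\<close>

lemma boundary_cutoff:
  fixes V :: "'a::euclidean_space \<times> real \<Rightarrow> 'a"
  assumes \<Omega>: "open \<Omega>" "bounded \<Omega>" and p: "p \<in> frontier \<Omega>"
    and ldf: "local_defining_function 1 \<Omega> p \<rho>" and J: "compact J"
    and V: "continuous_on (closure \<Omega> \<times> J) V"
    and dV: "\<And>t x b. t \<in> J \<Longrightarrow> x \<in> \<Omega> \<Longrightarrow> b \<in> Basis \<Longrightarrow> (\<lambda>y. V (y, t) \<bullet> b) differentiable at x"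
       "\<And>t b. t \<in> J \<Longrightarrow> b \<in> Basis \<Longrightarrow> continuous_on \<Omega> (pd b (\<lambda>y. V (y, t) \<bullet> b))"
    and flux: "\<And>x t. x \<in> frontier \<Omega> \<Longrightarrow> t \<in> J \<Longrightarrow> V (x, t) \<bullet> outer_normal \<Omega> x \<le> 0"
  shows "\<exists>r. cutoff_ball \<Omega> J V p r"
proof -
  let ?M = "vol \<Omega>"
  interpret M: finite_measure ?M by (rule finite_measure_vol[OF \<Omega>])
  obtain U where U: "open U" "p \<in> U" "Ck_on 1 U \<rho>" "grad \<rho> p \<noteq> 0" "\<Omega> \<inter> U = {x \<in> U. \<rho> x < 0}"
    using ldf by (auto simp: local_defining_function_def)
  have dr: "\<rho> differentiable at x" if "x \<in> U" for x
    using U(1,3) that by (simp add: differentiable_on_eq_differentiable_at)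
  have cr: "continuous_on U \<rho>" using Ck_on_Suc_D[OF U(1), of 0] U(3) by simp
  have cgr: "continuous_on U (grad \<rho>)"
    using U(3) unfolding grad_def by (auto intro!: continuous_intros)
  have cpr: "continuous_on U (pd b \<rho>)" for b
    using pd_linear[OF dr] cgr by (simp cong: continuous_on_cong) (intro continuous_intros)
  \<comment> \<open>The derivative of \<open>\<rho>\<close> in the fixed direction \<open>n\<close>
    equals \<open>2 * c\<close> at \<open>p\<close>, hence exceeds \<open>c\<close> on a small ball
    by continuity. A fixed direction is preferred to the varying gradient, which is only continuous
    and could not be integrated by parts.\<close>
  define n where "n = grad \<rho> p"
  define c where "c = (n \<bullet> n) / 2"
  have c: "c > 0" using U(4) by (simp add: c_def n_def)
  have "open {x \<in> U. pd n \<rho> x \<in> {c<..}}"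
    using continuous_open_preimage[OF cpr U(1) open_greaterThan, of n c] by (simp add: vimage_def Int_def)
  moreover have "p \<in> {x \<in> U. pd n \<rho> x \<in> {c<..}}"
    using U(2,4) pd_linear[OF dr[OF U(2)], of n] c by (simp add: c_def n_def)
  ultimately obtain r where r: "r > 0" "cball p r \<subseteq> {x \<in> U. pd n \<rho> x \<in> {c<..}}"
    using open_contains_cball by blast
  let ?C = "cball p r"
  have CU: "?C \<subseteq> U" and Cc: "\<And>x. x \<in> ?C \<Longrightarrow> c < pd n \<rho> x" using r by auto
  \<comment> \<open>On the ball the gradient of \<open>\<rho>\<close> does not vanish, so
    \<open>\<rho>\<close> is a defining function at every boundary point there, and the sign
    condition on \<open>outer_normal\<close> becomes one on \<open>grad \<rho>\<close>.\<close>
  have flux': "V (x, t) \<bullet> grad \<rho> x \<le> 0" if "x \<in> frontier \<Omega>" "x \<in> ?C" "t \<in> J" for x t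
  proof -
    have "grad \<rho> x \<noteq> 0" using Cc[OF that(2)] c pd_linear[OF dr, of x n] that(2) CU by auto
    then have "local_defining_function 1 \<Omega> x \<rho>"
      using U that CU by (auto simp: local_defining_function_def)
    from outer_normal_eq[OF \<Omega>(1) that(1) this] flux[OF that(1,3)]
    have "V (x, t) \<bullet> sgn (grad \<rho> x) \<le> 0" by simp
    then show ?thesis using \<open>grad \<rho> x \<noteq> 0\<close> by (simp add: sgn_div_norm mult_le_0_iff)
  qed
  have neg: "\<rho> x < 0" if "x \<in> \<Omega>" "x \<in> U" for x using U(5) that by blast
  define K where "K = (closure \<Omega> \<inter> ?C) \<times> J"
  have K: "compact K" using J \<Omega>(2) unfolding K_def by (intro compact_Times) (auto simp: compact_Int)
  define q where "q z = V z \<bullet> grad \<rho> (fst z)" for z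
  have cq: "continuous_on K q"
    unfolding q_def
  proof (intro continuous_intros continuous_on_compose2[OF cgr])
    show "continuous_on K V" by (rule continuous_on_subset[OF V]) (auto simp: K_def)
    show "fst ` K \<subseteq> U" using CU by (auto simp: K_def)
  qed
  \<comment> \<open>The points of the compact set \<open>K\<close> at which the flux is at least
    \<open>e\<close> form a compact set without boundary points, by \<open>flux'\<close>. The
    maximum of \<open>\<rho>\<close> on it is therefore negative, and the layer above this value is
    free of such points, uniformly in time.\<close>
  have layer: "\<exists>\<delta>0>0. \<forall>x\<in>\<Omega> \<inter> ?C. \<forall>t\<in>J. - \<delta>0 < \<rho> x \<longrightarrow> V (x, t) \<bullet> grad \<rho> x < e" if "e > 0" for e
  proof -
    define K' where "K' = K \<inter> q -` {e..}"
    have K': "compact K'"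
      unfolding K'_def
      using continuous_closed_preimage[OF cq compact_imp_closed[OF K] closed_atLeast, of e] K
        compact_Int_closed[of K "K \<inter> q -` {e..}"] by (simp add: Int_absorb1)
    show ?thesis
    proof (cases "K' = {}")
      case True
      then show ?thesis
        using closure_subset[of \<Omega>] by (intro exI[of _ 1]) (force simp: K'_def K_def q_def not_le)
    next
      case False
      have "continuous_on K' (\<lambda>z. \<rho> (fst z))"
        using CU by (intro continuous_on_compose2[OF cr] continuous_intros) (auto simp: K'_def K_def)
      from continuous_attains_sup[OF K' False this]
      obtain z where z: "z \<in> K'" "\<And>y. y \<in> K' \<Longrightarrow> \<rho> (fst y) \<le> \<rho> (fst z)" by auto
      have "fst z \<in> \<Omega>"
      proof (rule ccontr)
        assume "fst z \<notin> \<Omega>"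
        with z(1) have "fst z \<in> frontier \<Omega>" "fst z \<in> ?C" "snd z \<in> J"
          using \<Omega>(1) by (auto simp: K'_def K_def frontier_def interior_open)
        from flux'[OF this] z(1) that show False by (auto simp: K'_def q_def)
      qed
      then have "\<rho> (fst z) < 0" using z(1) CU by (intro neg) (auto simp: K'_def K_def)
      then show ?thesis
        using z(2) closure_subset[of \<Omega>]
        by (intro exI[of _ "- \<rho> (fst z)"]) (force simp: K'_def K_def q_def not_le)
    qed
  qed
  \<comment> \<open>For each inner point of the ball the step has reached the value 1 as soon as
    \<open>\<delta>\<close> is below half of \<open>- \<rho> x\<close>, so dominated convergence
    applies.\<close>
  have dist_lim: "((\<lambda>\<delta>. \<integral>x. indicat_real ?C x * (1 - step (- \<rho> x / \<delta>)) \<partial>?M) \<longlongrightarrow> 0) (at_right 0)"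
  proof (subst tendsto_at_iff_sequentially, intro allI impI)
    fix X assume X: "\<forall>i::nat. X i \<in> {0<..} - {0::real}" "X \<longlonglongrightarrow> 0"
    have "(\<lambda>n. \<integral>x. indicat_real ?C x * (1 - step (- \<rho> x / X n)) \<partial>?M) \<longlonglongrightarrow> (\<integral>x. 0 \<partial>?M)"
    proof (rule integral_dominated_convergence[where w="\<lambda>x. 1"])
      show "(\<lambda>x. indicat_real ?C x * (1 - step (- \<rho> x / X i)) ) \<in> borel_measurable ?M" for i
      proof -
        have "continuous_on ?C (\<lambda>x. 1 - step (- \<rho> x / X i))"
          using X continuous_on_subset[OF cr CU]
          by (intro continuous_intros continuous_on_compose2[OF continuous_on_step _ subset_UNIV]) (auto simp: less_imp_neq[THEN not_sym])
        then have "(\<lambda>x. indicat_real ?C x *\<^sub>R (1 - step (- \<rho> x / X i))) \<in> borel_measurable borel"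
          by (intro borel_measurable_continuous_on_indicator) auto
        then have "(\<lambda>x. indicat_real ?C x * (1 - step (- \<rho> x / X i))) \<in> borel_measurable lborel" by simp
        then show ?thesis by (rule measurable_restrict_space1)
      qed
      show "AE x in ?M. norm (indicat_real ?C x * (1 - step (- \<rho> x / X i))) \<le> 1" for i
        using step_bounds by (intro AE_I2) (auto simp: indicator_def)
      show "AE x in ?M. (\<lambda>i. indicat_real ?C x * (1 - step (- \<rho> x / X i))) \<longlonglongrightarrow> 0"
      proof (intro AE_I2)
        fix x assume "x \<in> space ?M"
        then have x: "x \<in> \<Omega>" by simp
        show "(\<lambda>i. indicat_real ?C x * (1 - step (- \<rho> x / X i))) \<longlonglongrightarrow> 0"
        proof (cases "x \<in> ?C")
          case True
          then have "\<rho> x < 0" using neg x CU by blast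
          then have "\<forall>\<^sub>F i in sequentially. X i < - \<rho> x / 2"
            by (intro order_tendstoD(2)[OF X(2)]) simp
          then have "\<forall>\<^sub>F i in sequentially. indicat_real ?C x * (1 - step (- \<rho> x / X i)) = 0"
          proof eventually_elim
            case (elim i)
            have "0 < X i" using X(1) by auto
            then have "2 \<le> - \<rho> x / X i" using elim by (simp add: field_simps)
            then show ?case by (simp add: step_eq)
          qed
          then show ?thesis by (rule tendsto_eventually)
        qed auto
      qed
    qed auto
    then show "((\<lambda>\<delta>. \<integral>x. indicat_real ?C x * (1 - step (- \<rho> x / \<delta>)) \<partial>?M) \<circ> X) \<longlonglongrightarrow> 0"
      by (simp add: o_def)
  qed
  show ?thesis
    unfolding cutoff_ball_def
  proof (intro exI[of _ r] conjI allI impI r(1), elim conjE)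
    fix \<zeta> :: "'a \<Rightarrow> real" and Q and e :: real
    assume Q: "open Q" "closure \<Omega> \<subseteq> Q" and dz': "\<forall>x\<in>Q. \<zeta> differentiable at x"
      and cz': "\<forall>b. continuous_on Q (pd b \<zeta>)" and z0': "\<forall>x. 0 \<le> \<zeta> x" and zb': "\<forall>x. x \<notin> ball p r \<longrightarrow> \<zeta> x = 0"
      and e: "0 < e"
    have dz: "\<zeta> differentiable at x" if "x \<in> Q" for x using dz' that by blast
    have cz: "continuous_on Q (pd b \<zeta>)" for b using cz' by blast
    have z0: "0 \<le> \<zeta> x" for x using z0' by blast
    have zb: "\<zeta> x = 0" if "x \<notin> ball p r" for x using zb' that by blast
    have \<Omega>Q: "\<Omega> \<subseteq> Q" using closure_subset Q(2) by blast
    have ccl: "compact (closure \<Omega>)" using \<Omega>(2) by (simp add: compact_closure)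
    have cgz: "continuous_on Q (grad \<zeta>)" unfolding grad_def by (intro continuous_intros cz)
    have cz': "continuous_on Q \<zeta>"
      using dz by (auto intro!: differentiable_at_imp_continuous_on)
    have pz0: "pd b \<zeta> x = 0" if "x \<notin> ?C" for b x
    proof -
      have "pd b \<zeta> x = pd b (\<lambda>x. 0) x"
        by (rule pd_cong_open[of "- ?C"]) (use that in \<open>auto intro!: zb\<close>)
      then show ?thesis by simp
    qed
    then have gz0: "grad \<zeta> x = 0" if "x \<notin> ?C" for x using that by (simp add: grad_def)
    have cw: "continuous_on (closure \<Omega> \<times> J) (\<lambda>z. grad \<zeta> (fst z) \<bullet> V z)"
      using Q(2) by (intro continuous_intros V continuous_on_compose2[OF cgz]) auto
    obtain B1 where B1: "0 \<le> B1" "\<And>z. z \<in> closure \<Omega> \<times> J \<Longrightarrow> \<bar>grad \<zeta> (fst z) \<bullet> V z\<bar> \<le> B1"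
      by (rule compact_abs_bound[OF compact_Times[OF ccl J] cw]) blast
    obtain B2 where B2: "0 \<le> B2" "\<And>x. x \<in> closure \<Omega> \<Longrightarrow> \<bar>\<zeta> x\<bar> \<le> B2"
      by (rule compact_abs_bound[OF ccl continuous_on_subset[OF cz' Q(2)]]) blast
    obtain B3 where B3: "0 \<le> B3" "\<And>x. x \<in> closure \<Omega> \<Longrightarrow> \<bar>pd n \<zeta> x\<bar> \<le> B3"
      by (rule compact_abs_bound[OF ccl continuous_on_subset[OF cz Q(2)]]) blast
    \<comment> \<open>The bound for the total mass of the boundary layer proved as
      \<open>mass\<close> below. It does not involve \<open>\<delta>\<close>, so the admissible flux
      \<open>e'\<close> can be fixed first and \<open>\<delta>\<close> afterwards.\<close>
    define C where "C = B3 * measure ?M (space ?M) / c"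
    have C: "0 \<le> C" using B3 c by (simp add: C_def)
    define e' where "e' = e / (2 * (C + 1))"
    have e': "e' > 0" "e' * C \<le> e / 2" using e C by (auto simp: e'_def field_simps)
    obtain \<delta>0 where \<delta>0: "\<delta>0 > 0"
      "\<And>x t. x \<in> \<Omega> \<Longrightarrow> x \<in> ?C \<Longrightarrow> t \<in> J \<Longrightarrow> - \<delta>0 < \<rho> x \<Longrightarrow> V (x, t) \<bullet> grad \<rho> x < e'"
      using layer[OF e'(1)] by auto
    define m where "m \<delta> = (\<integral>x. indicat_real ?C x * (1 - step (- \<rho> x / \<delta>)) \<partial>?M)" for \<delta>
    have "\<forall>\<^sub>F \<delta> in at_right 0. m \<delta> < e / (2 * (B1 + B2 + 1))"
      using order_tendstoD(2)[OF dist_lim] e B1 B2 by (auto simp: m_def)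
    \<comment> \<open>The derivative of the step lives where \<open>- \<rho> x\<close> lies between
      \<open>\<delta>\<close> and \<open>2 * \<delta>\<close>; half of \<open>\<delta>0\<close>
      keeps this strip inside the layer in which the flux is below \<open>e'\<close>.\<close>
    moreover have "\<forall>\<^sub>F \<delta> in at_right 0. 0 < \<delta> \<and> \<delta> < \<delta>0 / 2"
      using \<delta>0(1) by (auto simp: eventually_at_right intro!: exI[of _ "\<delta>0 / 2"])
    ultimately have "\<forall>\<^sub>F \<delta> in at_right 0. m \<delta> < e / (2 * (B1 + B2 + 1)) \<and> 0 < \<delta> \<and> \<delta> < \<delta>0 / 2"
      by eventually_elim auto
    then obtain \<delta> where \<delta>: "m \<delta> < e / (2 * (B1 + B2 + 1))" "0 < \<delta>" "\<delta> < \<delta>0 / 2"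
      using eventually_happens[of _ "at_right (0::real)"] by auto
    define k where "k x = step (- \<rho> x / \<delta>)" for x
    define k' where "k' x = step' (- \<rho> x / \<delta>) / \<delta>" for x
    define g where "g x = \<zeta> x * k x" for x
    define S where "S = {x \<in> closure \<Omega> \<inter> ?C. \<rho> x \<le> - \<delta>}"
    have k: "0 \<le> k x" "k x \<le> 1" "0 \<le> k' x" for x using step_bounds \<delta>(2) by (auto simp: k_def k'_def)
    have dk: "k differentiable at x" "pd b k x = - k' x * pd b \<rho> x" if "x \<in> U" for x b
    proof -
      have "((\<lambda>s. step (- s / \<delta>)) has_real_derivative - k' x) (at (\<rho> x))"
        by (rule DERIV_cong[OF DERIV_chain2[OF step_deriv, of "\<lambda>s. - s / \<delta>" "- 1 / \<delta>"]])
           (use \<delta> in \<open>auto intro!: derivative_eq_intros simp: k'_def\<close>)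
      from pd_chain[OF dr[OF that] this]
      show "k differentiable at x" "pd b k x = - k' x * pd b \<rho> x" by (simp_all add: k_def[abs_def])
    qed
    have ck: "continuous_on U k"
      using dk(1) by (auto intro!: differentiable_at_imp_continuous_on)
    have ck': "continuous_on U k'"
      unfolding k'_def using \<delta>(2) by (intro continuous_intros continuous_on_compose2[OF continuous_on_step' _ subset_UNIV] cr) auto
    \<comment> \<open>The set \<open>S\<close> is closed by construction, and it avoids the boundary
      because \<open>\<rho>\<close> is 0 there while it is at most \<open>- \<delta>\<close> on
      \<open>S\<close>.\<close>
    have Ssub: "S \<subseteq> \<Omega>"
    proof
      fix x assume x: "x \<in> S"
      show "x \<in> \<Omega>"
      proof (rule ccontr)
        assume "x \<notin> \<Omega>"
        with x have "x \<in> frontier \<Omega>" using \<Omega>(1) by (auto simp: S_def frontier_def interior_open)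
        from local_defining_function_zero[OF \<Omega>(1) this U(1) _ cr U(5)] x CU \<delta>(2) show False by (auto simp: S_def)
      qed
    qed
    have "closed S"
    proof -
      have "closed ((closure \<Omega> \<inter> ?C) \<inter> \<rho> -` {..- \<delta>})"
        using CU by (intro continuous_closed_preimage continuous_on_subset[OF cr]) auto
      also have "(closure \<Omega> \<inter> ?C) \<inter> \<rho> -` {..- \<delta>} = S" by (auto simp: S_def)
      finally show ?thesis .
    qed
    moreover have "bounded S" by (rule bounded_subset[OF bounded_cball[of p r]]) (auto simp: S_def)
    ultimately have S: "compact S" by (simp add: compact_eq_bounded_closed)
    have gS: "g x = 0" if "x \<in> \<Omega> - S" for x
    proof (cases "x \<in> ?C")
      case True
      then have "- \<delta> < \<rho> x" using that closure_subset[of \<Omega>] by (auto simp: S_def)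
      then have "- \<rho> x / \<delta> \<le> 1" using \<delta>(2) by (simp add: field_simps)
      then show ?thesis by (simp add: g_def k_def step_eq)
    next
      case False
      then show ?thesis using zb by (simp add: g_def)
    qed
    have gC: "g x = 0" if "x \<notin> ?C" for x using that zb by (simp add: g_def)
    have pg: "g differentiable at x" "pd b g x = \<zeta> x * (- k' x * pd b \<rho> x) + pd b \<zeta> x * k x" if "x \<in> \<Omega>" for b x
    proof -
      have "g differentiable at x \<and> pd b g x = \<zeta> x * (- k' x * pd b \<rho> x) + pd b \<zeta> x * k x"
      proof (cases "x \<in> U")
        case True
        with dk[of x] dz \<Omega>Q that show ?thesis unfolding g_def by (auto intro!: pd_mult simp: pd_mult)
      next
        case False
        then have x: "x \<in> - ?C" using CU by auto
        have o: "open (- ?C)" by auto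
        have "pd b g x = pd b (\<lambda>x. 0) x"
          by (rule pd_cong_open[OF o x]) (use gC in auto)
        moreover have "g differentiable at x"
          by (rule differentiable_transform_open[OF differentiable_const o x]) (use gC in auto)
        ultimately show ?thesis using pz0 zb x by auto
      qed
      then show "g differentiable at x" "pd b g x = \<zeta> x * (- k' x * pd b \<rho> x) + pd b \<zeta> x * k x" by auto
    qed
    have c1: "continuous_on \<Omega> (\<lambda>x. \<zeta> x * (k' x * h x))" if "continuous_on (\<Omega> \<inter> U) h" for h
      by (rule continuous_on_zero_extension[OF \<Omega>(1) U(1) closed_cball CU])
         (use that zb \<Omega>Q in \<open>auto intro!: continuous_intros continuous_on_subset[OF cz'] continuous_on_subset[OF ck']\<close>)
    have c2: "continuous_on \<Omega> (\<lambda>x. pd b \<zeta> x * k x)" for b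
      by (rule continuous_on_zero_extension[OF \<Omega>(1) U(1) closed_cball CU])
         (use pz0 \<Omega>Q in \<open>auto intro!: continuous_intros continuous_on_subset[OF cz] continuous_on_subset[OF ck]\<close>)
    have c3: "continuous_on \<Omega> (\<lambda>x. k x * (grad \<zeta> x \<bullet> V (x, t)))" if "t \<in> J" for t
    proof -
      have "continuous_on (closure \<Omega>) (\<lambda>x. grad \<zeta> x \<bullet> V (x, t))"
        using continuous_on_slice(1)[OF cw that] by simp
      then show ?thesis
        by (intro continuous_on_zero_extension[OF \<Omega>(1) U(1) closed_cball CU])
           (use gz0 closure_subset[of \<Omega>] in \<open>auto intro!: continuous_intros continuous_on_subset[OF ck] elim!: continuous_on_subset\<close>)
    qed
    have cpg: "continuous_on \<Omega> (pd b g)" for b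
    proof -
      have "continuous_on \<Omega> (\<lambda>x. - (\<zeta> x * (k' x * pd b \<rho> x)) + pd b \<zeta> x * k x)"
        by (intro continuous_intros c1 c2 continuous_on_subset[OF cpr]) auto
      then show ?thesis by (simp add: pg cong: continuous_on_cong)
    qed
    have cg: "continuous_on \<Omega> g"
      using pg(1) by (auto intro!: differentiable_at_imp_continuous_on)
    have bk: "\<exists>B. \<forall>x\<in>\<Omega>. \<bar>\<zeta> x * (k' x * h x)\<bar> \<le> B" if "continuous_on (closure \<Omega> \<inter> ?C) h" for h
    proof -
      have c0: "continuous_on (closure \<Omega> \<inter> ?C) (\<lambda>x. \<zeta> x * (k' x * h x))"
        using that Q(2) CU by (intro continuous_intros continuous_on_subset[OF cz'] continuous_on_subset[OF ck']) auto
      obtain B where B: "0 \<le> B" "\<And>x. x \<in> closure \<Omega> \<inter> ?C \<Longrightarrow> \<bar>\<zeta> x * (k' x * h x)\<bar> \<le> B"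
        by (rule compact_abs_bound[OF compact_Int[OF ccl compact_cball] c0]) blast
      have "\<bar>\<zeta> x * (k' x * h x)\<bar> \<le> B" if "x \<in> \<Omega>" for x
        using B that closure_subset[of \<Omega>] zb[of x] by (cases "x \<in> ?C") auto
      then show ?thesis by blast
    qed
    have i1: "integrable ?M (\<lambda>x. \<zeta> x * (k' x * h x))"
      if "continuous_on (\<Omega> \<inter> U) h" "continuous_on (closure \<Omega> \<inter> ?C) h" for h
    proof -
      from bk[OF that(2)] obtain B where "\<forall>x\<in>\<Omega>. \<bar>\<zeta> x * (k' x * h x)\<bar> \<le> B" ..
      then show ?thesis by (intro integrable_vol[OF \<Omega> measurable_vol[OF c1[OF that(1)]], of B]) blast
    qed
    have i1n: "integrable ?M (\<lambda>x. \<zeta> x * (k' x * pd n \<rho> x))"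
      by (rule i1; rule continuous_on_subset[OF cpr]) (use CU in auto)
    have i1c: "integrable ?M (\<lambda>x. \<zeta> x * (k' x * c))"
      by (rule i1) auto
    have i2: "integrable ?M (\<lambda>x. pd n \<zeta> x * k x)"
    proof (rule integrable_vol[OF \<Omega> measurable_vol[OF c2], of _ B3])
      fix x assume "x \<in> \<Omega>"
      then have "\<bar>pd n \<zeta> x\<bar> \<le> B3" using B3 closure_subset by blast
      then show "\<bar>pd n \<zeta> x * k x\<bar> \<le> B3" using k[of x] mult_mono[of "\<bar>pd n \<zeta> x\<bar>" B3 "k x" 1] B3(1) by (simp add: abs_mult)
    qed
    \<comment> \<open>The integral of \<open>pd n g\<close> vanishes. It trades the layer term,
      which carries the factor 1/\<delta>, for the harmless integral of
      \<open>pd n \<zeta> x * k x\<close>; the lower bound \<open>c\<close> for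
      \<open>pd n \<rho>\<close> on the ball then frees \<open>\<zeta> x * k' x\<close>.\<close>
    have mass: "(\<integral>x. \<zeta> x * k' x \<partial>?M) \<le> C"
    proof -
      have "0 = (\<integral>x. pd n g x \<partial>?M)"
        by (rule integral_pd_eq_0_compact_support[OF \<Omega>(1) S Ssub, symmetric]) (use pg cpg gS in auto)
      also have "\<dots> = (\<integral>x. pd n \<zeta> x * k x - \<zeta> x * (k' x * pd n \<rho> x) \<partial>?M)"
        by (rule Bochner_Integration.integral_cong) (auto simp: pg)
      finally have "(\<integral>x. \<zeta> x * (k' x * pd n \<rho> x) \<partial>?M) = (\<integral>x. pd n \<zeta> x * k x \<partial>?M)"
        using i1n i2 by simp
      also have "\<dots> \<le> (\<integral>x. B3 \<partial>?M)"
      proof (rule integral_mono[OF i2])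
        fix x assume "x \<in> space ?M"
        then have "\<bar>pd n \<zeta> x\<bar> \<le> B3" using B3 closure_subset by auto
        then show "pd n \<zeta> x * k x \<le> B3" using k[of x] mult_mono[of "\<bar>pd n \<zeta> x\<bar>" B3 "k x" 1] B3(1)
          by (smt (verit) mult_right_mono)
      qed auto
      finally have 1: "(\<integral>x. \<zeta> x * (k' x * pd n \<rho> x) \<partial>?M) \<le> B3 * measure ?M (space ?M)"
        by (simp add: mult.commute)
      have "(\<integral>x. \<zeta> x * (k' x * c) \<partial>?M) \<le> (\<integral>x. \<zeta> x * (k' x * pd n \<rho> x) \<partial>?M)"
      proof (rule integral_mono[OF i1c i1n])
        fix x assume "x \<in> space ?M"
        show "\<zeta> x * (k' x * c) \<le> \<zeta> x * (k' x * pd n \<rho> x)"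
          using Cc[of x] k[of x] z0[of x] zb[of x] by (cases "x \<in> ?C") (auto intro!: mult_left_mono)
      qed
      moreover have "(\<integral>x. \<zeta> x * (k' x * c) \<partial>?M) = (\<integral>x. \<zeta> x * k' x \<partial>?M) * c"
        by (simp add: mult.assoc[symmetric])
      ultimately show ?thesis using 1 c by (simp add: C_def field_simps)
    qed
    have i0: "integrable ?M (\<lambda>x. \<zeta> x * k' x)"
      using i1[of "\<lambda>x. 1"] by simp
    have im: "integrable ?M (\<lambda>x. indicat_real ?C x * (1 - k x))"
    proof (rule M.integrable_const_bound[where B=1])
      have "continuous_on ?C (\<lambda>x. 1 - k x)"
        by (intro continuous_intros continuous_on_subset[OF ck] CU)
      then have "(\<lambda>x. indicat_real ?C x *\<^sub>R (1 - k x)) \<in> borel_measurable borel"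
        by (intro borel_measurable_continuous_on_indicator) auto
      then have "(\<lambda>x. indicat_real ?C x * (1 - k x)) \<in> borel_measurable lborel" by simp
      then show "(\<lambda>x. indicat_real ?C x * (1 - k x)) \<in> borel_measurable ?M" by (rule measurable_restrict_space1)
      show "AE x in ?M. norm (indicat_real ?C x * (1 - k x)) \<le> 1"
        using k by (intro AE_I2) (auto simp: indicator_def)
    qed
    have m\<delta>: "m \<delta> = (\<integral>x. indicat_real ?C x * (1 - k x) \<partial>?M)" by (simp add: m_def k_def)
    have m0: "0 \<le> m \<delta>" unfolding m\<delta> by (rule integral_nonneg_AE) (use k in \<open>auto simp: indicator_def\<close>)
    have me: "(B1 + B2) * m \<delta> \<le> e / 2"
    proof -
      have "(B1 + B2) * m \<delta> \<le> (B1 + B2 + 1) * m \<delta>" using m0 by (simp add: algebra_simps)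
      also have "\<dots> \<le> e / 2" using \<delta>(1) B1(1) B2(1) by (simp add: field_simps)
      finally show ?thesis .
    qed
    have meB: "B1 * m \<delta> \<le> e / 2" "B2 * m \<delta> \<le> e / 2"
      using me mult_nonneg_nonneg[OF B1(1) m0] mult_nonneg_nonneg[OF B2(1) m0]
      unfolding distrib_right by linarith+
    have dist: "(\<integral>x. \<zeta> x - g x \<partial>?M) \<le> e"
    proof -
      have "(\<integral>x. \<zeta> x - g x \<partial>?M) \<le> (\<integral>x. B2 * (indicat_real ?C x * (1 - k x)) \<partial>?M)"
      proof (rule integral_mono)
        have "integrable ?M \<zeta>" using B2 closure_subset
          by (intro integrable_vol[OF \<Omega> measurable_vol[OF continuous_on_subset[OF cz' \<Omega>Q]], of B2]) blast
        moreover have "integrable ?M g"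
        proof (rule integrable_vol[OF \<Omega> measurable_vol[OF cg], of B2])
          fix x assume "x \<in> \<Omega>"
          then have "\<bar>\<zeta> x\<bar> \<le> B2" using B2 closure_subset by blast
          then show "\<bar>g x\<bar> \<le> B2" using k[of x] mult_mono[of "\<bar>\<zeta> x\<bar>" B2 "k x" 1] B2(1) by (simp add: abs_mult g_def)
        qed
        ultimately show "integrable ?M (\<lambda>x. \<zeta> x - g x)" by simp
        fix x assume "x \<in> space ?M"
        then have "\<zeta> x \<le> B2" using B2(2)[of x] closure_subset[of \<Omega>] by auto
        moreover have "\<zeta> x - g x = \<zeta> x * (1 - k x)" by (simp add: g_def algebra_simps)
        ultimately show "\<zeta> x - g x \<le> B2 * (indicat_real ?C x * (1 - k x))"
          using k[of x] zb[of x] by (cases "x \<in> ?C") (auto intro!: mult_right_mono)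
      qed (use im in auto)
      also have "\<dots> = B2 * m \<delta>" using m\<delta> by simp
      finally show ?thesis using meB e by linarith
    qed
    have fluxes: "(\<integral>x. grad \<zeta> x \<bullet> V (x, t) \<partial>?M) - e \<le> - (\<integral>x. g x * (\<Sum>b\<in>Basis. pd b (\<lambda>y. V (y, t) \<bullet> b) x) \<partial>?M)"
      if t: "t \<in> J" for t
    proof -
      have cwt: "continuous_on (closure \<Omega>) (\<lambda>x. grad \<zeta> x \<bullet> V (x, t))"
        using continuous_on_slice(1)[OF cw t] by simp
      have cVt: "continuous_on (closure \<Omega>) (\<lambda>x. V (x, t))"
        using continuous_on_slice(1)[OF V t] by simp
      have bw: "\<bar>grad \<zeta> x \<bullet> V (x, t)\<bar> \<le> B1" if "x \<in> \<Omega>" for x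
        using B1(2)[of "(x, t)"] that t closure_subset[of \<Omega>] by auto
      have ib: "integrable ?M (\<lambda>x. \<zeta> x * (k' x * (grad \<rho> x \<bullet> V (x, t))))"
        by (rule i1) (use CU closure_subset[of \<Omega>] in \<open>auto intro!: continuous_intros continuous_on_subset[OF cgr] continuous_on_subset[OF cVt]\<close>)
      have ik: "integrable ?M (\<lambda>x. k x * (grad \<zeta> x \<bullet> V (x, t)))"
      proof (rule integrable_vol[OF \<Omega> measurable_vol[OF c3[OF t]], of B1])
        fix x assume "x \<in> \<Omega>"
        from bw[OF this] show "\<bar>k x * (grad \<zeta> x \<bullet> V (x, t))\<bar> \<le> B1"
          using k[of x] mult_mono[of "k x" 1 "\<bar>grad \<zeta> x \<bullet> V (x, t)\<bar>" B1] B1(1) by (simp add: abs_mult)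
      qed
      have iw: "integrable ?M (\<lambda>x. grad \<zeta> x \<bullet> V (x, t))"
        using bw by (intro integrable_vol[OF \<Omega> measurable_vol[OF continuous_on_subset[OF cwt closure_subset]], of B1])
      have "- (\<integral>x. g x * (\<Sum>b\<in>Basis. pd b (\<lambda>y. V (y, t) \<bullet> b) x) \<partial>?M) = (\<integral>x. grad g x \<bullet> V (x, t) \<partial>?M)"
        using integral_by_parts_divergence(2)[OF \<Omega> S Ssub pg(1) cpg gS dV(1)[OF t] dV(2)[OF t]] by simp
      also have "\<dots> = (\<integral>x. k x * (grad \<zeta> x \<bullet> V (x, t)) - \<zeta> x * (k' x * (grad \<rho> x \<bullet> V (x, t))) \<partial>?M)"
      proof (rule Bochner_Integration.integral_cong[OF refl])
        fix x assume "x \<in> space ?M"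
        then have x: "x \<in> \<Omega>" by simp
        have "grad g x = k x *\<^sub>R grad \<zeta> x - (\<zeta> x * k' x) *\<^sub>R grad \<rho> x"
          unfolding grad_def pg(2)[OF x]
          by (simp add: scaleR_sum_right sum_subtractf[symmetric] algebra_simps)
        then show "grad g x \<bullet> V (x, t) = k x * (grad \<zeta> x \<bullet> V (x, t)) - \<zeta> x * (k' x * (grad \<rho> x \<bullet> V (x, t)))"
          by (simp add: inner_diff_left)
      qed
      also have "\<dots> = (\<integral>x. k x * (grad \<zeta> x \<bullet> V (x, t)) \<partial>?M) - (\<integral>x. \<zeta> x * (k' x * (grad \<rho> x \<bullet> V (x, t))) \<partial>?M)"
        using ib ik by simp
      finally have eq: "- (\<integral>x. g x * (\<Sum>b\<in>Basis. pd b (\<lambda>y. V (y, t) \<bullet> b) x) \<partial>?M) = \<dots>" .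
      have "(\<integral>x. \<zeta> x * (k' x * (grad \<rho> x \<bullet> V (x, t))) \<partial>?M) \<le> (\<integral>x. e' * (\<zeta> x * k' x) \<partial>?M)"
      proof (rule integral_mono[OF ib])
        show "integrable ?M (\<lambda>x. e' * (\<zeta> x * k' x))" using i0 by simp
        fix x assume "x \<in> space ?M"
        then have x: "x \<in> \<Omega>" by simp
        \<comment> \<open>Only an upper bound for the flux is available and only one is needed: in
          \<open>grad g\<close> the layer term carries a minus sign, so inward flux helps.\<close>
        have "(\<zeta> x * k' x) * (grad \<rho> x \<bullet> V (x, t)) \<le> (\<zeta> x * k' x) * e'"
        proof (cases "x \<in> ?C \<and> - \<rho> x < 2 * \<delta>")
          case True
          then have "grad \<rho> x \<bullet> V (x, t) \<le> e'"
            using \<delta>0(2)[of x t] x t \<delta>(3) by (simp add: inner_commute)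
          then show ?thesis using z0[of x] k[of x] by (intro mult_left_mono) auto
        next
          case False
          then have "\<zeta> x * k' x = 0"
            using zb[of x] \<delta>(2) step_eq(3)[of "- \<rho> x / \<delta>"] by (cases "x \<in> ?C") (auto simp: k'_def field_simps)
          then show ?thesis by (simp only: mult_zero_left)
        qed
        then show "\<zeta> x * (k' x * (grad \<rho> x \<bullet> V (x, t))) \<le> e' * (\<zeta> x * k' x)" by (simp add: algebra_simps)
      qed
      also have "\<dots> \<le> e' * C" using mass e'(1) by simp
      finally have 1: "(\<integral>x. \<zeta> x * (k' x * (grad \<rho> x \<bullet> V (x, t))) \<partial>?M) \<le> e / 2" using e'(2) by linarith
      have "(\<integral>x. grad \<zeta> x \<bullet> V (x, t) \<partial>?M) - (\<integral>x. k x * (grad \<zeta> x \<bullet> V (x, t)) \<partial>?M)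
          = (\<integral>x. grad \<zeta> x \<bullet> V (x, t) - k x * (grad \<zeta> x \<bullet> V (x, t)) \<partial>?M)"
        using iw ik by simp
      also have "\<dots> \<le> (\<integral>x. B1 * (indicat_real ?C x * (1 - k x)) \<partial>?M)"
      proof (rule integral_mono)
        fix x assume "x \<in> space ?M"
        then have "grad \<zeta> x \<bullet> V (x, t) \<le> B1" using bw[of x] by (simp add: abs_le_iff)
        moreover have "grad \<zeta> x \<bullet> V (x, t) - k x * (grad \<zeta> x \<bullet> V (x, t)) = (grad \<zeta> x \<bullet> V (x, t)) * (1 - k x)"
          by (simp add: algebra_simps)
        ultimately show "grad \<zeta> x \<bullet> V (x, t) - k x * (grad \<zeta> x \<bullet> V (x, t)) \<le> B1 * (indicat_real ?C x * (1 - k x))"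
          using k[of x] gz0[of x] by (cases "x \<in> ?C") (auto intro!: mult_right_mono)
      qed (use iw ik im in auto)
      also have "\<dots> = B1 * m \<delta>" using m\<delta> by simp
      finally have "(\<integral>x. grad \<zeta> x \<bullet> V (x, t) \<partial>?M) - (\<integral>x. k x * (grad \<zeta> x \<bullet> V (x, t)) \<partial>?M) \<le> e / 2"
        using meB by linarith
      with 1 eq show ?thesis by linarith
    qed
    have gbd: "0 \<le> g x \<and> g x \<le> \<zeta> x" for x
      using k[of x] z0[of x] by (auto simp: g_def mult_left_le)
    show "\<exists>g S. flux_cutoff \<Omega> J V \<zeta> e g S"
      unfolding flux_cutoff_def
      using S Ssub cg gbd gS dist fluxes by (intro exI[of _ g] exI[of _ S]) blast
  qed
qed

section \<open>A partition of unity of class C^1\<close>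

definition bump :: "'a::euclidean_space \<Rightarrow> real \<Rightarrow> 'a \<Rightarrow> real" where
  "bump p r x = (max 0 (r\<^sup>2 - (x - p) \<bullet> (x - p)))\<^sup>2"

lemma bump_derivs:
  shows "bump p r differentiable at x" "continuous_on UNIV (pd b (bump p r))"
proof -
  have d: "((\<lambda>x. r\<^sup>2 - (x - p) \<bullet> (x - p)) has_derivative (\<lambda>h. - 2 * ((x - p) \<bullet> h))) (at x)" for x
    by (auto intro!: derivative_eq_intros simp: inner_commute)
  have 1: "bump p r differentiable at x \<and> pd b (bump p r) x = 2 * max 0 (r\<^sup>2 - (x - p) \<bullet> (x - p)) * (- 2 * ((x - p) \<bullet> b))" for x
    unfolding bump_def
    using pd_chain[OF differentiableI[OF d[of x]] has_real_derivative_max0_square[OF DERIV_ident]] pd_eqI[OF d]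
    by simp
  then show "bump p r differentiable at x" by blast
  have "pd b (bump p r) = (\<lambda>x. 2 * max 0 (r\<^sup>2 - (x - p) \<bullet> (x - p)) * (- 2 * ((x - p) \<bullet> b)))"
    using 1 by blast
  then show "continuous_on UNIV (pd b (bump p r))" by (simp only:) (intro continuous_intros)
qed

lemma bump_nonneg: "0 \<le> bump p r x"
  by (simp add: bump_def)

lemma bump_pos: "x \<in> ball p r \<Longrightarrow> 0 < bump p r x"
proof -
  assume "x \<in> ball p r"
  then have "norm (x - p) ^ 2 < r ^ 2" by (intro power_strict_mono) (auto simp: dist_norm norm_minus_commute)
  then show ?thesis by (simp add: bump_def power2_norm_eq_inner)
qed

lemma bump_zero: "0 < r \<Longrightarrow> x \<notin> ball p r \<Longrightarrow> bump p r x = 0"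
proof -
  assume "0 < r" "x \<notin> ball p r"
  then have "r ^ 2 \<le> norm (x - p) ^ 2" by (intro power_mono) (auto simp: dist_norm norm_minus_commute)
  then show ?thesis by (simp add: bump_def power2_norm_eq_inner)
qed

text \<open>Finitely many bumps are divided by their sum. The normalisation holds on the open set
  \<open>Q\<close> where the sum is positive and not just on \<open>C\<close>, so it may be
  differentiated: the gradients add up to 0.\<close>

lemma C1_partition_of_unity:
  fixes C :: "'a::euclidean_space set" and r :: "'a \<Rightarrow> real"
  assumes C: "compact C" and r: "\<And>p. p \<in> C \<Longrightarrow> 0 < r p"
  obtains F Q \<zeta> where "finite F" "F \<subseteq> C" "open Q" "C \<subseteq> Q"
    "\<And>p x. x \<in> Q \<Longrightarrow> \<zeta> p differentiable at x" "\<And>p b. continuous_on Q (pd b (\<zeta> p))"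
    "\<And>p x. 0 \<le> \<zeta> p x" "\<And>p x. p \<in> F \<Longrightarrow> x \<notin> ball p (r p) \<Longrightarrow> \<zeta> p x = 0"
    "\<And>x. x \<in> Q \<Longrightarrow> (\<Sum>p\<in>F. \<zeta> p x) = 1" "\<And>x. x \<in> Q \<Longrightarrow> (\<Sum>p\<in>F. grad (\<zeta> p) x) = 0"
proof -
  have "C \<subseteq> (\<Union>p\<in>C. ball p (r p))" using r by force
  then obtain F where F: "F \<subseteq> C" "finite F" "C \<subseteq> (\<Union>p\<in>F. ball p (r p))"
    using compactE_image[OF C, of C "\<lambda>p. ball p (r p)"] by auto
  define T where "T x = (\<Sum>p\<in>F. bump p (r p) x)" for x
  define Q where "Q = {x. 0 < T x}"
  define \<zeta> where "\<zeta> p x = bump p (r p) x * inverse (T x)" for p x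
  have dT: "T differentiable at x" for x
    unfolding T_def using bump_derivs(1) F(2) by (intro differentiable_sum) auto
  have cb: "continuous_on UNIV (bump p (r p))" for p
    by (rule differentiable_at_imp_continuous_on) (rule bump_derivs(1))
  have cT: "continuous_on UNIV T"
    unfolding T_def by (intro continuous_intros cb)
  have pT: "pd b T x = (\<Sum>p\<in>F. pd b (bump p (r p)) x)" for b x
  proof -
    have "((\<lambda>x. \<Sum>p\<in>F. bump p (r p) x) has_derivative (\<lambda>h. \<Sum>p\<in>F. frechet_derivative (bump p (r p)) (at x) h)) (at x)"
      by (intro has_derivative_sum has_derivative_frechet bump_derivs)
    from pd_eqI[OF this] show ?thesis unfolding T_def[abs_def] by (simp add: pd_def)
  qed
  have cpT: "continuous_on UNIV (pd b T)" for b
    unfolding pT by (intro continuous_intros bump_derivs(2))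
  have oQ: "open Q" unfolding Q_def by (intro open_Collect_less continuous_intros cT)
  have T0: "T x \<noteq> 0" if "x \<in> Q" for x using that by (simp add: Q_def)
  have inv: "(\<lambda>x. inverse (T x)) differentiable at x" "pd b (\<lambda>x. inverse (T x)) x = - (inverse (T x) ^ 2) * pd b T x"
    if "x \<in> Q" for x b
    using pd_chain[OF dT DERIV_inverse[OF T0[OF that]]] by (simp_all add: numeral_2_eq_2)
  have dz: "\<zeta> p differentiable at x" if "x \<in> Q" for p x
    unfolding \<zeta>_def by (intro differentiable_mult bump_derivs inv that)
  have pz: "pd b (\<zeta> p) x = bump p (r p) x * (- (inverse (T x) ^ 2) * pd b T x) + pd b (bump p (r p)) x * inverse (T x)"
    if "x \<in> Q" for p x b
    unfolding \<zeta>_def[abs_def] using pd_mult[OF bump_derivs(1) inv(1)[OF that]] inv(2)[OF that] by simp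
  have cz: "continuous_on Q (pd b (\<zeta> p))" for p b
  proof -
    have "continuous_on Q (\<lambda>x. bump p (r p) x * (- (inverse (T x) ^ 2) * pd b T x) + pd b (bump p (r p)) x * inverse (T x))"
      using T0 by (intro continuous_intros continuous_on_subset[OF cb] continuous_on_subset[OF cT]
          continuous_on_subset[OF cpT] continuous_on_subset[OF bump_derivs(2)]) auto
    then show ?thesis by (simp add: pz cong: continuous_on_cong)
  qed
  have sum1: "(\<Sum>p\<in>F. \<zeta> p x) = 1" if "x \<in> Q" for x
    unfolding \<zeta>_def sum_distrib_right[symmetric] using T0[OF that] by (simp add: T_def)
  have sum0: "(\<Sum>p\<in>F. grad (\<zeta> p) x) = 0" if "x \<in> Q" for x
  proof -
    have "(\<Sum>p\<in>F. pd b (\<zeta> p) x) = 0" for b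
    proof -
      have "((\<lambda>x. \<Sum>p\<in>F. \<zeta> p x) has_derivative (\<lambda>h. \<Sum>p\<in>F. frechet_derivative (\<zeta> p) (at x) h)) (at x)"
        by (intro has_derivative_sum has_derivative_frechet dz that)
      from pd_eqI[OF this] have "pd b (\<lambda>x. \<Sum>p\<in>F. \<zeta> p x) x = (\<Sum>p\<in>F. pd b (\<zeta> p) x)" by (simp add: pd_def)
      moreover have "pd b (\<lambda>x. \<Sum>p\<in>F. \<zeta> p x) x = pd b (\<lambda>x. 1) x"
        by (rule pd_cong_open[OF oQ that]) (rule sum1)
      ultimately show ?thesis by simp
    qed
    moreover have "(\<Sum>p\<in>F. grad (\<zeta> p) x) = (\<Sum>b\<in>Basis. (\<Sum>p\<in>F. pd b (\<zeta> p) x) *\<^sub>R b)"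
      unfolding grad_def scaleR_sum_left by (rule sum.swap)
    ultimately show ?thesis by simp
  qed
  have "C \<subseteq> Q"
  proof
    fix x assume "x \<in> C"
    then obtain p where "p \<in> F" "x \<in> ball p (r p)" using F(3) by auto
    then show "x \<in> Q" unfolding Q_def T_def using F(2) bump_pos[of x p "r p"]
      by (auto intro!: sum_pos2[of F p] bump_nonneg)
  qed
  moreover have "0 \<le> \<zeta> p x" for p x
    unfolding \<zeta>_def T_def by (intro mult_nonneg_nonneg bump_nonneg) (auto intro!: sum_nonneg bump_nonneg)
  moreover have "\<zeta> p x = 0" if "p \<in> F" "x \<notin> ball p (r p)" for p x
    using that bump_zero[OF r, of p x] F(1) by (auto simp: \<zeta>_def)
  ultimately show ?thesis using that[of F Q \<zeta>] F oQ dz cz sum1 sum0 by blast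
qed

text \<open>For continuous \<open>V\<close> up to the boundary, pointing inwards there, this says $\int_\Omega \mathrm{div} V \le 0$
  although \<open>div V\<close> need not be integrable.\<close>

lemma divergence_cutoff:
  fixes V :: "'a::euclidean_space \<times> real \<Rightarrow> 'a"
  assumes \<Omega>: "open \<Omega>" "bounded \<Omega>"
    and bdry: "\<And>p. p \<in> frontier \<Omega> \<Longrightarrow> \<exists>\<rho>. local_defining_function 1 \<Omega> p \<rho>" and J: "compact J"
    and V: "continuous_on (closure \<Omega> \<times> J) V"
    and dV: "\<And>t x b. t \<in> J \<Longrightarrow> x \<in> \<Omega> \<Longrightarrow> b \<in> Basis \<Longrightarrow> (\<lambda>y. V (y, t) \<bullet> b) differentiable at x"
       "\<And>t b. t \<in> J \<Longrightarrow> b \<in> Basis \<Longrightarrow> continuous_on \<Omega> (pd b (\<lambda>y. V (y, t) \<bullet> b))"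
    and flux: "\<And>x t. x \<in> frontier \<Omega> \<Longrightarrow> t \<in> J \<Longrightarrow> V (x, t) \<bullet> outer_normal \<Omega> x \<le> 0"
    and e: "0 < e"
  obtains \<kappa> S where "compact S" "S \<subseteq> \<Omega>" "continuous_on \<Omega> \<kappa>" "\<And>x. x \<in> \<Omega> \<Longrightarrow> 0 \<le> \<kappa> x \<and> \<kappa> x \<le> 1"
    "\<And>x. x \<in> \<Omega> - S \<Longrightarrow> \<kappa> x = 0" "(\<integral>x. 1 - \<kappa> x \<partial>vol \<Omega>) \<le> e"
    "\<And>t. t \<in> J \<Longrightarrow> (\<integral>x. \<kappa> x * (\<Sum>b\<in>Basis. pd b (\<lambda>y. V (y, t) \<bullet> b) x) \<partial>vol \<Omega>) \<le> e"
proof -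
  let ?M = "vol \<Omega>"
  let ?div = "\<lambda>t x. \<Sum>b\<in>Basis. pd b (\<lambda>y. V (y, t) \<bullet> b) x"
  interpret M: finite_measure ?M by (rule finite_measure_vol[OF \<Omega>])
  have ccl: "compact (closure \<Omega>)" using \<Omega>(2) by (simp add: compact_closure)
  have loc: "\<exists>r. cutoff_ball \<Omega> J V p r" if p: "p \<in> closure \<Omega>" for p
  proof (cases "p \<in> \<Omega>")
    case False
    then have pf: "p \<in> frontier \<Omega>" using p \<Omega>(1) by (simp add: frontier_def interior_open)
    then obtain \<rho> where "local_defining_function 1 \<Omega> p \<rho>" using bdry by blast
    from boundary_cutoff[OF \<Omega> pf this J V dV flux] show ?thesis .
  next
    case True
    then obtain r where r: "r > 0" "cball p r \<subseteq> \<Omega>" using \<Omega>(1) open_contains_cball by blast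
    \<comment> \<open>When the ball lies inside \<open>\<Omega>\<close>, the function
      \<open>\<zeta>\<close> already has compact support in \<open>\<Omega>\<close> and is its own
      cutoff.\<close>
    have "\<exists>g S. flux_cutoff \<Omega> J V \<zeta> e g S" if Q: "open Q" "closure \<Omega> \<subseteq> Q" and z: "\<forall>x\<in>Q. \<zeta> differentiable at x"
      "\<forall>b. continuous_on Q (pd b \<zeta>)" "\<forall>x. 0 \<le> \<zeta> x" "\<forall>x. x \<notin> ball p r \<longrightarrow> \<zeta> x = 0" and e: "0 < e" for \<zeta> Q e
      unfolding flux_cutoff_def
    proof (intro exI[of _ \<zeta>] exI[of _ "cball p r"] conjI ballI)
      have Q': "\<Omega> \<subseteq> Q" using Q(2) closure_subset by blast
      then have dz: "\<And>x. x \<in> \<Omega> \<Longrightarrow> \<zeta> differentiable at x" using z(1) by blast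
      then show "continuous_on \<Omega> \<zeta>"
        by (rule differentiable_at_imp_continuous_on)
      fix t assume t: "t \<in> J"
      have "(\<integral>x. \<zeta> x * ?div t x \<partial>?M) = - (\<integral>x. grad \<zeta> x \<bullet> V (x, t) \<partial>?M)"
        by (rule integral_by_parts_divergence(2)[OF \<Omega> compact_cball r(2) dz])
           (use z Q' dV t in \<open>auto intro: continuous_on_subset\<close>)
      then show "(\<integral>x. grad \<zeta> x \<bullet> V (x, t) \<partial>?M) - e \<le> - (\<integral>x. \<zeta> x * ?div t x \<partial>?M)" using e by simp
    qed (use r z e in auto)
    then show ?thesis
      unfolding cutoff_ball_def
      by (intro exI[of _ r] conjI allI impI r(1)) (elim conjE, assumption)
  qed
  then obtain r where r: "\<And>p. p \<in> closure \<Omega> \<Longrightarrow> cutoff_ball \<Omega> J V p (r p)" by metis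
  then have r0: "\<And>p. p \<in> closure \<Omega> \<Longrightarrow> 0 < r p" by (simp add: cutoff_ball_def)
  obtain F Q \<zeta> where F: "finite F" "F \<subseteq> closure \<Omega>" and Q: "open Q" "closure \<Omega> \<subseteq> Q"
    and z: "\<And>p x. x \<in> Q \<Longrightarrow> \<zeta> p differentiable at x" "\<And>p b. continuous_on Q (pd b (\<zeta> p))"
    "\<And>p x. 0 \<le> \<zeta> p x" "\<And>p x. p \<in> F \<Longrightarrow> x \<notin> ball p (r p) \<Longrightarrow> \<zeta> p x = 0"
    "\<And>x. x \<in> Q \<Longrightarrow> (\<Sum>p\<in>F. \<zeta> p x) = 1" "\<And>x. x \<in> Q \<Longrightarrow> (\<Sum>p\<in>F. grad (\<zeta> p) x) = 0"
    by (rule C1_partition_of_unity[OF ccl r0], assumption) (rule that)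
  \<comment> \<open>The allowed error is shared among the members of the partition; adding 1 keeps
    \<open>N\<close> positive even if \<open>F\<close> is empty.\<close>
  define N where "N = real (card F) + 1"
  have N: "N > 0" "card F * (e / N) \<le> e" using e by (auto simp: N_def field_simps)
  have "\<exists>g S. flux_cutoff \<Omega> J V (\<zeta> p) (e / N) g S" if p: "p \<in> F" for p
  proof -
    have c: "cutoff_ball \<Omega> J V p (r p)" using r F p by blast
    have "open Q \<and> closure \<Omega> \<subseteq> Q \<and> (\<forall>x\<in>Q. \<zeta> p differentiable at x) \<and> (\<forall>b. continuous_on Q (pd b (\<zeta> p))) \<and>
        (\<forall>x. 0 \<le> \<zeta> p x) \<and> (\<forall>x. x \<notin> ball p (r p) \<longrightarrow> \<zeta> p x = 0) \<and> 0 < e / N"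
      using Q z p e N by auto
    then show ?thesis
      by (rule c[unfolded cutoff_ball_def, THEN conjunct2, THEN spec, THEN spec, THEN spec, THEN mp])
  qed
  then obtain g S where gS: "\<And>p. p \<in> F \<Longrightarrow> flux_cutoff \<Omega> J V (\<zeta> p) (e / N) (g p) (S p)" by metis
  have g: "compact (S p)" "S p \<subseteq> \<Omega>" "continuous_on \<Omega> (g p)" "\<And>x. x \<in> \<Omega> \<Longrightarrow> 0 \<le> g p x \<and> g p x \<le> \<zeta> p x"
    "\<And>x. x \<in> \<Omega> - S p \<Longrightarrow> g p x = 0" "(\<integral>x. \<zeta> p x - g p x \<partial>?M) \<le> e / N"
    "\<And>t. t \<in> J \<Longrightarrow> (\<integral>x. grad (\<zeta> p) x \<bullet> V (x, t) \<partial>?M) - e / N \<le> - (\<integral>x. g p x * ?div t x \<partial>?M)"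
    if "p \<in> F" for p
    using gS[OF that] unfolding flux_cutoff_def by blast+
  have \<Omega>Q: "\<Omega> \<subseteq> Q" using Q(2) closure_subset by blast
  have z1: "\<zeta> p x \<le> 1" if "x \<in> \<Omega>" "p \<in> F" for p x
  proof -
    have "\<zeta> p x \<le> (\<Sum>p\<in>F. \<zeta> p x)" by (rule member_le_sum) (use that z F in auto)
    then show ?thesis using z(5) that \<Omega>Q by auto
  qed
  have cz: "continuous_on Q (\<zeta> p)" for p
    using z(1) by (auto intro!: differentiable_at_imp_continuous_on)
  define \<kappa> where "\<kappa> x = (\<Sum>p\<in>F. g p x)" for x
  show ?thesis
  proof (rule that[of "\<Union>p\<in>F. S p" \<kappa>])
    show "compact (\<Union>p\<in>F. S p)" using F g by (intro compact_UN) auto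
    show "(\<Union>p\<in>F. S p) \<subseteq> \<Omega>" using g by blast
    show "continuous_on \<Omega> \<kappa>" unfolding \<kappa>_def using g by (intro continuous_intros) auto
    show "0 \<le> \<kappa> x \<and> \<kappa> x \<le> 1" if "x \<in> \<Omega>" for x
    proof -
      have "\<kappa> x \<le> (\<Sum>p\<in>F. \<zeta> p x)" unfolding \<kappa>_def using g(4) that by (intro sum_mono) auto
      then show ?thesis unfolding \<kappa>_def using g(4) that z(5) \<Omega>Q by (auto intro!: sum_nonneg)
    qed
    show "\<kappa> x = 0" if "x \<in> \<Omega> - (\<Union>p\<in>F. S p)" for x
      unfolding \<kappa>_def using g(5) that by (intro sum.neutral) auto
    have iz: "integrable ?M (\<lambda>x. \<zeta> p x - g p x)" if "p \<in> F" for p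
    proof (rule integrable_vol[OF \<Omega> measurable_vol, of _ 1])
      show "continuous_on \<Omega> (\<lambda>x. \<zeta> p x - g p x)"
        by (intro continuous_intros g that continuous_on_subset[OF cz] \<Omega>Q)
      show "\<bar>\<zeta> p x - g p x\<bar> \<le> 1" if "x \<in> \<Omega>" for x
        using g(4)[OF \<open>p \<in> F\<close> that] z1[OF that \<open>p \<in> F\<close>] by auto
    qed
    have "(\<integral>x. 1 - \<kappa> x \<partial>?M) = (\<integral>x. (\<Sum>p\<in>F. \<zeta> p x - g p x) \<partial>?M)"
      by (rule Bochner_Integration.integral_cong)
         (use z(5) \<Omega>Q in \<open>auto simp: \<kappa>_def sum_subtractf\<close>)
    also have "\<dots> = (\<Sum>p\<in>F. \<integral>x. \<zeta> p x - g p x \<partial>?M)"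
      using iz by (rule Bochner_Integration.integral_sum)
    also have "\<dots> \<le> (\<Sum>p\<in>F. e / N)" using g(6) by (intro sum_mono) auto
    also have "\<dots> \<le> e" using N(2) by simp
    finally show "(\<integral>x. 1 - \<kappa> x \<partial>?M) \<le> e" .
    fix t assume t: "t \<in> J"
    have cV: "continuous_on (closure \<Omega>) (\<lambda>x. V (x, t))"
      using continuous_on_slice(1)[OF V t] by simp
    have ig: "integrable ?M (\<lambda>x. grad (\<zeta> p) x \<bullet> V (x, t))" for p
    proof -
      have c: "continuous_on (closure \<Omega>) (\<lambda>x. grad (\<zeta> p) x \<bullet> V (x, t))"
        unfolding grad_def by (intro continuous_intros cV continuous_on_subset[OF z(2)] Q)
      obtain B where "0 \<le> B" "\<And>x. x \<in> closure \<Omega> \<Longrightarrow> \<bar>grad (\<zeta> p) x \<bullet> V (x, t)\<bar> \<le> B"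
        by (rule compact_abs_bound[OF ccl c]) blast
      then show ?thesis using closure_subset
        by (intro integrable_vol[OF \<Omega> measurable_vol[OF continuous_on_subset[OF c closure_subset]], of B]) blast
    qed
    have cd: "continuous_on \<Omega> (?div t)" using dV(2)[OF t] by (intro continuous_on_sum) auto
    have id: "integrable ?M (\<lambda>x. g p x * ?div t x)" if "p \<in> F" for p
      using g(5)[OF that]
      by (intro integrable_vol_compact_support[OF \<Omega> g(1,2)[OF that]] continuous_on_mult g(3) that cd) auto
    have "(\<integral>x. \<kappa> x * ?div t x \<partial>?M) = (\<Sum>p\<in>F. \<integral>x. g p x * ?div t x \<partial>?M)"
      unfolding \<kappa>_def sum_distrib_right using id by (intro Bochner_Integration.integral_sum)
    also have "\<dots> \<le> (\<Sum>p\<in>F. e / N - (\<integral>x. grad (\<zeta> p) x \<bullet> V (x, t) \<partial>?M))"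
      using g(7)[OF _ t] by (intro sum_mono) force
    also have "\<dots> = card F * (e / N) - (\<integral>x. (\<Sum>p\<in>F. grad (\<zeta> p) x \<bullet> V (x, t)) \<partial>?M)"
      using ig by (simp add: sum_subtractf Bochner_Integration.integral_sum)
    \<comment> \<open>The flux terms of the separate pieces have no sign, but they cancel in the sum
      because the gradients of the partition of unity add up to 0.\<close>
    also have "(\<integral>x. (\<Sum>p\<in>F. grad (\<zeta> p) x \<bullet> V (x, t)) \<partial>?M) = (\<integral>x. 0 \<partial>?M)"
      by (rule Bochner_Integration.integral_cong)
         (use z(6) \<Omega>Q in \<open>auto simp: inner_sum_left[symmetric]\<close>)
    also have "card F * (e / N) - (\<integral>x. 0 \<partial>?M) \<le> e" using N(2) by simp
    finally show "(\<integral>x. \<kappa> x * ?div t x \<partial>?M) \<le> e" .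
  qed
qed

section \<open>The weighted mass of a solution\<close>

lemma Ck_on_2D:
  assumes "open \<Omega>" "Ck_on 2 \<Omega> v"
  shows "\<And>x. x \<in> \<Omega> \<Longrightarrow> v differentiable at x" "continuous_on \<Omega> v"
    "\<And>x b. x \<in> \<Omega> \<Longrightarrow> b \<in> Basis \<Longrightarrow> pd b v differentiable at x"
    "\<And>b. b \<in> Basis \<Longrightarrow> continuous_on \<Omega> (pd b v)"
    "\<And>b c. b \<in> Basis \<Longrightarrow> c \<in> Basis \<Longrightarrow> continuous_on \<Omega> (pd c (pd b v))"
proof -
  have 1: "v differentiable_on \<Omega>" "\<And>b. b \<in> Basis \<Longrightarrow> pd b v differentiable_on \<Omega>"
    "\<And>b c. b \<in> Basis \<Longrightarrow> c \<in> Basis \<Longrightarrow> continuous_on \<Omega> (pd c (pd b v))"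
    using assms(2) by (auto simp: numeral_2_eq_2)
  then show "continuous_on \<Omega> v" "\<And>b. b \<in> Basis \<Longrightarrow> continuous_on \<Omega> (pd b v)"
    by (auto intro: differentiable_imp_continuous_on)
  show "\<And>x. x \<in> \<Omega> \<Longrightarrow> v differentiable at x" "\<And>x b. x \<in> \<Omega> \<Longrightarrow> b \<in> Basis \<Longrightarrow> pd b v differentiable at x"
    using 1 assms(1) by (simp_all add: differentiable_on_eq_differentiable_at)
  show "\<And>b c. b \<in> Basis \<Longrightarrow> c \<in> Basis \<Longrightarrow> continuous_on \<Omega> (pd c (pd b v))" by (rule 1)
qed

text \<open>On the real line the only basis vector is 1, so the class defined with \<open>pd\<close>
  is the usual one for \<open>deriv\<close>.\<close>

lemma Ck_on_real:
  fixes f :: "real \<Rightarrow> real"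
  assumes "Ck_on (Suc k) UNIV f"
  shows "(f has_real_derivative deriv f x) (at x)" "Ck_on k UNIV (deriv f)"
proof -
  have d: "(f has_real_derivative pd 1 f x) (at x)" for x
  proof -
    have df: "f differentiable at x" using assms by (simp add: differentiable_on_def)
    interpret D: bounded_linear "frechet_derivative f (at x)"
      by (rule has_derivative_bounded_linear[OF has_derivative_frechet[OF df]])
    have "frechet_derivative f (at x) = (*) (pd 1 f x)"
    proof
      fix h show "frechet_derivative f (at x) h = pd 1 f x * h"
        using D.scaleR[of h 1] by (simp add: pd_def mult.commute)
    qed
    then show ?thesis using has_derivative_frechet[OF df] by (simp add: has_field_derivative_def)
  qed
  then have "deriv f = pd 1 f" by (auto intro: DERIV_imp_deriv)
  then show "(f has_real_derivative deriv f x) (at x)" "Ck_on k UNIV (deriv f)"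
    using d assms by auto
qed

lemma Ck_on_2_compose:
  assumes \<Omega>: "open \<Omega>" and v: "Ck_on 2 \<Omega> v" and K: "Ck_on 2 UNIV (K :: real \<Rightarrow> real)"
  shows "Ck_on 2 \<Omega> (\<lambda>x. K (v x))" "\<And>x b. x \<in> \<Omega> \<Longrightarrow> pd b (\<lambda>x. K (v x)) x = deriv K (v x) * pd b v x"
proof -
  note v' = Ck_on_2D[OF \<Omega> v]
  have K2: "Ck_on (Suc (Suc 0)) UNIV K" using K by (simp add: numeral_2_eq_2)
  note K1 = Ck_on_real[OF K2]
  note K3 = Ck_on_real[OF K1(2)]
  show p: "pd b (\<lambda>x. K (v x)) x = deriv K (v x) * pd b v x" if "x \<in> \<Omega>" for x b
    by (rule pd_chain(2)[OF v'(1)[OF that] K1(1)])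
  have pp: "pd b (\<lambda>x. K (v x)) differentiable at x \<and> pd c (pd b (\<lambda>x. K (v x))) x
      = deriv K (v x) * pd c (pd b v) x + deriv (deriv K) (v x) * pd c v x * pd b v x" if "x \<in> \<Omega>" "b \<in> Basis" for x b c
  proof -
    note c = pd_chain[OF v'(1)[OF that(1)] K3(1)]
    have "(\<lambda>x. deriv K (v x) * pd b v x) differentiable at x"
      by (intro differentiable_mult c v' that)
    moreover have "pd c (\<lambda>x. deriv K (v x) * pd b v x) x = deriv K (v x) * pd c (pd b v) x + deriv (deriv K) (v x) * pd c v x * pd b v x"
      by (subst pd_mult[OF c(1) v'(3)[OF that]]) (simp add: c(2))
    ultimately show ?thesis
      using differentiable_transform_open[OF _ \<Omega> that(1), of _ "pd b (\<lambda>x. K (v x))"] p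
        pd_cong_open[OF \<Omega> that(1), of "pd b (\<lambda>x. K (v x))"] by auto
  qed
  have ck: "continuous_on \<Omega> (\<lambda>x. h (v x))" if "continuous_on UNIV h" for h :: "real \<Rightarrow> real"
    by (rule continuous_on_compose2[OF that v'(2)]) simp
  have cd: "continuous_on UNIV (deriv K)" "continuous_on UNIV (deriv (deriv K))"
    using K3 K1 by (auto intro: DERIV_continuous_on has_field_derivative_at_within)
  have "continuous_on \<Omega> (pd c (pd b (\<lambda>x. K (v x))))" if "b \<in> Basis" "c \<in> Basis" for b c
  proof -
    have "continuous_on \<Omega> (\<lambda>x. deriv K (v x) * pd c (pd b v) x + deriv (deriv K) (v x) * pd c v x * pd b v x)"
      by (intro continuous_intros ck cd v' that)
    then show ?thesis by (simp add: pp that cong: continuous_on_cong)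
  qed
  then show "Ck_on 2 \<Omega> (\<lambda>x. K (v x))"
    using pp pd_chain(1)[OF v'(1) K1(1)] \<Omega>
    by (auto simp: numeral_2_eq_2 differentiable_on_eq_differentiable_at)
qed

lemma tendsto_within_closure:
  assumes "continuous_on (closure S) h" "x \<in> closure S"
  shows "(h \<longlongrightarrow> h x) (at x within S)"
  by (rule tendsto_within_subset[OF _ closure_subset]) (use assms in \<open>auto simp: continuous_on_def\<close>)

text \<open>Limits are taken over punctured neighbourhoods. Since \<open>x\<close> lies outside
  \<open>S\<close>, the first component never equals \<open>x\<close>, and a purely spatial limit at
  a boundary point becomes a limit in space and time.\<close>

lemma filterlim_fst_within:
  assumes "x \<notin> S"
  shows "filterlim fst (at x within S) (at (x, t) within S \<times> J)"
proof -
  have "((\<lambda>z. fst z) \<longlongrightarrow> x) (at (x, t) within S \<times> J)"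
    using tendsto_fst[OF tendsto_ident_at[of "(x, t)" "S \<times> J"]] by simp
  moreover have "\<forall>\<^sub>F z in at (x, t) within S \<times> J. fst z \<in> S \<and> fst z \<noteq> x"
    unfolding eventually_at_filter by (rule always_eventually) (use assms in auto)
  ultimately show ?thesis by (simp add: filterlim_at)
qed

locale eigen_problem =
  fixes \<Omega> :: "'a::euclidean_space set" and \<beta> :: "'a \<Rightarrow> ennreal"
    and f K :: "real \<Rightarrow> real" and lam \<mu> :: real and \<phi> :: "'a \<Rightarrow> real"
  assumes open\<Omega>: "open \<Omega>" and bdd: "bounded \<Omega>" and smooth_bdry: "Ck_boundary 2 \<Omega>"
    and lam: "0 < lam" and f3: "Ck_on 3 UNIV f" and K3: "Ck_on 3 UNIV K"
    and K0: "0 \<le> K 0" "\<And>s. 0 < s \<Longrightarrow> 0 < K s"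
    and Kd: "\<And>s. 0 \<le> s \<Longrightarrow> 0 < deriv K s" "\<And>s. 0 \<le> s \<Longrightarrow> 0 < deriv (deriv K) s"
    and fp: "\<And>s. 0 \<le> s \<Longrightarrow> 0 < f s"
    and fd: "\<And>s. 0 \<le> s \<Longrightarrow> 0 < deriv f s" "\<And>s. 0 \<le> s \<Longrightarrow> 0 < deriv (deriv f) s"
    and eig: "eigenfunction \<Omega> \<beta> \<mu> \<phi>" and \<phi>_pos: "\<And>x. x \<in> \<Omega> \<Longrightarrow> 0 < \<phi> x"
    and \<phi>1: "(\<integral>x. \<phi> x \<partial>vol \<Omega>) = 1"
begin

abbreviation "M \<equiv> vol \<Omega>"

sublocale M: finite_measure M by (rule finite_measure_vol[OF open\<Omega> bdd])

lemma \<Omega>_closure: "x \<in> \<Omega> \<Longrightarrow> x \<in> closure \<Omega>" using closure_subset by blast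

lemma compact_cl: "compact (closure \<Omega>)" using bdd by (simp add: compact_closure)

lemma bdry1: "p \<in> frontier \<Omega> \<Longrightarrow> \<exists>\<rho>. local_defining_function 1 \<Omega> p \<rho>"
proof -
  assume "p \<in> frontier \<Omega>"
  then obtain \<rho> U where "open U \<and> p \<in> U \<and> Ck_on 2 U \<rho> \<and> grad \<rho> p \<noteq> 0 \<and> \<Omega> \<inter> U = {x \<in> U. \<rho> x < 0}"
    using smooth_bdry by (auto simp: Ck_boundary_def local_defining_function_def)
  moreover then have "Ck_on 1 U \<rho>" using Ck_on_Suc_D[of U 1 \<rho>] by (simp del: Ck_on.simps add: numeral_2_eq_2)
  ultimately show ?thesis unfolding local_defining_function_def by blast
qed

lemma \<phi>C2: "Ck_on 2 \<Omega> \<phi>" and \<phi>cont: "continuous_on (closure \<Omega>) \<phi>"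
  and \<phi>lap: "\<And>x. x \<in> \<Omega> \<Longrightarrow> laplacian \<phi> x = - \<mu> * \<phi> x"
  and \<phi>bc: "\<And>x. x \<in> frontier \<Omega> \<Longrightarrow> boundary_condition \<Omega> \<beta> \<phi> x"
  using eig by (auto simp: eigenfunction_def add_eq_0_iff)

lemmas \<phi>D = Ck_on_2D[OF open\<Omega> \<phi>C2]

lemma \<phi>_nonneg: "x \<in> closure \<Omega> \<Longrightarrow> 0 \<le> \<phi> x"
  using continuous_ge_on_closure[OF \<phi>cont, of x 0] \<phi>_pos by (simp add: less_imp_le)

lemma K2: "Ck_on 2 UNIV K" and f2: "Ck_on 2 UNIV f"
  by (rule Ck_on_Suc_D[OF open_UNIV]; use K3 f3 in \<open>simp del: Ck_on.simps\<close>)+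

lemma K_deriv: "(K has_real_derivative deriv K s) (at s)" "(deriv K has_real_derivative deriv (deriv K) s) (at s)"
  by (rule Ck_on_real[OF K2[unfolded numeral_2_eq_2]] Ck_on_real(1)[OF Ck_on_real(2)[OF K2[unfolded numeral_2_eq_2]]])+

lemma f_deriv: "(f has_real_derivative deriv f s) (at s)" "(deriv f has_real_derivative deriv (deriv f) s) (at s)"
  by (rule Ck_on_real[OF f2[unfolded numeral_2_eq_2]] Ck_on_real(1)[OF Ck_on_real(2)[OF f2[unfolded numeral_2_eq_2]]])+

lemma K_cont: "continuous_on S K" "continuous_on S (deriv K)" and f_cont: "continuous_on S f"
  by (rule DERIV_continuous_on, rule has_field_derivative_at_within, rule K_deriv f_deriv)+

lemma K_nonneg: "0 \<le> s \<Longrightarrow> 0 \<le> K s"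
  using K0(1) K0(2)[of s] by (cases "s = 0") auto

end

text \<open>Kept apart from \<open>eigen_problem\<close> because the threshold for the initial data
  has to be found from the fixed data alone, before any solution is given.\<close>

locale solution = eigen_problem +
  fixes u0 :: "'a \<Rightarrow> real" and T :: ereal and u :: "'a \<Rightarrow> real \<Rightarrow> real"
  assumes sol: "classical_solution \<Omega> \<beta> lam f K u0 T u"
    and u_pos: "\<And>x t. x \<in> \<Omega> \<Longrightarrow> t \<in> existence_times T \<Longrightarrow> 0 < u x t"
begin

abbreviation "I \<equiv> existence_times T"

lemma open_I: "open I"
proof -
  have "I = {0<..} \<inter> ereal -` {..<T}" by (auto simp: existence_times_def)
  then show ?thesis by (simp add: continuous_on_ereal open_vimage open_Int)
qed

lemma I_interval: "a \<in> I \<Longrightarrow> b \<in> I \<Longrightarrow> {a..b} \<subseteq> I"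
proof
  fix x assume "a \<in> I" "b \<in> I" "x \<in> {a..b}"
  then have "0 < x" "ereal x \<le> ereal b" "ereal b < T" by (auto simp: existence_times_def)
  then show "x \<in> I" unfolding existence_times_def using le_less_trans[of "ereal x" "ereal b" T] by blast
qed

lemma C21: "C21_on \<Omega> I u" and u_cont: "continuous_on (closure \<Omega> \<times> I) (\<lambda>(x, t). u x t)"
  and grad_lim: "\<And>x t. x \<in> frontier \<Omega> \<Longrightarrow> \<beta> x \<noteq> \<infinity> \<Longrightarrow> t \<in> I \<Longrightarrow>
     \<exists>g. ((\<lambda>(y, s). grad (\<lambda>z. u z s) y) \<longlongrightarrow> g) (at (x, t) within \<Omega> \<times> I)"
  and pde: "\<And>x t. x \<in> \<Omega> \<Longrightarrow> t \<in> I \<Longrightarrow> deriv (u x) t = laplacian (\<lambda>y. K (u y t)) x + lam * f (u x t)"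
  and bc: "\<And>x t. x \<in> frontier \<Omega> \<Longrightarrow> t \<in> I \<Longrightarrow> boundary_condition \<Omega> \<beta> (\<lambda>y. K (u y t)) x"
  and u_cont0: "continuous_on (\<Omega> \<times> insert 0 I) (\<lambda>(x, t). u x t)"
  and u_init: "\<And>x. x \<in> \<Omega> \<Longrightarrow> u x 0 = u0 x"
  and u_bdd: "\<And>s. s \<in> I \<Longrightarrow> \<exists>C. \<forall>x\<in>\<Omega>. \<forall>t\<in>{0<..s}. \<bar>u x t\<bar> \<le> C"
  using sol by (auto simp: classical_solution_def)

lemma u_slice: "t \<in> I \<Longrightarrow> continuous_on (closure \<Omega>) (\<lambda>x. u x t)"
  using continuous_on_slice(1)[OF u_cont] by simp

lemma u_nonneg: "x \<in> closure \<Omega> \<Longrightarrow> t \<in> I \<Longrightarrow> 0 \<le> u x t"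
  using continuous_ge_on_closure[OF u_slice, of t x 0] u_pos by (simp add: less_imp_le)

lemma uC2: "t \<in> I \<Longrightarrow> Ck_on 2 \<Omega> (\<lambda>x. u x t)"
  using C21 by (auto simp: C21_on_def)

lemma u_deriv: "x \<in> \<Omega> \<Longrightarrow> t \<in> I \<Longrightarrow> (u x has_real_derivative deriv (u x) t) (at t)"
  using C21 open_I unfolding C21_on_def
  by (metis DERIV_deriv_iff_real_differentiable differentiable_on_eq_differentiable_at)

lemma wC2: "t \<in> I \<Longrightarrow> Ck_on 2 \<Omega> (\<lambda>x. K (u x t))"
  and pd_w: "\<And>x b. t \<in> I \<Longrightarrow> x \<in> \<Omega> \<Longrightarrow> pd b (\<lambda>x. K (u x t)) x = deriv K (u x t) * pd b (\<lambda>x. u x t) x"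
  using Ck_on_2_compose[OF open\<Omega> uC2 K2] by auto

lemma grad_w: "t \<in> I \<Longrightarrow> x \<in> \<Omega> \<Longrightarrow> grad (\<lambda>x. K (u x t)) x = deriv K (u x t) *\<^sub>R grad (\<lambda>x. u x t) x"
  unfolding grad_def by (simp add: pd_w scaleR_sum_right)

text \<open>The Green field for \<open>K(u)\<close> and the truncated eigenfunction. It is written
  with the gradient of \<open>u\<close> rather than that of \<open>K(u)\<close>, since it is the
  former for which a classical solution provides limits at the boundary jointly in space and
  time.\<close>

definition W :: "real \<Rightarrow> 'a \<times> real \<Rightarrow> 'a" where
  "W \<epsilon> = (\<lambda>(x, t). (K (u x t) * trunc' \<epsilon> (\<phi> x)) *\<^sub>R grad \<phi> x
     - (trunc \<epsilon> (\<phi> x) * deriv K (u x t)) *\<^sub>R grad (\<lambda>y. u y t) x)"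

lemma W_alt: "t \<in> I \<Longrightarrow> x \<in> \<Omega> \<Longrightarrow> W \<epsilon> (x, t) = (K (u x t) * trunc' \<epsilon> (\<phi> x)) *\<^sub>R grad \<phi> x
     - trunc \<epsilon> (\<phi> x) *\<^sub>R grad (\<lambda>y. K (u y t)) x"
  by (simp add: W_def grad_w)

lemma trunc_cont: "0 < \<epsilon> \<Longrightarrow> continuous_on S (trunc \<epsilon>)" "0 < \<epsilon> \<Longrightarrow> continuous_on S (trunc' \<epsilon>)"
  "0 < \<epsilon> \<Longrightarrow> continuous_on S (trunc'' \<epsilon>)"
  using trunc_derivs[of \<epsilon>]
  by (auto intro!: continuous_at_imp_continuous_on intro: DERIV_isCont)

lemma W_cont:
  assumes "0 < \<epsilon>"
  shows "continuous_on (\<Omega> \<times> I) (W \<epsilon>)"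
proof -
  have u: "continuous_on (\<Omega> \<times> I) (\<lambda>z. u (fst z) (snd z))"
    using continuous_on_subset[OF u_cont, of "\<Omega> \<times> I"] closure_subset by (auto simp: case_prod_unfold)
  have gu: "continuous_on (\<Omega> \<times> I) (\<lambda>z. grad (\<lambda>y. u y (snd z)) (fst z))"
    using C21 unfolding grad_def C21_on_def case_prod_unfold by (intro continuous_intros) auto
  have p: "continuous_on (\<Omega> \<times> I) (\<lambda>z. h (\<phi> (fst z)))" if "continuous_on UNIV h" for h :: "real \<Rightarrow> real"
    by (rule continuous_on_compose2[OF that]) (auto intro!: continuous_on_compose2[OF \<phi>D(2)] continuous_intros)
  have gp: "continuous_on (\<Omega> \<times> I) (\<lambda>z. grad \<phi> (fst z))"
    unfolding grad_def by (intro continuous_intros) (auto intro!: continuous_on_compose2[OF \<phi>D(4)] continuous_intros)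
  show ?thesis
    unfolding W_def case_prod_unfold
    by (intro continuous_intros gu gp p trunc_cont assms continuous_on_compose2[OF K_cont(1) u]
        continuous_on_compose2[OF K_cont(2) u]) auto
qed

text \<open>Where \<open>\<beta>\<close> is finite, all ingredients have limits. At a Dirichlet
  point the gradients may be unbounded, but \<open>\<phi>\<close> is below \<open>\<epsilon>\<close>
  nearby, so both truncation factors, and with them \<open>W\<close>, vanish in a
  neighbourhood.\<close>

lemma W_limit:
  assumes "0 < \<epsilon>" "x \<in> closure \<Omega>" "t \<in> I"
  shows "\<exists>l. (W \<epsilon> \<longlongrightarrow> l) (at (x, t) within \<Omega> \<times> I)"
proof (cases "x \<in> \<Omega>")
  case True
  then show ?thesis using W_cont[OF assms(1)] assms(3) by (auto simp: continuous_on_def)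
next
  case False
  then have x: "x \<in> frontier \<Omega>" using assms(2) open\<Omega> by (simp add: frontier_def interior_open)
  let ?F = "at (x, t) within \<Omega> \<times> I"
  have \<phi>l: "((\<lambda>z. \<phi> (fst z)) \<longlongrightarrow> \<phi> x) ?F"
  proof (rule filterlim_compose[OF _ filterlim_fst_within[OF False]])
    show "(\<phi> \<longlongrightarrow> \<phi> x) (at x within \<Omega>)"
      by (rule tendsto_within_closure[OF \<phi>cont assms(2)])
  qed
  show ?thesis
  proof (cases "\<beta> x = \<infinity>")
    case True
    then have "\<phi> x = 0" using \<phi>bc[OF x] by (simp add: boundary_condition_def)
    then have "\<forall>\<^sub>F z in ?F. \<phi> (fst z) < \<epsilon>" using order_tendstoD(2)[OF \<phi>l] assms(1) by simp
    then have "\<forall>\<^sub>F z in ?F. W \<epsilon> z = 0"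
      by eventually_elim (simp add: W_def case_prod_unfold trunc_eq_0)
    then show ?thesis using tendsto_eventually by blast
  next
    case False
    from grad_lim[OF x False assms(3)] obtain g where
      g: "((\<lambda>z. grad (\<lambda>y. u y (snd z)) (fst z)) \<longlongrightarrow> g) ?F" by (auto simp: case_prod_unfold)
    from \<phi>bc[OF x] False obtain h where "(grad \<phi> \<longlongrightarrow> h) (at x within \<Omega>)" by (auto simp: boundary_condition_def)
    from filterlim_compose[OF this filterlim_fst_within[OF \<open>x \<notin> \<Omega>\<close>]]
    have h: "((\<lambda>z. grad \<phi> (fst z)) \<longlongrightarrow> h) ?F" .
    have ul: "((\<lambda>z. u (fst z) (snd z)) \<longlongrightarrow> u x t) ?F"
    proof -
      have "((\<lambda>(x, t). u x t) \<longlongrightarrow> u x t) (at (x, t) within closure \<Omega> \<times> I)"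
        using u_cont assms(2,3) by (auto simp: continuous_on_def)
      then show ?thesis
        using closure_subset by (auto simp: case_prod_unfold intro: tendsto_within_subset)
    qed
    have c: "isCont K s" "isCont (deriv K) s" "isCont (trunc \<epsilon>) s" "isCont (trunc' \<epsilon>) s" for s
      by (rule DERIV_isCont, rule K_deriv trunc_derivs[OF assms(1)])+
    have "(W \<epsilon> \<longlongrightarrow> (K (u x t) * trunc' \<epsilon> (\<phi> x)) *\<^sub>R h - (trunc \<epsilon> (\<phi> x) * deriv K (u x t)) *\<^sub>R g) ?F"
      unfolding W_def case_prod_unfold
      by (intro tendsto_intros g h isCont_tendsto_compose[OF c(1)] isCont_tendsto_compose[OF c(2)]
          isCont_tendsto_compose[OF c(3)] isCont_tendsto_compose[OF c(4)] ul \<phi>l)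
    then show ?thesis by blast
  qed
qed

text \<open>With $w = K(u)$ and $\eta$ the truncation, $V\cdot\hat n = -\beta w (\eta'(\phi)\phi - \eta(\phi)) \le 0$ on the
  boundary by convexity of $\eta$; near Dirichlet points, \<open>V\<close> vanishes.\<close>

lemma W_extension:
  assumes \<epsilon>: "0 < \<epsilon>" and J: "{a..b} \<subseteq> I"
  obtains V where "continuous_on (closure \<Omega> \<times> {a..b}) V"
    "\<And>x t. x \<in> \<Omega> \<Longrightarrow> t \<in> {a..b} \<Longrightarrow> V (x, t) = W \<epsilon> (x, t)"
    "\<And>x t. x \<in> frontier \<Omega> \<Longrightarrow> t \<in> {a..b} \<Longrightarrow> V (x, t) \<bullet> outer_normal \<Omega> x \<le> 0"
proof -
  have cl: "closure (\<Omega> \<times> {a..b}) = closure \<Omega> \<times> {a..b}" by (simp add: closure_Times)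
  have "\<exists>l. (W \<epsilon> \<longlongrightarrow> l) (at z within \<Omega> \<times> {a..b})" if "z \<in> closure (\<Omega> \<times> {a..b})" for z
  proof -
    have "fst z \<in> closure \<Omega>" "snd z \<in> I" using that J unfolding cl by auto
    from W_limit[OF \<epsilon> this] show ?thesis
      using J by (auto intro: tendsto_within_subset)
  qed
  moreover have "continuous_on (\<Omega> \<times> {a..b}) (W \<epsilon>)"
    by (rule continuous_on_subset[OF W_cont[OF \<epsilon>]]) (use J in auto)
  ultimately obtain V where V: "continuous_on (closure \<Omega> \<times> {a..b}) V" "\<And>z. z \<in> \<Omega> \<times> {a..b} \<Longrightarrow> V z = W \<epsilon> z"
    using continuous_extension_closure[of "\<Omega> \<times> {a..b}" "W \<epsilon>"] unfolding cl by metis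
  have "V (x, t) \<bullet> outer_normal \<Omega> x \<le> 0" if x: "x \<in> frontier \<Omega>" and t: "t \<in> {a..b}" for x t
  proof -
    have tI: "t \<in> I" using t J by auto
    have xc: "x \<in> closure \<Omega>" and xn: "x \<notin> \<Omega>" using x open\<Omega> by (auto simp: frontier_def interior_open)
    let ?F = "at x within \<Omega>"
    have nt: "?F \<noteq> bot" using xc xn islimpt_in_closure[of x \<Omega>] by (simp add: trivial_limit_within)
    have ev: "\<forall>\<^sub>F y in ?F. y \<in> \<Omega>"
      unfolding eventually_at_filter by (rule always_eventually) auto
    have lim: "(h \<longlongrightarrow> h x) ?F" if "continuous_on (closure \<Omega>) h" for h :: "'a \<Rightarrow> 'b::topological_space"
      by (rule tendsto_within_closure[OF that xc])
    \<comment> \<open>The boundary values of \<open>V\<close> arise as limits in space and time,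
      whereas the boundary conditions speak of limits in space at a fixed time. Continuity of
      \<open>V\<close> reconciles them, and uniqueness of limits then identifies
      \<open>V (x, t)\<close>.\<close>
    have "continuous_on (closure \<Omega>) (\<lambda>y. V (y, t))"
      using continuous_on_slice(1)[OF V(1) t] by simp
    from lim[OF this] have "((\<lambda>y. V (y, t)) \<longlongrightarrow> V (x, t)) ?F" .
    moreover have "\<forall>\<^sub>F y in ?F. V (y, t) = (K (u y t) * trunc' \<epsilon> (\<phi> y)) *\<^sub>R grad \<phi> y - trunc \<epsilon> (\<phi> y) *\<^sub>R grad (\<lambda>y. K (u y t)) y"
      using ev by eventually_elim (use V(2) W_alt tI t in auto)
    ultimately have VL: "((\<lambda>y. (K (u y t) * trunc' \<epsilon> (\<phi> y)) *\<^sub>R grad \<phi> y - trunc \<epsilon> (\<phi> y) *\<^sub>R grad (\<lambda>y. K (u y t)) y) \<longlongrightarrow> V (x, t)) ?F"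
      by (rule Lim_transform_eventually)
    show ?thesis
    proof (cases "\<beta> x = \<infinity>")
      case True
      then have "\<phi> x = 0" using \<phi>bc[OF x] by (simp add: boundary_condition_def)
      then have "\<forall>\<^sub>F y in ?F. \<phi> y < \<epsilon>" using order_tendstoD(2)[OF lim[OF \<phi>cont]] \<epsilon> by simp
      then have "\<forall>\<^sub>F y in ?F. (K (u y t) * trunc' \<epsilon> (\<phi> y)) *\<^sub>R grad \<phi> y - trunc \<epsilon> (\<phi> y) *\<^sub>R grad (\<lambda>y. K (u y t)) y = 0"
        by eventually_elim (simp add: trunc_eq_0)
      from tendsto_unique[OF nt VL tendsto_eventually[OF this]] show ?thesis by simp
    next
      case False
      from \<phi>bc[OF x] False obtain h where h: "(grad \<phi> \<longlongrightarrow> h) ?F" "outer_normal \<Omega> x \<bullet> h = - enn2real (\<beta> x) * \<phi> x"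
        by (auto simp: boundary_condition_def add_eq_0_iff)
      from bc[OF x tI] False obtain g where g: "(grad (\<lambda>y. K (u y t)) \<longlongrightarrow> g) ?F" "outer_normal \<Omega> x \<bullet> g = - enn2real (\<beta> x) * K (u x t)"
        by (auto simp: boundary_condition_def add_eq_0_iff)
      have c: "isCont K s" "isCont (trunc \<epsilon>) s" "isCont (trunc' \<epsilon>) s" for s
        by (rule DERIV_isCont, rule K_deriv trunc_derivs[OF \<epsilon>])+
      have "((\<lambda>y. (K (u y t) * trunc' \<epsilon> (\<phi> y)) *\<^sub>R grad \<phi> y - trunc \<epsilon> (\<phi> y) *\<^sub>R grad (\<lambda>y. K (u y t)) y)
          \<longlongrightarrow> (K (u x t) * trunc' \<epsilon> (\<phi> x)) *\<^sub>R h - trunc \<epsilon> (\<phi> x) *\<^sub>R g) ?F"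
        by (intro tendsto_intros g(1) h(1) isCont_tendsto_compose[OF c(1)] isCont_tendsto_compose[OF c(2)]
            isCont_tendsto_compose[OF c(3)] lim[OF \<phi>cont] lim[OF u_slice[OF tI]])
      from tendsto_unique[OF nt VL this]
      have "V (x, t) \<bullet> outer_normal \<Omega> x = (K (u x t) * trunc' \<epsilon> (\<phi> x)) * (outer_normal \<Omega> x \<bullet> h) - trunc \<epsilon> (\<phi> x) * (outer_normal \<Omega> x \<bullet> g)"
        by (simp add: inner_diff_left inner_commute[of _ "outer_normal \<Omega> x"] inner_diff_right)
      also have "\<dots> = - (enn2real (\<beta> x) * K (u x t) * (trunc' \<epsilon> (\<phi> x) * \<phi> x - trunc \<epsilon> (\<phi> x)))"
        unfolding h(2) g(2) by (simp add: algebra_simps)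
      also have "\<dots> \<le> 0"
        using trunc_bounds(5)[OF \<epsilon> \<phi>_nonneg[OF xc]] K_nonneg[OF u_nonneg[OF xc tI]] by simp
      finally show ?thesis .
    qed
  qed
  then show ?thesis using that V by auto
qed

text \<open>The two mixed terms \<eta>'(\<phi>) grad w . grad \<phi> cancel, and the eigenvalue
  equation turns the Laplacian of \<open>\<phi>\<close> into \<open>- \<mu> * \<phi>\<close>. This
  is the source of the weight \<open>trunc' \<epsilon> (\<phi> x) * \<phi> x\<close> in front of
  \<open>K (u x t)\<close>.\<close>

lemma W_divergence:
  assumes \<epsilon>: "0 < \<epsilon>" and t: "t \<in> I" and V: "\<And>y. y \<in> \<Omega> \<Longrightarrow> V y = W \<epsilon> (y, t)"
  shows "\<And>x b. x \<in> \<Omega> \<Longrightarrow> b \<in> Basis \<Longrightarrow> (\<lambda>y. V y \<bullet> b) differentiable at x"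
    and "\<And>b. b \<in> Basis \<Longrightarrow> continuous_on \<Omega> (pd b (\<lambda>y. V y \<bullet> b))"
    and "\<And>x. x \<in> \<Omega> \<Longrightarrow> (\<Sum>b\<in>Basis. pd b (\<lambda>y. V y \<bullet> b) x)
      = K (u x t) * trunc'' \<epsilon> (\<phi> x) * (\<Sum>b\<in>Basis. (pd b \<phi> x)\<^sup>2) - \<mu> * K (u x t) * (trunc' \<epsilon> (\<phi> x) * \<phi> x)
        - trunc \<epsilon> (\<phi> x) * laplacian (\<lambda>y. K (u y t)) x"
proof -
  let ?w = "\<lambda>y. K (u y t)"
  note w = Ck_on_2D[OF open\<Omega> wC2[OF t]]
  define X where "X b y = (?w y * trunc' \<epsilon> (\<phi> y)) * pd b \<phi> y - trunc \<epsilon> (\<phi> y) * pd b ?w y" for b y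
  have VX: "X b y = V y \<bullet> b" if "y \<in> \<Omega>" "b \<in> Basis" for b y
    using that by (simp add: V W_alt[OF t] X_def inner_diff_left grad_inner_Basis)
  have X: "X b differentiable at x \<and> pd b (X b) x = ?w x * trunc'' \<epsilon> (\<phi> x) * (pd b \<phi> x)\<^sup>2
      + ?w x * trunc' \<epsilon> (\<phi> x) * pd b (pd b \<phi>) x - trunc \<epsilon> (\<phi> x) * pd b (pd b ?w) x"
    if x: "x \<in> \<Omega>" and b: "b \<in> Basis" for x b
  proof -
    note c1 = pd_chain[OF \<phi>D(1)[OF x] trunc_derivs(1)[OF \<epsilon>]]
    note c2 = pd_chain[OF \<phi>D(1)[OF x] trunc_derivs(2)[OF \<epsilon>]]
    note d1 = differentiable_mult[OF w(1)[OF x] c2(1)]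
    note d2 = differentiable_mult[OF d1 \<phi>D(3)[OF x b]]
    note d3 = differentiable_mult[OF c1(1) w(3)[OF x b]]
    have "pd b (X b) x = (?w x * trunc' \<epsilon> (\<phi> x) * pd b (pd b \<phi>) x
        + (?w x * (trunc'' \<epsilon> (\<phi> x) * pd b \<phi> x) + pd b ?w x * trunc' \<epsilon> (\<phi> x)) * pd b \<phi> x)
        - (trunc \<epsilon> (\<phi> x) * pd b (pd b ?w) x + trunc' \<epsilon> (\<phi> x) * pd b \<phi> x * pd b ?w x)"
      unfolding X_def
      by (simp add: pd_diff[OF d2 d3] pd_mult[OF d1 \<phi>D(3)[OF x b]] pd_mult[OF w(1)[OF x] c2(1)]
          pd_mult[OF c1(1) w(3)[OF x b]] c1(2) c2(2))
    also have "\<dots> = ?w x * trunc'' \<epsilon> (\<phi> x) * (pd b \<phi> x)\<^sup>2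
      + ?w x * trunc' \<epsilon> (\<phi> x) * pd b (pd b \<phi>) x - trunc \<epsilon> (\<phi> x) * pd b (pd b ?w) x"
      by (simp add: algebra_simps power2_eq_square)
    finally show ?thesis using differentiable_diff[OF d2 d3] by (simp add: X_def[abs_def])
  qed
  have pdV: "pd b (\<lambda>y. V y \<bullet> b) x = pd b (X b) x" if "x \<in> \<Omega>" "b \<in> Basis" for x b
    by (rule pd_cong_open[OF open\<Omega> that(1)]) (simp add: VX that)
  show "(\<lambda>y. V y \<bullet> b) differentiable at x" if "x \<in> \<Omega>" "b \<in> Basis" for x b
    by (rule differentiable_transform_open[OF conjunct1[OF X[OF that]] open\<Omega> that(1)]) (rule VX[OF _ that(2)])
  show "continuous_on \<Omega> (pd b (\<lambda>y. V y \<bullet> b))" if b: "b \<in> Basis" for b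
  proof -
    have p: "continuous_on \<Omega> (\<lambda>z. h (\<phi> z))" if "continuous_on UNIV h" for h :: "real \<Rightarrow> real"
      by (rule continuous_on_compose2[OF that \<phi>D(2)]) simp
    have "continuous_on \<Omega> (\<lambda>x. ?w x * trunc'' \<epsilon> (\<phi> x) * (pd b \<phi> x)\<^sup>2
      + ?w x * trunc' \<epsilon> (\<phi> x) * pd b (pd b \<phi>) x - trunc \<epsilon> (\<phi> x) * pd b (pd b ?w) x)"
      by (intro continuous_intros w b \<phi>D p trunc_cont \<epsilon>)
    then show ?thesis by (simp add: pdV X b cong: continuous_on_cong)
  qed
  show "(\<Sum>b\<in>Basis. pd b (\<lambda>y. V y \<bullet> b) x)
      = K (u x t) * trunc'' \<epsilon> (\<phi> x) * (\<Sum>b\<in>Basis. (pd b \<phi> x)\<^sup>2) - \<mu> * K (u x t) * (trunc' \<epsilon> (\<phi> x) * \<phi> x)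
        - trunc \<epsilon> (\<phi> x) * laplacian ?w x" if x: "x \<in> \<Omega>" for x
  proof -
    have "(\<Sum>b\<in>Basis. pd b (\<lambda>y. V y \<bullet> b) x) = K (u x t) * trunc'' \<epsilon> (\<phi> x) * (\<Sum>b\<in>Basis. (pd b \<phi> x)\<^sup>2)
        + ?w x * trunc' \<epsilon> (\<phi> x) * laplacian \<phi> x - trunc \<epsilon> (\<phi> x) * laplacian ?w x"
      by (simp add: pdV X x sum.distrib sum_subtractf laplacian_def sum_distrib_left)
    then show ?thesis by (simp add: \<phi>lap[OF x] algebra_simps)
  qed
qed

section \<open>Lower bounds for the increments of the mass\<close>

definition mass :: "real \<Rightarrow> real" where
  "mass t = (\<integral>x. u x t * \<phi> x \<partial>M)"

text \<open>What Green's identity would give as the time derivative of \<open>mass\<close>. It is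
  compared with increments of \<open>mass\<close> only.\<close>

definition rate :: "real \<Rightarrow> real" where
  "rate t = (\<integral>x. (lam * f (u x t) - \<mu> * K (u x t)) * \<phi> x \<partial>M)"

text \<open>\<open>A\<close> is the mass with the weight \<open>\<phi>\<close> replaced by its
  truncation times a cutoff. Its support is compact in \<open>\<Omega>\<close>, so the time
  derivative passes under the integral and the equation may be inserted. The constant
  \<open>L\<close> precedes \<open>e\<close>, so one interval of time admits arbitrarily good
  approximations.\<close>

lemma mass_approx:
  assumes ab: "a \<in> I" "b \<in> I" "a < b"
  obtains L where "\<And>e. 0 < e \<Longrightarrow> \<exists>A A'. \<forall>t\<in>{a<..<b}. (A has_real_derivative A' t) (at t) \<and>
      \<bar>A t - mass t\<bar> \<le> L * e \<and> rate t - L * e \<le> A' t"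
proof -
  let ?J = "{a..b}"
  have J: "?J \<subseteq> I" using I_interval[OF ab(1,2)] .
  have cJ: "compact (closure \<Omega> \<times> ?J)" by (intro compact_Times compact_cl) simp
  have uc: "continuous_on (closure \<Omega> \<times> ?J) (\<lambda>z. u (fst z) (snd z))"
    using continuous_on_subset[OF u_cont, of "closure \<Omega> \<times> ?J"] J by (auto simp: case_prod_unfold)
  obtain B1 where B1: "0 \<le> B1" "\<And>z. z \<in> closure \<Omega> \<times> ?J \<Longrightarrow> \<bar>u (fst z) (snd z)\<bar> \<le> B1"
    by (rule compact_abs_bound[OF cJ uc]) blast
  have Kc: "continuous_on (closure \<Omega> \<times> ?J) (\<lambda>z. K (u (fst z) (snd z)))"
    by (rule continuous_on_compose2[OF K_cont(1) uc subset_UNIV])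
  obtain B2 where B2: "0 \<le> B2" "\<And>z. z \<in> closure \<Omega> \<times> ?J \<Longrightarrow> \<bar>K (u (fst z) (snd z))\<bar> \<le> B2"
    by (rule compact_abs_bound[OF cJ Kc]) blast
  have fc: "continuous_on (closure \<Omega> \<times> ?J) (\<lambda>z. f (u (fst z) (snd z)))"
    by (rule continuous_on_compose2[OF f_cont uc subset_UNIV])
  obtain B3 where B3: "0 \<le> B3" "\<And>z. z \<in> closure \<Omega> \<times> ?J \<Longrightarrow> \<bar>f (u (fst z) (snd z))\<bar> \<le> B3"
    by (rule compact_abs_bound[OF cJ fc]) blast
  obtain B4 where B4: "0 \<le> B4" "\<And>x. x \<in> closure \<Omega> \<Longrightarrow> \<bar>\<phi> x\<bar> \<le> B4"
    by (rule compact_abs_bound[OF compact_cl \<phi>cont]) blast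
  have b1: "\<bar>u x t\<bar> \<le> B1" and b2: "\<bar>K (u x t)\<bar> \<le> B2" and b3: "\<bar>f (u x t)\<bar> \<le> B3"
    if "x \<in> \<Omega>" "t \<in> ?J" for x t
    using B1(2)[of "(x, t)"] B2(2)[of "(x, t)"] B3(2)[of "(x, t)"] that \<Omega>_closure by auto
  have b4: "\<bar>\<phi> x\<bar> \<le> B4" if "x \<in> \<Omega>" for x using B4 \<Omega>_closure that by blast
  \<comment> \<open>\<open>D * e\<close> will bound the mean distance of the modified weights from
    \<open>\<phi>\<close>: the cutoff costs at most \<open>e * B4\<close>, the truncation
    \<open>3 * e\<close> times the volume.\<close>
  define D where "D = B4 + 3 * measure M \<Omega>"
  have D: "0 \<le> D" using B4 by (simp add: D_def)
  define C where "C = B1 + lam * B3 + \<bar>\<mu>\<bar> * B2"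
  have C: "0 \<le> C" "B1 \<le> C" "lam * B3 + \<bar>\<mu>\<bar> * B2 \<le> C" using B1 B2 B3 lam by (auto simp: C_def)
  have uc': "continuous_on \<Omega> (\<lambda>x. u x t)" if "t \<in> ?J" for t
    using continuous_on_subset[OF u_slice closure_subset] that J by blast
  have \<phi>c: "continuous_on \<Omega> \<phi>" by (rule \<phi>D(2))
  show ?thesis
  \<comment> \<open>The product accounts for the change of weights, the extra 1 for the error
    \<open>e\<close> in the divergence inequality.\<close>
  proof (rule that[of "C * D + 1"])
    fix e :: real assume e: "0 < e"
    obtain V where V: "continuous_on (closure \<Omega> \<times> ?J) V"
      "\<And>x t. x \<in> \<Omega> \<Longrightarrow> t \<in> ?J \<Longrightarrow> V (x, t) = W e (x, t)"
      "\<And>x t. x \<in> frontier \<Omega> \<Longrightarrow> t \<in> ?J \<Longrightarrow> V (x, t) \<bullet> outer_normal \<Omega> x \<le> 0"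
      by (rule W_extension[OF e J]) blast
    have div: "\<And>t x b. t \<in> ?J \<Longrightarrow> x \<in> \<Omega> \<Longrightarrow> b \<in> Basis \<Longrightarrow> (\<lambda>y. V (y, t) \<bullet> b) differentiable at x"
      "\<And>t b. t \<in> ?J \<Longrightarrow> b \<in> Basis \<Longrightarrow> continuous_on \<Omega> (pd b (\<lambda>y. V (y, t) \<bullet> b))"
      "\<And>t x. t \<in> ?J \<Longrightarrow> x \<in> \<Omega> \<Longrightarrow> (\<Sum>b\<in>Basis. pd b (\<lambda>y. V (y, t) \<bullet> b) x)
        = K (u x t) * trunc'' e (\<phi> x) * (\<Sum>b\<in>Basis. (pd b \<phi> x)\<^sup>2) - \<mu> * K (u x t) * (trunc' e (\<phi> x) * \<phi> x)
          - trunc e (\<phi> x) * laplacian (\<lambda>y. K (u y t)) x"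
      using W_divergence[OF e _ V(2)] J by blast+
    obtain \<kappa> S where S: "compact S" "S \<subseteq> \<Omega>" and \<kappa>: "continuous_on \<Omega> \<kappa>" "\<And>x. x \<in> \<Omega> \<Longrightarrow> 0 \<le> \<kappa> x \<and> \<kappa> x \<le> 1"
      "\<And>x. x \<in> \<Omega> - S \<Longrightarrow> \<kappa> x = 0" "(\<integral>x. 1 - \<kappa> x \<partial>M) \<le> e"
      "\<And>t. t \<in> ?J \<Longrightarrow> (\<integral>x. \<kappa> x * (\<Sum>b\<in>Basis. pd b (\<lambda>y. V (y, t) \<bullet> b) x) \<partial>M) \<le> e"
      by (rule divergence_cutoff[OF open\<Omega> bdd bdry1 compact_Icc V(1) div(1,2) V(3) e])
         (assumption | rule that)+
    define \<eta> where "\<eta> x = trunc e (\<phi> x)" for x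
    define \<theta> where "\<theta> x = trunc' e (\<phi> x) * \<phi> x" for x
    have \<eta>\<theta>: "0 \<le> \<eta> x" "\<eta> x \<le> \<phi> x" "\<phi> x - 3 * e \<le> \<eta> x" "\<eta> x \<le> \<theta> x" "\<theta> x \<le> \<phi> x" if "x \<in> \<Omega>" for x
      using trunc_bounds[OF e less_imp_le[OF \<phi>_pos[OF that]]] by (auto simp: \<eta>_def \<theta>_def)
    have comp: "continuous_on \<Omega> (\<lambda>z. h (\<phi> z))" if "continuous_on UNIV h" for h :: "real \<Rightarrow> real"
      by (rule continuous_on_compose2[OF that \<phi>c]) simp
    have \<eta>c: "continuous_on \<Omega> \<eta>" unfolding \<eta>_def by (intro comp trunc_cont e)
    have \<theta>c: "continuous_on \<Omega> \<theta>" unfolding \<theta>_def by (intro continuous_intros comp trunc_cont e \<phi>c)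
    note isupp = integrable_vol_compact_support[OF open\<Omega> bdd S]
    have Kc': "continuous_on \<Omega> (\<lambda>x. K (u x t))" and fc': "continuous_on \<Omega> (\<lambda>x. f (u x t))" if "t \<in> ?J" for t
      by (rule continuous_on_compose2[OF K_cont(1) uc'[OF that] subset_UNIV]
          continuous_on_compose2[OF f_cont uc'[OF that] subset_UNIV])+
    have err: "\<bar>\<kappa> x * \<eta> x - \<phi> x\<bar> \<le> (1 - \<kappa> x) * B4 + 3 * e" "\<bar>\<kappa> x * \<theta> x - \<phi> x\<bar> \<le> (1 - \<kappa> x) * B4 + 3 * e"
      if x: "x \<in> \<Omega>" for x
    proof -
      \<comment> \<open>Stated for any \<open>q\<close> between \<open>\<phi> x - 3 * e\<close> and
        \<open>\<phi> x\<close>, because two weights are compared with \<open>\<phi>\<close>: the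
        truncation itself goes with \<open>f\<close>, and its derivative times \<open>\<phi>\<close>
        goes with \<open>K\<close>.\<close>
      have k: "\<bar>\<kappa> x * q - \<phi> x\<bar> \<le> (1 - \<kappa> x) * B4 + 3 * e" if "\<phi> x - 3 * e \<le> q" "q \<le> \<phi> x" for q
      proof -
        have "\<bar>\<kappa> x * q - \<phi> x\<bar> = (1 - \<kappa> x) * \<phi> x + \<kappa> x * (\<phi> x - q)"
        proof -
          have "0 \<le> (1 - \<kappa> x) * \<phi> x + \<kappa> x * (\<phi> x - q)"
            using \<kappa>(2)[OF x] \<phi>_pos[OF x] that by (intro add_nonneg_nonneg mult_nonneg_nonneg) auto
          moreover have "\<kappa> x * q - \<phi> x = - ((1 - \<kappa> x) * \<phi> x + \<kappa> x * (\<phi> x - q))" by (simp add: algebra_simps)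
          ultimately show ?thesis by simp
        qed
        also have "(1 - \<kappa> x) * \<phi> x \<le> (1 - \<kappa> x) * B4"
          using b4[OF x] \<kappa>(2)[OF x] by (intro mult_left_mono) auto
        also have "\<kappa> x * (\<phi> x - q) \<le> 1 * (3 * e)"
          using \<kappa>(2)[OF x] that by (intro mult_mono) auto
        finally show ?thesis by simp
      qed
      show "\<bar>\<kappa> x * \<eta> x - \<phi> x\<bar> \<le> (1 - \<kappa> x) * B4 + 3 * e" "\<bar>\<kappa> x * \<theta> x - \<phi> x\<bar> \<le> (1 - \<kappa> x) * B4 + 3 * e"
        using \<eta>\<theta>[OF x] by (auto intro!: k)
    qed
    have i\<kappa>: "integrable M (\<lambda>x. 1 - \<kappa> x)"
      by (rule integrable_vol[OF open\<Omega> bdd measurable_vol, of _ 1]) (use \<kappa> in \<open>auto intro!: continuous_intros\<close>)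
    have ierr: "integrable M (\<lambda>x. (1 - \<kappa> x) * B4 + 3 * e)"
      using i\<kappa> by simp
    have Ierr: "(\<integral>x. (1 - \<kappa> x) * B4 + 3 * e \<partial>M) \<le> D * e"
    proof -
      have "(\<integral>x. (1 - \<kappa> x) * B4 + 3 * e \<partial>M) = (\<integral>x. 1 - \<kappa> x \<partial>M) * B4 + measure M \<Omega> * (3 * e)"
        using i\<kappa> by simp
      also have "\<dots> \<le> e * B4 + measure M \<Omega> * (3 * e)" using \<kappa>(4) B4(1) by (simp add: mult_right_mono)
      finally show ?thesis by (simp add: D_def algebra_simps)
    qed
    define A where "A t = (\<integral>x. \<kappa> x * \<eta> x * u x t \<partial>M)" for t
    define A' where "A' t = (\<integral>x. \<kappa> x * \<eta> x * deriv (u x) t \<partial>M)" for t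
    show "\<exists>A A'. \<forall>t\<in>{a<..<b}. (A has_real_derivative A' t) (at t) \<and>
      \<bar>A t - mass t\<bar> \<le> (C * D + 1) * e \<and> rate t - (C * D + 1) * e \<le> A' t"
    proof (rule exI[of _ A], rule exI[of _ A'], intro ballI conjI)
      fix t assume t: "t \<in> {a<..<b}"
      then have tJ: "t \<in> ?J" and tI: "t \<in> I" using J by auto
      have utc: "continuous_on (\<Omega> \<times> I) (\<lambda>z. deriv (u (fst z)) (snd z))"
        using C21 by (simp add: C21_on_def case_prod_unfold)
      have dtc: "continuous_on \<Omega> (\<lambda>x. deriv (u x) s)" if "s \<in> ?J" for s
        using continuous_on_slice(1)[OF utc, of s] that J by auto
      \<comment> \<open>The time derivative of \<open>u\<close> need not be bounded near the
        boundary. The cutoff vanishes outside \<open>S\<close>, and on the compact product of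
        \<open>S\<close> with the time interval continuity gives a bound.\<close>
      have gc: "continuous_on (S \<times> ?J) (\<lambda>z. \<kappa> (fst z) * \<eta> (fst z) * deriv (u (fst z)) (snd z))"
        using S J by (intro continuous_intros continuous_on_compose2[OF \<kappa>(1)] continuous_on_compose2[OF \<eta>c]
            continuous_on_subset[OF utc]) auto
      obtain B where B: "0 \<le> B" "\<And>z. z \<in> S \<times> ?J \<Longrightarrow> \<bar>\<kappa> (fst z) * \<eta> (fst z) * deriv (u (fst z)) (snd z)\<bar> \<le> B"
        by (rule compact_abs_bound[OF compact_Times[OF S(1) compact_Icc] gc]) blast
      show "(A has_real_derivative A' t) (at t)"
        unfolding A_def A'_def
      proof (rule has_real_derivative_integral[where B=B and a=a and b=b and
            g="\<lambda>x s. \<kappa> x * \<eta> x * u x s" and g'="\<lambda>x s. \<kappa> x * \<eta> x * deriv (u x) s"])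
        show "finite_measure M" by (rule M.finite_measure_axioms)
        show "t \<in> {a<..<b}" by (rule t)
        show "integrable M (\<lambda>x. \<kappa> x * \<eta> x * u x s)" if "s \<in> {a<..<b}" for s
          using that by (intro isupp continuous_intros \<kappa>(1) \<eta>c uc') (auto simp: \<kappa>(3))
        show "(\<lambda>x. \<kappa> x * \<eta> x * deriv (u x) t) \<in> borel_measurable M"
          by (intro measurable_vol continuous_intros \<kappa>(1) \<eta>c dtc tJ)
        show "((\<lambda>s. \<kappa> x * \<eta> x * u x s) has_real_derivative \<kappa> x * \<eta> x * deriv (u x) s) (at s)"
          if "x \<in> space M" "s \<in> {a<..<b}" for x s
          by (rule DERIV_cmult[OF u_deriv]) (use that J in auto)
        show "\<bar>\<kappa> x * \<eta> x * deriv (u x) s\<bar> \<le> B" if "x \<in> space M" "s \<in> {a<..<b}" for x s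
          using B(1) B(2)[of "(x, s)"] \<kappa>(3)[of x] that by (cases "x \<in> S") auto
      qed
      have iu: "integrable M (\<lambda>x. u x t * \<phi> x)"
        by (rule integrable_vol[OF open\<Omega> bdd measurable_vol, of _ "B1 * B4"])
           (use b1 b4 tJ in \<open>auto intro!: continuous_intros uc' \<phi>c mult_mono simp: abs_mult B1(1)\<close>)
      have iku: "integrable M (\<lambda>x. \<kappa> x * \<eta> x * u x t)"
        by (intro isupp continuous_intros \<kappa>(1) \<eta>c uc' tJ) (auto simp: \<kappa>(3))
      have "\<bar>A t - mass t\<bar> = \<bar>\<integral>x. \<kappa> x * \<eta> x * u x t - u x t * \<phi> x \<partial>M\<bar>"
        using iu iku by (simp add: A_def mass_def)
      also have "\<dots> \<le> (\<integral>x. \<bar>\<kappa> x * \<eta> x * u x t - u x t * \<phi> x\<bar> \<partial>M)"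
        by (rule integral_abs_bound)
      also have "\<dots> \<le> (\<integral>x. C * ((1 - \<kappa> x) * B4 + 3 * e) \<partial>M)"
      proof (rule integral_mono)
        show "integrable M (\<lambda>x. \<bar>\<kappa> x * \<eta> x * u x t - u x t * \<phi> x\<bar>)"
          using iu iku by (intro integrable_abs Bochner_Integration.integrable_diff)
        show "integrable M (\<lambda>x. C * ((1 - \<kappa> x) * B4 + 3 * e))"
          by (intro integrable_mult_right ierr)
        fix x assume "x \<in> space M"
        then have x: "x \<in> \<Omega>" by simp
        have "\<bar>\<kappa> x * \<eta> x * u x t - u x t * \<phi> x\<bar> = \<bar>u x t\<bar> * \<bar>\<kappa> x * \<eta> x - \<phi> x\<bar>"
          by (simp add: abs_mult[symmetric] algebra_simps)
        also have "\<dots> \<le> C * ((1 - \<kappa> x) * B4 + 3 * e)"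
          using b1[OF x tJ] C err(1)[OF x] by (intro mult_mono) auto
        finally show "\<bar>\<kappa> x * \<eta> x * u x t - u x t * \<phi> x\<bar> \<le> C * ((1 - \<kappa> x) * B4 + 3 * e)" .
      qed
      also have "\<dots> = C * (\<integral>x. (1 - \<kappa> x) * B4 + 3 * e \<partial>M)" by simp
      also have "\<dots> \<le> C * (D * e)" using Ierr C(1) by (rule mult_left_mono)
      also have "\<dots> \<le> (C * D + 1) * e" using e by (simp add: algebra_simps)
      finally show "\<bar>A t - mass t\<bar> \<le> (C * D + 1) * e" .

      let ?div = "\<lambda>x. \<Sum>b\<in>Basis. pd b (\<lambda>y. V (y, t) \<bullet> b) x"
      let ?R = "\<lambda>x. \<kappa> x * (lam * f (u x t) * \<eta> x - \<mu> * K (u x t) * \<theta> x)"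
      have ct: "continuous_on \<Omega> (?div)" using div(2)[OF tJ] by (intro continuous_on_sum) auto
      have iR: "integrable M ?R"
        by (intro isupp continuous_intros \<kappa>(1) \<eta>c \<theta>c Kc' fc' tJ) (auto simp: \<kappa>(3))
      have idv: "integrable M (\<lambda>x. \<kappa> x * ?div x)"
        by (intro isupp continuous_on_mult \<kappa>(1) ct) (auto simp: \<kappa>(3))
      have idt: "integrable M (\<lambda>x. \<kappa> x * \<eta> x * deriv (u x) t)"
        by (intro isupp continuous_intros \<kappa>(1) \<eta>c dtc tJ) (auto simp: \<kappa>(3))
      have "(\<integral>x. ?R x \<partial>M) - e \<le> (\<integral>x. ?R x - \<kappa> x * ?div x \<partial>M)"
        using \<kappa>(5)[OF tJ] iR idv by simp
      also have "\<dots> \<le> A' t"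
        unfolding A'_def
      proof (rule integral_mono[OF Bochner_Integration.integrable_diff[OF iR idv] idt])
        fix x assume "x \<in> space M"
        then have x: "x \<in> \<Omega>" by simp
        \<comment> \<open>The difference is exactly the convexity term of the truncation. Dropping
          it costs the equality but keeps the direction of the inequality.\<close>
        have "\<kappa> x * \<eta> x * deriv (u x) t - (?R x - \<kappa> x * ?div x)
            = \<kappa> x * (K (u x t) * trunc'' e (\<phi> x) * (\<Sum>b\<in>Basis. (pd b \<phi> x)\<^sup>2))"
          unfolding div(3)[OF tJ x] pde[OF x tI] \<eta>_def[symmetric] \<theta>_def[symmetric] by (simp add: algebra_simps)
        moreover have "0 \<le> \<dots>"
          using \<kappa>(2)[OF x] K_nonneg[OF less_imp_le[OF u_pos[OF x tI]]] trunc_bounds(4)[OF e less_imp_le[OF \<phi>_pos[OF x]]]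
          by (intro mult_nonneg_nonneg sum_nonneg) auto
        ultimately show "?R x - \<kappa> x * ?div x \<le> \<kappa> x * \<eta> x * deriv (u x) t" by linarith
      qed
      finally have 1: "(\<integral>x. ?R x \<partial>M) - e \<le> A' t" .
      let ?H = "\<lambda>x. (lam * f (u x t) - \<mu> * K (u x t)) * \<phi> x"
      have "\<bar>lam * f (u x t) - \<mu> * K (u x t)\<bar> \<le> C" if "x \<in> \<Omega>" for x
      proof -
        have "\<bar>lam * f (u x t) - \<mu> * K (u x t)\<bar> \<le> lam * \<bar>f (u x t)\<bar> + \<bar>\<mu>\<bar> * \<bar>K (u x t)\<bar>"
          using lam abs_triangle_ineq4[of "lam * f (u x t)" "\<mu> * K (u x t)"] by (simp add: abs_mult)
        also have "\<dots> \<le> lam * B3 + \<bar>\<mu>\<bar> * B2"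
          using b2[OF that tJ] b3[OF that tJ] lam by (intro add_mono mult_left_mono) auto
        finally show ?thesis using C by linarith
      qed
      then have iH: "integrable M ?H"
        by (intro integrable_vol[OF open\<Omega> bdd measurable_vol, of _ "C * B4"])
           (use b4 C in \<open>auto intro!: continuous_intros Kc' fc' tJ \<phi>c mult_mono simp: abs_mult\<close>)
      have "rate t - (\<integral>x. ?R x \<partial>M) = (\<integral>x. ?H x - ?R x \<partial>M)"
        using iH iR by (simp add: rate_def)
      also have "\<dots> \<le> (\<integral>x. C * ((1 - \<kappa> x) * B4 + 3 * e) \<partial>M)"
      proof (rule integral_mono)
        show "integrable M (\<lambda>x. ?H x - ?R x)" by (rule Bochner_Integration.integrable_diff[OF iH iR])
        show "integrable M (\<lambda>x. C * ((1 - \<kappa> x) * B4 + 3 * e))"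
          by (intro integrable_mult_right ierr)
        fix x assume "x \<in> space M"
        then have x: "x \<in> \<Omega>" by simp
        define r where "r = (1 - \<kappa> x) * B4 + 3 * e"
        have r: "0 \<le> r" using err(1)[OF x] by (simp add: r_def)
        \<comment> \<open>The two nonlinear terms come with different weights, so the error is split
          into two parts before taking absolute values.\<close>
        have "?H x - ?R x = (- (lam * f (u x t))) * (\<kappa> x * \<eta> x - \<phi> x) + (\<mu> * K (u x t)) * (\<kappa> x * \<theta> x - \<phi> x)"
          by (simp add: algebra_simps)
        also have "\<dots> \<le> \<bar>(- (lam * f (u x t))) * (\<kappa> x * \<eta> x - \<phi> x)\<bar> + \<bar>(\<mu> * K (u x t)) * (\<kappa> x * \<theta> x - \<phi> x)\<bar>"
          by (intro add_mono abs_ge_self)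
        also have "\<dots> \<le> (lam * B3) * r + (\<bar>\<mu>\<bar> * B2) * r"
          unfolding abs_mult r_def
          using b2[OF x tJ] b3[OF x tJ] lam err[OF x] B2 B3
          by (intro add_mono mult_mono) (auto simp: abs_mult)
        also have "\<dots> \<le> C * r" using C(3) r by (simp add: distrib_right[symmetric] mult_right_mono)
        finally show "?H x - ?R x \<le> C * ((1 - \<kappa> x) * B4 + 3 * e)" by (simp add: r_def)
      qed
      also have "\<dots> = C * (\<integral>x. (1 - \<kappa> x) * B4 + 3 * e \<partial>M)" by simp
      also have "\<dots> \<le> C * (D * e)" using Ierr C(1) by (rule mult_left_mono)
      finally have "rate t - (\<integral>x. ?R x \<partial>M) \<le> C * (D * e)" .
      with 1 show "rate t - (C * D + 1) * e \<le> A' t" by (simp add: algebra_simps)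
    qed
  qed
qed

text \<open>The mean value theorem is applied to the approximations of \<open>mass\<close>, and
  their error is sent to 0. A constant lower bound \<open>m\<close> replaces the time integral of
  \<open>rate\<close>, so no regularity of \<open>rate\<close> in time enters.\<close>

lemma mass_increment:
  assumes s: "s \<in> I" and t: "t \<in> I" and st: "s \<le> t" and m: "\<And>r. r \<in> {s..t} \<Longrightarrow> m \<le> rate r"
  shows "m * (t - s) \<le> mass t - mass s"
proof -
  \<comment> \<open>The interval is enlarged on both sides, because the approximations are
    differentiable on open intervals only and are evaluated at \<open>s\<close> and
    \<open>t\<close>.\<close>
  obtain d1 where d1: "d1 > 0" "ball s d1 \<subseteq> I" using open_I s open_contains_ball by blast
  obtain d2 where d2: "d2 > 0" "ball t d2 \<subseteq> I" using open_I t open_contains_ball by blast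
  define a b where "a = s - d1 / 2" and "b = t + d2 / 2"
  have "a \<in> ball s d1" "b \<in> ball t d2" using d1(1) d2(1) by (auto simp: a_def b_def dist_real_def)
  then have ab: "a \<in> I" "b \<in> I" "a < b" "a < s" "t < b" using d1 d2 st by (auto simp: a_def b_def)
  obtain L where L: "\<And>e. 0 < e \<Longrightarrow> \<exists>A A'. \<forall>t\<in>{a<..<b}. (A has_real_derivative A' t) (at t) \<and>
      \<bar>A t - mass t\<bar> \<le> L * e \<and> rate t - L * e \<le> A' t"
    by (rule mass_approx[OF ab(1-3)]) blast
  \<comment> \<open>The error is \<open>L * e\<close> at each of the two ends and
    \<open>L * e\<close> times the length in the slope. The absolute value is taken as
    \<open>L\<close> has no known sign, and adding 1 makes \<open>N\<close> positive.\<close>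
  define N where "N = \<bar>L\<bar> * (t - s + 2) + 1"
  have N: "N > 0" using st by (simp add: N_def add_nonneg_pos)
  show ?thesis
  proof (rule field_le_epsilon)
    fix d :: real assume d: "0 < d"
    define e where "e = d / N"
    have e: "e > 0" "N * e = d" using d N by (auto simp: e_def)
    from L[OF e(1)] obtain A A' where A: "\<And>r. r \<in> {a<..<b} \<Longrightarrow> (A has_real_derivative A' r) (at r)"
      "\<And>r. r \<in> {a<..<b} \<Longrightarrow> \<bar>A r - mass r\<bar> \<le> L * e" "\<And>r. r \<in> {a<..<b} \<Longrightarrow> rate r - L * e \<le> A' r" by blast
    have ms: "(m - L * e) * (t - s) \<le> A t - A s"
    proof (cases "s = t")
      case False
      then have "s < t" using st by simp
      then obtain z where z: "s < z" "z < t" "A t - A s = (t - s) * A' z"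
        using MVT2[of s t A A'] A(1) ab by force
      have "m - L * e \<le> A' z" using m[of z] A(3)[of z] z ab by force
      then have "(t - s) * (m - L * e) \<le> (t - s) * A' z" using st by (intro mult_left_mono) auto
      then show ?thesis unfolding z(3) by (simp add: mult.commute)
    qed simp
    have "\<bar>A t - mass t\<bar> \<le> L * e" "\<bar>A s - mass s\<bar> \<le> L * e" using A(2) ab st by auto
    then have "(m - L * e) * (t - s) \<le> mass t - mass s + 2 * (L * e)" using ms by linarith
    then have "m * (t - s) \<le> mass t - mass s + (L * (t - s + 2)) * e" by (simp add: algebra_simps)
    also have "(L * (t - s + 2)) * e \<le> N * e"
    proof (rule mult_right_mono)
      have "L * (t - s + 2) \<le> \<bar>L\<bar> * (t - s + 2)" using st by (intro mult_right_mono) auto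
      then show "L * (t - s + 2) \<le> N" by (simp add: N_def)
    qed (use e in simp)
    finally show "m * (t - s) \<le> mass t - mass s + d" using e by simp
  qed
qed

text \<open>The bounds for positive times pass to time 0 along the right-hand limit of
  \<open>u x\<close>.\<close>

lemma u_bdd0:
  assumes "s \<in> I"
  obtains C where "0 \<le> C" "\<And>x t. x \<in> \<Omega> \<Longrightarrow> t \<in> {0..s} \<Longrightarrow> 0 \<le> u x t \<and> u x t \<le> C"
proof -
  obtain C where C: "\<And>x t. x \<in> \<Omega> \<Longrightarrow> t \<in> {0<..s} \<Longrightarrow> \<bar>u x t\<bar> \<le> C" using u_bdd[OF assms] by blast
  have sI: "{0<..s} \<subseteq> I"
    using assms le_less_trans[of _ "ereal s" T] by (auto simp: existence_times_def)
  have s0: "0 < s" using assms by (simp add: existence_times_def)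
  have "0 \<le> u x t \<and> u x t \<le> \<bar>C\<bar>" if x: "x \<in> \<Omega>" and t: "t \<in> {0..s}" for x t
  proof (cases "t = 0")
    case False
    then have "t \<in> {0<..s}" using t by auto
    with C[OF x this] u_pos[OF x] sI show ?thesis by fastforce
  next
    case True
    have "{0..s} \<subseteq> insert 0 I" using sI by (auto simp: less_eq_real_def)
    then have "continuous_on {0..s} (u x)"
      using continuous_on_subset continuous_on_slice(2)[OF u_cont0 x] by force
    then have "(u x \<longlongrightarrow> u x 0) (at 0 within {0..s})" using s0 by (auto simp: continuous_on_def)
    then have lim: "(u x \<longlongrightarrow> u x 0) (at_right 0)"
      using s0 by (simp add: at_within_Icc_at_right)
    have "\<forall>\<^sub>F t in at_right 0. t \<in> {0<..s}"
      using s0 by (auto simp: eventually_at_right intro!: exI[of _ s])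
    then have "\<forall>\<^sub>F t in at_right 0. 0 \<le> u x t" "\<forall>\<^sub>F t in at_right 0. u x t \<le> \<bar>C\<bar>"
      by (eventually_elim; use C[OF x] u_pos[OF x] sI in fastforce)+
    then show ?thesis using tendsto_lowerbound[OF lim] tendsto_upperbound[OF lim] True by simp
  qed
  then show ?thesis using that[of "\<bar>C\<bar>"] by auto
qed

lemma I_shrink: "t \<in> insert 0 I \<Longrightarrow> \<exists>s\<in>I. t < s"
proof -
  assume "t \<in> insert 0 I"
  then have "0 \<le> t" "ereal t < T" using sol by (auto simp: existence_times_def classical_solution_def zero_ereal_def)
  then obtain s where "ereal t < ereal s" "ereal s < T" using ereal_dense2 by metis
  with \<open>0 \<le> t\<close> show ?thesis by (intro bexI[of _ s]) (auto simp: existence_times_def)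
qed

text \<open>Dominated convergence, with the bound near time 0 that belongs to the notion of
  solution. Continuity at 0 is what makes large initial data visible at positive times, where the
  increment estimate holds.\<close>

lemma mass_continuous: "continuous_on (insert 0 I) mass"
proof (subst continuous_on_sequentially, intro allI ballI impI)
  fix X t assume t: "t \<in> insert 0 I" and X: "(\<forall>n. X n \<in> insert 0 I) \<and> X \<longlonglongrightarrow> t"
  obtain s where s: "s \<in> I" "t < s" using I_shrink[OF t] by blast
  obtain C where C: "0 \<le> C" "\<And>x t. x \<in> \<Omega> \<Longrightarrow> t \<in> {0..s} \<Longrightarrow> 0 \<le> u x t \<and> u x t \<le> C" by (rule u_bdd0[OF s(1)]) blast
  obtain B4 where B4: "0 \<le> B4" "\<And>x. x \<in> closure \<Omega> \<Longrightarrow> \<bar>\<phi> x\<bar> \<le> B4"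
    by (rule compact_abs_bound[OF compact_cl \<phi>cont]) blast
  have "\<forall>\<^sub>F n in sequentially. X n < s" using X s(2) order_tendstoD(2) by blast
  then obtain n0 where n0: "\<And>n. n \<ge> n0 \<Longrightarrow> X n < s" by (auto simp: eventually_sequentially)
  have X0: "0 \<le> X n" for n using X by (auto simp: existence_times_def) (metis less_eq_real_def)
  have c: "continuous_on \<Omega> (\<lambda>x. u x r)" if "r \<in> insert 0 I" for r
    using continuous_on_slice(1)[OF u_cont0 that] by simp
  have "(\<lambda>n. mass (X (n + n0))) \<longlonglongrightarrow> mass t"
    unfolding mass_def
  proof (rule integral_dominated_convergence[where w="\<lambda>x. C * B4"])
    show "(\<lambda>x. u x t * \<phi> x) \<in> borel_measurable M"
      by (intro measurable_vol continuous_intros c t \<phi>D(2))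
    show "(\<lambda>x. u x (X (n + n0)) * \<phi> x) \<in> borel_measurable M" for n
      by (intro measurable_vol continuous_intros c \<phi>D(2)) (use X in auto)
    show "AE x in M. (\<lambda>n. u x (X (n + n0)) * \<phi> x) \<longlonglongrightarrow> u x t * \<phi> x"
    proof (rule AE_I2)
      fix x assume "x \<in> space M"
      then have x: "x \<in> \<Omega>" by simp
      have "continuous_on (insert 0 I) (u x)"
        using continuous_on_slice(2)[OF u_cont0 x] by simp
      then have "(\<lambda>n. u x (X n)) \<longlonglongrightarrow> u x t"
        using X t unfolding continuous_on_sequentially by (auto simp: o_def)
      then show "(\<lambda>n. u x (X (n + n0)) * \<phi> x) \<longlonglongrightarrow> u x t * \<phi> x"
        by (intro tendsto_intros LIMSEQ_ignore_initial_segment)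
    qed
    show "AE x in M. norm (u x (X (n + n0)) * \<phi> x) \<le> C * B4" for n
    proof (rule AE_I2)
      fix x assume "x \<in> space M"
      then have x: "x \<in> \<Omega>" by simp
      have "X (n + n0) \<in> {0..s}" using X0 n0[of "n + n0"] by (simp add: less_imp_le)
      then show "norm (u x (X (n + n0)) * \<phi> x) \<le> C * B4"
        using C(2)[OF x] C(1) B4(2)[OF \<Omega>_closure[OF x]] by (simp add: abs_mult mult_mono)
    qed
  qed simp
  then show "(mass \<circ> X) \<longlonglongrightarrow> mass t"
    using LIMSEQ_offset[of "\<lambda>n. mass (X n)" n0] by (simp add: o_def)
qed

lemma mass_0: "mass 0 = (\<integral>x. u0 x * \<phi> x \<partial>M)"
  unfolding mass_def by (rule Bochner_Integration.integral_cong) (auto simp: u_init)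

end

section \<open>Continuation of bounded solutions\<close>

text \<open>A limit at time \<open>t\<close> sees only times near \<open>t\<close>; this is what
  allows solutions on overlapping time intervals to be glued.\<close>

lemma at_within_Times_open:
  assumes "open O'" "t \<in> O'"
  shows "at (x, t) within S \<times> I = at (x, t) within S \<times> (I \<inter> O')"
  by (rule at_within_nhd[of _ "UNIV \<times> O'"]) (use assms in \<open>auto intro: open_Times\<close>)

lemma continuous_on_Times_local:
  assumes "\<And>t. t \<in> I \<Longrightarrow> \<exists>O'. open O' \<and> t \<in> O' \<and> continuous_on (S \<times> (I \<inter> O')) h"
  shows "continuous_on (S \<times> I) h"
  unfolding continuous_on_def
proof
  fix z assume z: "z \<in> S \<times> I"
  obtain x t where [simp]: "z = (x, t)" by (cases z)
  obtain O' where O': "open O'" "t \<in> O'" "continuous_on (S \<times> (I \<inter> O')) h" using assms[of t] z by auto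
  then have "(h \<longlongrightarrow> h (x, t)) (at (x, t) within S \<times> (I \<inter> O'))"
    using z by (auto simp: continuous_on_def)
  then show "(h \<longlongrightarrow> h z) (at z within S \<times> I)"
    using at_within_Times_open[OF O'(1,2), of x S I] by simp
qed

lemma continuous_on_Times_Un:
  assumes "open I1" "open I2" "continuous_on (S \<times> I1) h" "continuous_on (S \<times> I2) h"
  shows "continuous_on (S \<times> (I1 \<union> I2)) h"
proof (rule continuous_on_Times_local)
  fix t assume "t \<in> I1 \<union> I2"
  then show "\<exists>O'. open O' \<and> t \<in> O' \<and> continuous_on (S \<times> ((I1 \<union> I2) \<inter> O')) h"
    using assms by (metis Int_absorb1 UnE Un_upper1 Un_upper2 inf.commute)
qed

text \<open>The part of \<open>classical_solution\<close> that is local in time.\<close>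

definition time_local_solution ::
    "'a::euclidean_space set \<Rightarrow> ('a \<Rightarrow> ennreal) \<Rightarrow> real \<Rightarrow> (real \<Rightarrow> real) \<Rightarrow> (real \<Rightarrow> real) \<Rightarrow>
     real set \<Rightarrow> ('a \<Rightarrow> real \<Rightarrow> real) \<Rightarrow> bool" where
  "time_local_solution \<Omega> \<beta> lam f K I u \<longleftrightarrow>
     C21_on \<Omega> I u \<and>
     continuous_on (closure \<Omega> \<times> I) (\<lambda>(x, t). u x t) \<and>
     (\<forall>x\<in>frontier \<Omega>. \<beta> x \<noteq> \<infinity> \<longrightarrow> (\<forall>t\<in>I.
        \<exists>g. ((\<lambda>(y, s). grad (\<lambda>z. u z s) y) \<longlongrightarrow> g) (at (x, t) within \<Omega> \<times> I))) \<and>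
     (\<forall>x\<in>\<Omega>. \<forall>t\<in>I. deriv (u x) t = laplacian (\<lambda>y. K (u y t)) x + lam * f (u x t)) \<and>
     (\<forall>x\<in>frontier \<Omega>. \<forall>t\<in>I. boundary_condition \<Omega> \<beta> (\<lambda>y. K (u y t)) x)"

lemma classical_solution_alt:
  "classical_solution \<Omega> \<beta> lam f K u0 T u \<longleftrightarrow> 0 < T \<and> time_local_solution \<Omega> \<beta> lam f K (existence_times T) u \<and>
     continuous_on (\<Omega> \<times> insert 0 (existence_times T)) (\<lambda>(x, t). u x t) \<and> (\<forall>x\<in>\<Omega>. u x 0 = u0 x) \<and>
     (\<forall>s\<in>existence_times T. \<exists>C. \<forall>x\<in>\<Omega>. \<forall>t\<in>{0<..s}. \<bar>u x t\<bar> \<le> C)"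
  unfolding classical_solution_def time_local_solution_def by blast

lemma C21_on_cong:
  assumes "open \<Omega>" "open I" "\<And>x t. x \<in> \<Omega> \<Longrightarrow> t \<in> I \<Longrightarrow> u x t = v x t" "C21_on \<Omega> I u"
  shows "C21_on \<Omega> I v"
proof -
  have dv: "deriv (v x) t = deriv (u x) t" if "x \<in> \<Omega>" "t \<in> I" for x t
  proof (rule deriv_cong_ev)
    show "\<forall>\<^sub>F s in nhds t. v x s = u x s"
      by (rule eventually_mono[OF eventually_nhds_in_open[OF assms(2) that(2)]]) (simp add: assms(3) that)
  qed simp
  have pv: "pd b (\<lambda>y. v y t) x = pd b (\<lambda>y. u y t) x" if "x \<in> \<Omega>" "t \<in> I" for b x t
    by (rule pd_cong_open[OF assms(1) that(1)]) (simp add: assms(3) that)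
  have ppv: "pd c (pd b (\<lambda>y. v y t)) x = pd c (pd b (\<lambda>y. u y t)) x" if "x \<in> \<Omega>" "t \<in> I" for b c x t
    by (rule pd_cong_open[OF assms(1) that(1)]) (simp add: pv that)
  have cc: "continuous_on (\<Omega> \<times> I) (\<lambda>(x, t). h x t) \<Longrightarrow> (\<And>x t. x \<in> \<Omega> \<Longrightarrow> t \<in> I \<Longrightarrow> k x t = h x t)
      \<Longrightarrow> continuous_on (\<Omega> \<times> I) (\<lambda>(x, t). k x t)" for h k :: "'a \<Rightarrow> real \<Rightarrow> real"
    by (subst continuous_on_cong[OF refl, of _ _ "\<lambda>(x, t). h x t"]) auto
  have "v x differentiable_on I" if "x \<in> \<Omega>" for x
    using assms(4) differentiable_transform_open[OF _ assms(2), of "u x" _ "v x"] assms(3)[OF that] that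
    by (auto simp: C21_on_def differentiable_on_eq_differentiable_at[OF assms(2)])
  moreover have "Ck_on 2 \<Omega> (\<lambda>x. v x t)" if "t \<in> I" for t
    by (rule Ck_on_cong_open[OF assms(1), of "\<lambda>x. u x t"]) (use assms that in \<open>auto simp: C21_on_def\<close>)
  moreover have "continuous_on (\<Omega> \<times> I) (\<lambda>(x, t). v x t)"
    by (rule cc[of u]) (use assms in \<open>auto simp: C21_on_def\<close>)
  moreover have "continuous_on (\<Omega> \<times> I) (\<lambda>(x, t). deriv (v x) t)"
    by (rule cc[of "\<lambda>x. deriv (u x)"]) (use assms(4) dv in \<open>auto simp: C21_on_def\<close>)
  moreover have "continuous_on (\<Omega> \<times> I) (\<lambda>(x, t). pd b (\<lambda>y. v y t) x)" if "b \<in> Basis" for b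
    by (rule cc[of "\<lambda>x t. pd b (\<lambda>y. u y t) x"]) (use assms(4) pv that in \<open>auto simp: C21_on_def\<close>)
  moreover have "continuous_on (\<Omega> \<times> I) (\<lambda>(x, t). pd c (pd b (\<lambda>y. v y t)) x)" if "b \<in> Basis" "c \<in> Basis" for b c
    by (rule cc[of "\<lambda>x t. pd c (pd b (\<lambda>y. u y t)) x"]) (use assms(4) ppv that in \<open>auto simp: C21_on_def\<close>)
  ultimately show ?thesis unfolding C21_on_def by blast
qed

lemma boundary_condition_cong:
  assumes "open \<Omega>" "x \<in> frontier \<Omega>" "\<And>y. y \<in> closure \<Omega> \<Longrightarrow> v y = w y" "boundary_condition \<Omega> \<beta> w x"
  shows "boundary_condition \<Omega> \<beta> v x"
proof -
  have "v x = w x" using assms(2,3) by (simp add: frontier_def)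
  moreover have "(grad v \<longlongrightarrow> g) (at x within \<Omega>) \<longleftrightarrow> (grad w \<longlongrightarrow> g) (at x within \<Omega>)" for g
    by (rule Lim_cong_within) (use assms(3) closure_subset in \<open>auto intro!: grad_cong_open[OF assms(1)]\<close>)
  ultimately show ?thesis using assms(4) by (simp add: boundary_condition_def)
qed

lemma time_local_solution_cong:
  assumes "open \<Omega>" "open I" "\<And>x t. x \<in> closure \<Omega> \<Longrightarrow> t \<in> I \<Longrightarrow> v x t = u x t"
    and u: "time_local_solution \<Omega> \<beta> lam f K I u"
  shows "time_local_solution \<Omega> \<beta> lam f K I v"
proof -
  have in\<Omega>: "x \<in> \<Omega> \<Longrightarrow> t \<in> I \<Longrightarrow> v x t = u x t" for x t using assms(3) closure_subset by blast
  have "C21_on \<Omega> I v"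
    by (rule C21_on_cong[OF assms(1,2), of u]) (use in\<Omega> u in \<open>auto simp: time_local_solution_def\<close>)
  moreover have "continuous_on (closure \<Omega> \<times> I) (\<lambda>(x, t). v x t)"
    using u assms(3) by (subst continuous_on_cong[OF refl, of _ _ "\<lambda>(x, t). u x t"]) (auto simp: time_local_solution_def)
  moreover have "\<exists>g. ((\<lambda>(y, s). grad (\<lambda>z. v z s) y) \<longlongrightarrow> g) (at (x, t) within \<Omega> \<times> I)"
    if x: "x \<in> frontier \<Omega>" "\<beta> x \<noteq> \<infinity>" "t \<in> I" for x t
  proof -
    obtain g where "((\<lambda>(y, s). grad (\<lambda>z. u z s) y) \<longlongrightarrow> g) (at (x, t) within \<Omega> \<times> I)"
      using u x unfolding time_local_solution_def by blast
    moreover have "((\<lambda>(y, s). grad (\<lambda>z. v z s) y) \<longlongrightarrow> g) (at (x, t) within \<Omega> \<times> I)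
        \<longleftrightarrow> ((\<lambda>(y, s). grad (\<lambda>z. u z s) y) \<longlongrightarrow> g) (at (x, t) within \<Omega> \<times> I)"
      by (rule Lim_cong_within) (use in\<Omega> in \<open>auto intro!: grad_cong_open[OF assms(1)]\<close>)
    ultimately show ?thesis by blast
  qed
  moreover have "deriv (v x) t = laplacian (\<lambda>y. K (v y t)) x + lam * f (v x t)" if "x \<in> \<Omega>" "t \<in> I" for x t
  proof -
    have "deriv (v x) t = deriv (u x) t"
      by (rule deriv_cong_ev[OF eventually_mono[OF eventually_nhds_in_open[OF assms(2) that(2)]]])
         (simp_all add: in\<Omega> that)
    moreover have "laplacian (\<lambda>y. K (v y t)) x = laplacian (\<lambda>y. K (u y t)) x"
      by (rule laplacian_cong_open[OF assms(1) that(1)]) (simp add: in\<Omega> that)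
    ultimately show ?thesis using u that in\<Omega> by (simp add: time_local_solution_def)
  qed
  moreover have "boundary_condition \<Omega> \<beta> (\<lambda>y. K (v y t)) x" if "x \<in> frontier \<Omega>" "t \<in> I" for x t
    by (rule boundary_condition_cong[OF assms(1) that(1), of _ "\<lambda>y. K (u y t)"])
       (use that assms(3) u in \<open>auto simp: time_local_solution_def\<close>)
  ultimately show ?thesis unfolding time_local_solution_def by blast
qed

text \<open>Each condition at a time \<open>t\<close> concerns only times close to \<open>t\<close>.
  As \<open>I1\<close> and \<open>I2\<close> are open, it is inherited from whichever of them
  contains \<open>t\<close>.\<close>

lemma time_local_solution_Un:
  assumes \<Omega>: "open \<Omega>" and I: "open I1" "open I2"
    and 1: "time_local_solution \<Omega> \<beta> lam f K I1 u" and 2: "time_local_solution \<Omega> \<beta> lam f K I2 u"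
  shows "time_local_solution \<Omega> \<beta> lam f K (I1 \<union> I2) u"
proof -
  note cU = continuous_on_Times_Un[OF I]
  have "C21_on \<Omega> (I1 \<union> I2) u"
    using 1 2 unfolding time_local_solution_def C21_on_def
    by (auto intro!: cU simp: differentiable_on_eq_differentiable_at I open_Un)
  moreover have "continuous_on (closure \<Omega> \<times> (I1 \<union> I2)) (\<lambda>(x, t). u x t)"
    using 1 2 by (intro cU) (auto simp: time_local_solution_def)
  moreover have "\<exists>g. ((\<lambda>(y, s). grad (\<lambda>z. u z s) y) \<longlongrightarrow> g) (at (x, t) within \<Omega> \<times> (I1 \<union> I2))"
    if x: "x \<in> frontier \<Omega>" "\<beta> x \<noteq> \<infinity>" "t \<in> I1 \<union> I2" for x t
  proof -
    have "at (x, t) within \<Omega> \<times> (I1 \<union> I2) = at (x, t) within \<Omega> \<times> J" if "t \<in> J" "J = I1 \<or> J = I2" for J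
      using at_within_Times_open[of J t x \<Omega> "I1 \<union> I2"] that I by (auto simp: Int_absorb1 Int_commute)
    then show ?thesis using x 1 2 unfolding time_local_solution_def by (metis Un_iff)
  qed
  ultimately show ?thesis using 1 2 unfolding time_local_solution_def by blast
qed

text \<open>The equation and the boundary condition do not depend explicitly on time. The lemma
  restarts \<open>u\<close> at a later moment and moves the local solution back to its
  place.\<close>

lemma time_local_solution_shift:
  assumes I: "open I" "open I'" "\<And>s. s \<in> I' \<Longrightarrow> s + c \<in> I"
    and u: "time_local_solution \<Omega> \<beta> lam f K I u"
  shows "time_local_solution \<Omega> \<beta> lam f K I' (\<lambda>x s. u x (s + c))"
proof -
  have cc: "continuous_on (S \<times> I') (\<lambda>(x, s). h x (s + c))" if "continuous_on (S \<times> I) (\<lambda>(x, t). h x t)"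
    for S and h :: "'a \<Rightarrow> real \<Rightarrow> real"
  proof -
    have "continuous_on (S \<times> I') (\<lambda>z. (fst z, snd z + c))" by (intro continuous_intros)
    from continuous_on_compose2[OF that this] I(3) show ?thesis
      by (simp add: case_prod_unfold image_subset_iff mem_Times_iff)
  qed
  have du: "(u x has_real_derivative deriv (u x) t) (at t)" if "x \<in> \<Omega>" "t \<in> I" for x t
  proof -
    have "u x differentiable_on I" using u that by (simp add: time_local_solution_def C21_on_def)
    then show ?thesis
      using that I(1) by (simp add: differentiable_on_eq_differentiable_at DERIV_deriv_iff_real_differentiable)
  qed
  have ds: "((\<lambda>s. u x (s + c)) has_real_derivative deriv (u x) (s + c)) (at s)" if "x \<in> \<Omega>" "s \<in> I'" for x s
    using du[OF that(1) I(3)[OF that(2)]] by (simp add: DERIV_shift)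
  have dd: "deriv (\<lambda>s. u x (s + c)) s = deriv (u x) (s + c)" if "x \<in> \<Omega>" "s \<in> I'" for x s
    by (rule DERIV_imp_deriv[OF ds[OF that]])
  have "continuous_on (\<Omega> \<times> I') (\<lambda>(x, s). deriv (\<lambda>s. u x (s + c)) s)"
    using cc[of \<Omega> "\<lambda>x. deriv (u x)"] u dd
    by (subst continuous_on_cong[OF refl, of _ _ "\<lambda>(x, s). deriv (u x) (s + c)"])
       (auto simp: time_local_solution_def C21_on_def)
  moreover have "(\<lambda>s. u x (s + c)) differentiable_on I'" if "x \<in> \<Omega>" for x
    using ds[OF that] by (auto simp: differentiable_on_eq_differentiable_at[OF I(2)] real_differentiable_def)
  moreover have "continuous_on (\<Omega> \<times> I') (\<lambda>(x, s). pd b (\<lambda>y. u y (s + c)) x)" if "b \<in> Basis" for b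
    using cc[of \<Omega> "\<lambda>x t. pd b (\<lambda>y. u y t) x"] u that by (auto simp: time_local_solution_def C21_on_def)
  moreover have "continuous_on (\<Omega> \<times> I') (\<lambda>(x, s). pd d (pd b (\<lambda>y. u y (s + c))) x)" if "b \<in> Basis" "d \<in> Basis" for b d
    using cc[of \<Omega> "\<lambda>x t. pd d (pd b (\<lambda>y. u y t)) x"] u that by (auto simp: time_local_solution_def C21_on_def)
  ultimately have "C21_on \<Omega> I' (\<lambda>x s. u x (s + c))"
    using u I(3) cc[of \<Omega> u] unfolding time_local_solution_def C21_on_def by auto
  moreover have "continuous_on (closure \<Omega> \<times> I') (\<lambda>(x, s). u x (s + c))"
    using u by (intro cc) (auto simp: time_local_solution_def)
  moreover have "\<exists>g. ((\<lambda>(y, s). grad (\<lambda>z. u z (s + c)) y) \<longlongrightarrow> g) (at (x, s) within \<Omega> \<times> I')"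
    if x: "x \<in> frontier \<Omega>" "\<beta> x \<noteq> \<infinity>" "s \<in> I'" for x s
  proof -
    obtain g where g: "((\<lambda>(y, s). grad (\<lambda>z. u z s) y) \<longlongrightarrow> g) (at (x, s + c) within \<Omega> \<times> I)"
      using u x I(3) unfolding time_local_solution_def by blast
    have "((\<lambda>z. (fst z, snd z + c)) \<longlongrightarrow> (fst (x, s), snd (x, s) + c)) (at (x, s) within \<Omega> \<times> I')"
      by (intro tendsto_intros)
    moreover have "\<forall>\<^sub>F z in at (x, s) within \<Omega> \<times> I'. (fst z, snd z + c) \<in> \<Omega> \<times> I \<and> (fst z, snd z + c) \<noteq> (x, s + c)"
      unfolding eventually_at_filter by (rule always_eventually) (use I(3) in auto)
    ultimately have "filterlim (\<lambda>z. (fst z, snd z + c)) (at (x, s + c) within \<Omega> \<times> I) (at (x, s) within \<Omega> \<times> I')"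
      by (simp add: filterlim_at)
    from filterlim_compose[OF g this] show ?thesis by (auto simp: case_prod_unfold)
  qed
  moreover have "deriv (\<lambda>s. u x (s + c)) s = laplacian (\<lambda>y. K (u y (s + c))) x + lam * f (u x (s + c))"
    if "x \<in> \<Omega>" "s \<in> I'" for x s
    using dd[OF that] u I(3)[OF that(2)] that(1) by (simp add: time_local_solution_def)
  ultimately show ?thesis using u I(3) unfolding time_local_solution_def by simp
qed

text \<open>Continuity upgrades the essential bound to a pointwise one: the set where it fails is
  open and null, hence empty.\<close>

lemma Linf_norm_bound:
  assumes "open \<Omega>" "continuous_on \<Omega> v" "Linf_norm \<Omega> v < ereal B" "x \<in> \<Omega>"
  shows "\<bar>v x\<bar> \<le> B"
proof (rule ccontr)
  assume n: "\<not> \<bar>v x\<bar> \<le> B"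
  define S where "S = \<Omega> \<inter> (\<lambda>x. \<bar>v x\<bar>) -` {B<..}"
  have "continuous_on \<Omega> (\<lambda>x. \<bar>v x\<bar>)" using assms(2) by (intro continuous_intros)
  then have "open S" unfolding S_def by (intro continuous_open_preimage assms(1)) auto
  moreover have "x \<in> S" using assms(4) n by (simp add: S_def)
  ultimately have "\<not> negligible S" using open_not_negligible by blast
  moreover have "negligible S"
  proof -
    have "AE x in vol \<Omega>. ereal \<bar>v x\<bar> \<le> Linf_norm \<Omega> v"
      unfolding Linf_norm_def by (rule esssup_AE)
    then have "AE x in lborel. x \<in> \<Omega> \<longrightarrow> ereal \<bar>v x\<bar> \<le> Linf_norm \<Omega> v"
      using assms(1) by (subst (asm) AE_restrict_space_iff) auto
    then have "AE x in lborel. x \<notin> S"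
      by eventually_elim (use assms(3) in \<open>auto simp: S_def dest: le_less_trans\<close>)
    then have "S \<in> null_sets lborel" using \<open>open S\<close> by (subst (asm) AE_iff_null_sets[symmetric]) auto
    then show ?thesis by (simp add: negligible_iff_null_sets null_sets_completionI)
  qed
  ultimately show False by simp
qed

text \<open>A finite upper limit bounds the solution by one constant \<open>B\<close> throughout a
  left neighbourhood of the maximal time. The local existence time \<open>\<tau>\<close> depends on
  \<open>B\<close> only, so a restart late enough overshoots the maximal time; uniqueness makes the
  two pieces agree where they overlap.\<close>

lemma blows_up_if_maximal_time_finite:
  fixes \<Omega> :: "'a::euclidean_space set"
  assumes \<Omega>: "open \<Omega>" and wp: "locally_well_posed \<Omega> \<beta> lam f K"
    and max: "maximal_solution \<Omega> \<beta> lam f K u0 T u"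
    and pos: "\<And>x t. x \<in> \<Omega> \<Longrightarrow> t \<in> existence_times T \<Longrightarrow> 0 < u x t"
    and fin: "T < \<infinity>"
  shows "blows_up_in_finite_time \<Omega> T u"
proof (rule ccontr)
  assume nb: "\<not> blows_up_in_finite_time \<Omega> T u"
  have sol: "classical_solution \<Omega> \<beta> lam f K u0 T u" using max by (simp add: maximal_solution_def)
  then have "0 < T" by (simp add: classical_solution_def)
  with fin obtain T0 where T: "T = ereal T0" and T0: "0 < T0" by (cases T) auto
  have I: "existence_times (ereal r) = {0<..<r}" for r by (auto simp: existence_times_def)
  define I1 where "I1 = {0<..<T0}"
  have s1: "time_local_solution \<Omega> \<beta> lam f K I1 u" and u0c: "continuous_on (\<Omega> \<times> insert 0 I1) (\<lambda>(x, t). u x t)"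
    and ui: "\<And>x. x \<in> \<Omega> \<Longrightarrow> u x 0 = u0 x" and ub: "\<And>s. s \<in> I1 \<Longrightarrow> \<exists>C. \<forall>x\<in>\<Omega>. \<forall>t\<in>{0<..s}. \<bar>u x t\<bar> \<le> C"
    using sol by (simp_all add: classical_solution_alt T I I1_def)
  have uc: "continuous_on (closure \<Omega> \<times> I1) (\<lambda>(x, t). u x t)" using s1 by (simp add: time_local_solution_def)
  have slice: "continuous_on S (\<lambda>x. h x t)" if "continuous_on (S \<times> J) (\<lambda>(x, t). h x t)" "t \<in> J"
    for h :: "'a \<Rightarrow> real \<Rightarrow> real" and S J t
    using continuous_on_slice(1)[OF that] by simp
  have "Limsup (at_left T0) (\<lambda>t. Linf_norm \<Omega> (\<lambda>x. u x t)) \<noteq> \<infinity>"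
    using nb by (simp add: blows_up_in_finite_time_def T)
  then obtain B where "Limsup (at_left T0) (\<lambda>t. Linf_norm \<Omega> (\<lambda>x. u x t)) < ereal B"
    using less_PInf_Ex_of_nat[of "Limsup (at_left T0) (\<lambda>t. Linf_norm \<Omega> (\<lambda>x. u x t))"] by auto
  from Limsup_lessD[OF this] obtain d where d: "d < T0" "\<And>t. d < t \<Longrightarrow> t < T0 \<Longrightarrow> Linf_norm \<Omega> (\<lambda>x. u x t) < ereal B"
    unfolding eventually_at_left_field by blast
  from wp[unfolded locally_well_posed_def, THEN spec] obtain \<tau> where \<tau>': "0 < \<tau> \<and> (\<forall>v0. continuous_on (closure \<Omega>) v0 \<and> (\<forall>x\<in>closure \<Omega>. 0 \<le> v0 x \<and> v0 x \<le> B) \<and>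
        (\<forall>x\<in>frontier \<Omega>. \<beta> x = \<infinity> \<longrightarrow> K (v0 x) = 0) \<longrightarrow>
        (\<exists>v. classical_solution \<Omega> \<beta> lam f K v0 (ereal \<tau>) v \<and>
             (\<forall>T w. classical_solution \<Omega> \<beta> lam f K v0 T w \<and>
                     (\<forall>x\<in>\<Omega>. \<forall>t\<in>existence_times T. 0 \<le> w x t) \<longrightarrow>
                     (\<forall>x\<in>\<Omega>. \<forall>t\<in>existence_times (min (ereal \<tau>) T). w x t = v x t))))" ..
  then have \<tau>: "0 < \<tau>" by simp
  \<comment> \<open>The restart is positive, lies beyond \<open>d\<close> so that \<open>B\<close>
    bounds the new initial value, and lies within \<open>\<tau>\<close> of \<open>T0\<close> so that
    the new solution reaches past \<open>T0\<close>.\<close>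
  obtain t0 where t0: "max (max d 0) (T0 - \<tau>) < t0" "t0 < T0"
    using dense[of "max (max d 0) (T0 - \<tau>)" T0] d(1) T0 \<tau> by auto
  have t0I: "t0 \<in> I1" using t0 by (auto simp: I1_def)
  define v0 where "v0 x = u x t0" for x
  have v0c: "continuous_on (closure \<Omega>) v0" unfolding v0_def by (rule slice[OF uc t0I])
  have v0b: "0 \<le> v0 x \<and> v0 x \<le> B" if "x \<in> closure \<Omega>" for x
  proof
    show "0 \<le> v0 x"
      by (rule continuous_ge_on_closure[OF v0c that]) (use pos t0I in \<open>auto simp: v0_def T I I1_def less_imp_le\<close>)
    show "v0 x \<le> B"
    proof (rule continuous_le_on_closure[OF v0c that])
      fix y assume "y \<in> \<Omega>"
      have "continuous_on \<Omega> v0" by (rule continuous_on_subset[OF v0c closure_subset])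
      from Linf_norm_bound[OF \<Omega> this _ \<open>y \<in> \<Omega>\<close>, of B] d(2)[of t0] t0 show "v0 y \<le> B"
        by (auto simp: v0_def[abs_def])
    qed
  qed
  have v0d: "K (v0 x) = 0" if "x \<in> frontier \<Omega>" "\<beta> x = \<infinity>" for x
    using s1 that t0I unfolding time_local_solution_def boundary_condition_def v0_def by auto
  have "continuous_on (closure \<Omega>) v0 \<and> (\<forall>x\<in>closure \<Omega>. 0 \<le> v0 x \<and> v0 x \<le> B) \<and>
        (\<forall>x\<in>frontier \<Omega>. \<beta> x = \<infinity> \<longrightarrow> K (v0 x) = 0)"
    using v0c v0b v0d by blast
  from \<tau>'[THEN conjunct2, THEN spec, THEN mp, OF this] obtain v where v: "classical_solution \<Omega> \<beta> lam f K v0 (ereal \<tau>) v"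
    and un: "\<And>T w. classical_solution \<Omega> \<beta> lam f K v0 T w \<Longrightarrow>
             (\<forall>x\<in>\<Omega>. \<forall>t\<in>existence_times T. 0 \<le> w x t) \<Longrightarrow>
             (\<forall>x\<in>\<Omega>. \<forall>t\<in>existence_times (min (ereal \<tau>) T). w x t = v x t)" by blast
  have vs: "time_local_solution \<Omega> \<beta> lam f K {0<..<\<tau>} v" and vb: "\<And>s. s \<in> {0<..<\<tau>} \<Longrightarrow> \<exists>C. \<forall>x\<in>\<Omega>. \<forall>t\<in>{0<..s}. \<bar>v x t\<bar> \<le> C"
    using v by (simp_all add: classical_solution_alt I)
  have vc: "continuous_on (closure \<Omega> \<times> {0<..<\<tau>}) (\<lambda>(x, t). v x t)" using vs by (simp add: time_local_solution_def)
  define w where "w x s = u x (s + t0)" for x s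
  have w: "classical_solution \<Omega> \<beta> lam f K v0 (ereal (T0 - t0)) w"
    unfolding classical_solution_alt I
  proof (intro conjI ballI)
    show "0 < ereal (T0 - t0)" using t0 by simp
    show "time_local_solution \<Omega> \<beta> lam f K {0<..<T0 - t0} w"
      unfolding w_def
      by (rule time_local_solution_shift[OF _ _ _ s1]) (use t0 in \<open>auto simp: I1_def\<close>)
    show "continuous_on (\<Omega> \<times> insert 0 {0<..<T0 - t0}) (\<lambda>(x, t). w x t)"
    proof -
      have "continuous_on (\<Omega> \<times> I1) (\<lambda>(x, t). u x t)"
        by (rule continuous_on_subset[OF uc]) (use closure_subset in auto)
      moreover have "continuous_on (\<Omega> \<times> insert 0 {0<..<T0 - t0}) (\<lambda>z. (fst z, snd z + t0))"
        by (intro continuous_intros)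
      moreover have "(\<lambda>z. (fst z, snd z + t0)) ` (\<Omega> \<times> insert 0 {0<..<T0 - t0}) \<subseteq> \<Omega> \<times> I1"
        using t0 by (auto simp: I1_def)
      ultimately have "continuous_on (\<Omega> \<times> insert 0 {0<..<T0 - t0}) (\<lambda>z. (\<lambda>(x, t). u x t) (fst z, snd z + t0))"
        by (rule continuous_on_compose2)
      then show ?thesis by (simp add: w_def case_prod_unfold)
    qed
    show "w x 0 = v0 x" for x by (simp add: w_def v0_def)
    fix s assume s: "s \<in> {0<..<T0 - t0}"
    then have "s + t0 \<in> I1" using t0 by (auto simp: I1_def)
    from ub[OF this] obtain C where "\<forall>x\<in>\<Omega>. \<forall>t\<in>{0<..s + t0}. \<bar>u x t\<bar> \<le> C" by blast
    then show "\<exists>C. \<forall>x\<in>\<Omega>. \<forall>t\<in>{0<..s}. \<bar>w x t\<bar> \<le> C"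
      using t0 by (intro exI[of _ C]) (auto simp: w_def)
  qed
  \<comment> \<open>Positivity of \<open>u\<close> is essential here, since well-posedness offers
    uniqueness among nonnegative solutions only.\<close>
  have "\<forall>x\<in>\<Omega>. \<forall>t\<in>existence_times (min (ereal \<tau>) (ereal (T0 - t0))). w x t = v x t"
    by (rule un[OF w]) (use pos t0 in \<open>auto simp: w_def T I less_imp_le\<close>)
  moreover have "min (ereal \<tau>) (ereal (T0 - t0)) = ereal (T0 - t0)" using t0 by (simp add: min_def)
  ultimately have wv: "w x t = v x t" if "x \<in> \<Omega>" "t \<in> {0<..<T0 - t0}" for x t
    using that by (simp add: I)
  \<comment> \<open>Uniqueness speaks of points of \<open>\<Omega>\<close>. The pieces must agree on
    the closure as well, where the boundary condition is read off; both sides are continuous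
    there.\<close>
  have uv: "u x t = v x (t - t0)" if x: "x \<in> closure \<Omega>" and t: "t0 < t" "t < T0" for x t
  proof -
    have "continuous_on (closure \<Omega>) (\<lambda>x. u x t - v x (t - t0))"
      by (intro continuous_intros slice[OF uc] slice[OF vc]) (use t t0 in \<open>auto simp: I1_def\<close>)
    from continuous_constant_on_closure[OF this _ x, of 0] wv[of _ "t - t0"] t
    show ?thesis by (simp add: w_def)
  qed
  define z where "z x t = (if t < T0 then u x t else v x (t - t0))" for x t
  define I2 where "I2 = {t0<..<t0 + \<tau>}"
  have z1: "z x t = u x t" if "t < T0" for x t using that by (simp add: z_def)
  have z2: "z x t = v x (t - t0)" if "x \<in> closure \<Omega>" "t \<in> I2" for x t using that uv by (simp add: z_def I2_def)
  have I12: "I1 \<union> I2 = {0<..<t0 + \<tau>}" using t0 by (auto simp: I1_def I2_def)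
  have "classical_solution \<Omega> \<beta> lam f K u0 (ereal (t0 + \<tau>)) z"
    unfolding classical_solution_alt I
  proof (intro conjI ballI)
    show "0 < ereal (t0 + \<tau>)" using t0 \<tau> by simp
    have "time_local_solution \<Omega> \<beta> lam f K I1 z"
      by (rule time_local_solution_cong[OF \<Omega> _ _ s1]) (auto simp: I1_def z1)
    moreover have "time_local_solution \<Omega> \<beta> lam f K I2 z"
    proof (rule time_local_solution_cong[OF \<Omega>])
      show "time_local_solution \<Omega> \<beta> lam f K I2 (\<lambda>x s. v x (s + (- t0)))"
        by (rule time_local_solution_shift[OF _ _ _ vs]) (auto simp: I2_def)
    qed (auto simp: I2_def[symmetric] z2, simp add: I2_def)
    ultimately show "time_local_solution \<Omega> \<beta> lam f K {0<..<t0 + \<tau>} z"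
      unfolding I12[symmetric] by (intro time_local_solution_Un[OF \<Omega>]) (auto simp: I1_def I2_def)
    then have zc: "continuous_on (closure \<Omega> \<times> {0<..<t0 + \<tau>}) (\<lambda>(x, t). z x t)"
      by (simp add: time_local_solution_def)
    show "continuous_on (\<Omega> \<times> insert 0 {0<..<t0 + \<tau>}) (\<lambda>(x, t). z x t)"
    proof (rule continuous_on_Times_local)
      fix t assume t: "t \<in> insert 0 {0<..<t0 + \<tau>}"
      show "\<exists>O'. open O' \<and> t \<in> O' \<and> continuous_on (\<Omega> \<times> (insert 0 {0<..<t0 + \<tau>} \<inter> O')) (\<lambda>(x, t). z x t)"
      proof (cases "t = 0")
        case True
        have "continuous_on (\<Omega> \<times> (insert 0 {0<..<t0 + \<tau>} \<inter> {..<T0})) (\<lambda>(x, t). u x t)"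
          by (rule continuous_on_subset[OF u0c]) (auto simp: I1_def)
        then have "continuous_on (\<Omega> \<times> (insert 0 {0<..<t0 + \<tau>} \<inter> {..<T0})) (\<lambda>(x, t). z x t)"
          by (subst continuous_on_cong[OF refl, of _ _ "\<lambda>(x, t). u x t"]) (auto simp: z1)
        then show ?thesis using True T0 by (intro exI[of _ "{..<T0}"]) auto
      next
        case False
        have "continuous_on (\<Omega> \<times> (insert 0 {0<..<t0 + \<tau>} \<inter> {0<..})) (\<lambda>(x, t). z x t)"
          by (rule continuous_on_subset[OF zc]) (use closure_subset in auto)
        then show ?thesis using False t by (intro exI[of _ "{0<..}"]) auto
      qed
    qed
    show "z x 0 = u0 x" if "x \<in> \<Omega>" for x using ui[OF that] T0 by (simp add: z_def)
    fix s assume s: "s \<in> {0<..<t0 + \<tau>}"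
    obtain C1 where C1: "\<And>x t. x \<in> \<Omega> \<Longrightarrow> t \<in> {0<..t0} \<Longrightarrow> \<bar>u x t\<bar> \<le> C1" using ub[OF t0I] by blast
    \<comment> \<open>For \<open>s\<close> below \<open>t0\<close> the shifted time would not be
      positive; the maximum yields an admissible time in all cases.\<close>
    have "max (s - t0) (\<tau> / 2) \<in> {0<..<\<tau>}" using s \<tau> by auto
    from vb[OF this] obtain C2 where C2: "\<And>x t. x \<in> \<Omega> \<Longrightarrow> t \<in> {0<..max (s - t0) (\<tau> / 2)} \<Longrightarrow> \<bar>v x t\<bar> \<le> C2" by blast
    have "\<bar>z x t\<bar> \<le> max C1 C2" if x: "x \<in> \<Omega>" and t: "t \<in> {0<..s}" for x t
    proof (cases "t \<le> t0")
      case True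
      then show ?thesis using C1[OF x, of t] t t0 by (simp add: z1)
    next
      case False
      then have "t \<in> I2" using t s by (simp add: I2_def)
      then have "z x t = v x (t - t0)" using x closure_subset by (intro z2) auto
      moreover have "t - t0 \<in> {0<..max (s - t0) (\<tau> / 2)}" using t False by (simp add: le_max_iff_disj)
      ultimately show ?thesis using C2[OF x] by (simp add: le_max_iff_disj)
    qed
    then show "\<exists>C. \<forall>x\<in>\<Omega>. \<forall>t\<in>{0<..s}. \<bar>z x t\<bar> \<le> C" by blast
  qed
  moreover have "\<forall>x\<in>\<Omega>. \<forall>t\<in>existence_times T. z x t = u x t" by (simp add: T I z1)
  moreover have "T < ereal (t0 + \<tau>)" using t0 by (simp add: T)
  ultimately show False using max unfolding maximal_solution_def by blast
qed

section \<open>Blow-up\<close>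

text \<open>One half of the integral test: \<open>1 / g\<close> decreases, so the term at
  \<open>a + n\<close> is at most the integral over the unit interval to its left. The condition
  \<open>b + 1 \<le> a\<close> keeps the first of these intervals inside
  \<open>{b..}\<close>.\<close>

lemma summable_inverse_of_integrable:
  fixes g :: "real \<Rightarrow> real"
  assumes mono: "\<And>x y. b \<le> x \<Longrightarrow> x \<le> y \<Longrightarrow> g x \<le> g y" and pos: "0 < g b"
    and int: "set_integrable lborel {b..} (\<lambda>s. 1 / g s)" and a: "b + 1 \<le> a"
  shows "summable (\<lambda>k. 1 / g (a + real k))"
proof (rule summableI_nonneg_bounded)
  have gp: "0 < g x" if "b \<le> x" for x using mono[of b x] pos that by simp
  show "0 \<le> 1 / g (a + real n)" for n using gp[of "a + real n"] a by simp
  define F where "F n = (LINT s:{a - 1..<a - 1 + real n}|lborel. 1 / g s)" for n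
  have sub: "set_integrable lborel S (\<lambda>s. 1 / g s)" if "S \<in> sets borel" "S \<subseteq> {b..}" for S
    by (rule set_integrable_subset[OF int]) (use that in auto)
  have "(\<Sum>i<n. 1 / g (a + real i)) \<le> F n" for n
  proof (induction n)
    case 0
    then show ?case by (simp add: F_def set_lebesgue_integral_def)
  next
    case (Suc n)
    define S where "S = {a - 1 + real n..<a + real n}"
    have "F (Suc n) = F n + (LINT s:S|lborel. 1 / g s)"
    proof -
      have "{a - 1..<a - 1 + real (Suc n)} = {a - 1..<a - 1 + real n} \<union> S" by (auto simp: S_def)
      then show ?thesis
        unfolding F_def by (simp only:) (rule set_integral_Un, use a in \<open>auto simp: S_def intro!: sub\<close>)
    qed
    moreover have "1 / g (a + real n) \<le> (LINT s:S|lborel. 1 / g s)"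
    proof -
      have "1 / g (a + real n) = (LINT s:S|lborel. 1 / g (a + real n))"
        by (subst set_integral_const) (simp_all add: S_def)
      also have "\<dots> \<le> (LINT s:S|lborel. 1 / g s)"
      proof (rule set_integral_mono)
        show "set_integrable lborel S (\<lambda>s. 1 / g (a + real n))"
          unfolding set_integrable_def S_def by simp
        show "set_integrable lborel S (\<lambda>s. 1 / g s)" by (rule sub) (use a in \<open>auto simp: S_def\<close>)
        fix s assume "s \<in> S"
        then show "1 / g (a + real n) \<le> 1 / g s"
          using mono[of s "a + real n"] gp[of s] a by (intro divide_left_mono mult_pos_pos) (auto simp: S_def)
      qed
      finally show ?thesis .
    qed
    ultimately show ?case using Suc by simp
  qed
  also have "F n \<le> (LINT s:{b..}|lborel. 1 / g s)" for n
    unfolding F_def set_lebesgue_integral_def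
  proof (rule integral_mono)
    show "integrable lborel (\<lambda>s. indicat_real {a - 1..<a - 1 + real n} s *\<^sub>R (1 / g s))"
      using sub[of "{a - 1..<a - 1 + real n}"] a by (simp add: set_integrable_def subset_iff)
    show "integrable lborel (\<lambda>s. indicat_real {b..} s *\<^sub>R (1 / g s))" using int by (simp add: set_integrable_def)
    show "indicat_real {a - 1..<a - 1 + real n} s *\<^sub>R (1 / g s) \<le> indicat_real {b..} s *\<^sub>R (1 / g s)" for s
      using gp[of s] a by (auto simp: indicator_def)
  qed
  finally show "(\<Sum>i<n. 1 / g (a + real i)) \<le> (LINT s:{b..}|lborel. 1 / g s)" for n .
qed

text \<open>The time needed to climb from level \<open>a + k\<close> to \<open>a + k + 1\<close> is at most \<open>1 / (c * g (a + k))\<close>.\<close>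

lemma no_global_growth:
  fixes A H g :: "real \<Rightarrow> real"
  assumes cont: "continuous_on {t1..} A"
    and inc: "\<And>s t m. t1 \<le> s \<Longrightarrow> s \<le> t \<Longrightarrow> (\<And>r. r \<in> {s..t} \<Longrightarrow> m \<le> H r) \<Longrightarrow> m * (t - s) \<le> A t - A s"
    and H: "\<And>t. t1 \<le> t \<Longrightarrow> M \<le> A t \<Longrightarrow> c * g (A t) \<le> H t" and c: "0 < c"
    and g: "\<And>x y. M \<le> x \<Longrightarrow> x \<le> y \<Longrightarrow> g x \<le> g y" "0 < g M"
    and start: "M < A t1" and summ: "summable (\<lambda>k. 1 / g (A t1 + real k))"
  shows False
proof -
  have gp: "0 < g x" if "M \<le> x" for x using g(1)[of M x] g(2) that by simp
  have H0: "0 \<le> H t" if "t1 \<le> t" "M \<le> A t" for t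
    using H[OF that] mult_pos_pos[OF c gp[OF that(2)]] by linarith
  have above: "M < A t" if t: "t1 \<le> t" for t
  proof (rule ccontr)
    assume "\<not> M < A t"
    \<comment> \<open>At the first time at which the level \<open>M\<close> is no longer exceeded,
      continuity gives the value \<open>M\<close> itself. Up to then the rate is nonnegative, so
      \<open>A\<close> cannot have come down from its start above \<open>M\<close>.\<close>
    define S where "S = {t1..t} \<inter> A -` {..M}"
    have ct: "continuous_on {t1..t} A" by (rule continuous_on_subset[OF cont]) auto
    have "closed S" unfolding S_def by (rule continuous_closed_preimage[OF ct]) auto
    moreover have "bounded S" by (rule bounded_subset[of "{t1..t}"]) (auto simp: S_def)
    ultimately have "compact S" by (simp add: compact_eq_bounded_closed)
    moreover have "S \<noteq> {}" using t \<open>\<not> M < A t\<close> by (auto simp: S_def)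
    ultimately obtain s where s: "s \<in> S" "\<And>r. r \<in> S \<Longrightarrow> s \<le> r"
      using compact_attains_inf[of S] by metis
    have s1: "t1 \<le> s" "s \<le> t" "A s \<le> M" using s(1) by (auto simp: S_def)
    have "continuous_on {t1..s} A" by (rule continuous_on_subset[OF cont]) auto
    then obtain r where r: "t1 \<le> r" "r \<le> s" "A r = M"
      using IVT2'[of A s M t1] s1 start by auto
    then have "r \<in> S" using s1 by (auto simp: S_def)
    then have "A s = M" using s(2)[of r] r by auto
    have "M \<le> A r" if "r \<in> {t1..s}" for r
    proof (cases "r = s")
      case False
      then have "r \<notin> S" using that s(2)[of r] by auto
      then show ?thesis using that s1 by (auto simp: S_def)
    qed (use \<open>A s = M\<close> in simp)
    then have "0 * (s - t1) \<le> A s - A t1" using H0 s1 by (intro inc) auto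
    then show False using \<open>A s = M\<close> start by simp
  qed
  have mono: "A s \<le> A t" if "t1 \<le> s" "s \<le> t" for s t
  proof -
    have "0 * (t - s) \<le> A t - A s" using that above H0 by (intro inc) (auto simp: less_imp_le)
    then show ?thesis by simp
  qed
  define a where "a = A t1"
  define \<tau> where "\<tau> n = t1 + (\<Sum>k<n. 1 / (c * g (a + real k)))" for n
  have ga: "0 < g (a + real k)" for k using gp start by (simp add: a_def)
  have \<tau>1: "t1 \<le> \<tau> n" for n
    unfolding \<tau>_def using ga c by (simp add: sum_nonneg less_imp_le)
  have climb: "a + real n \<le> A (\<tau> n)" for n
  proof (induction n)
    case 0
    then show ?case by (simp add: \<tau>_def a_def)
  next
    case (Suc n)
    have d: "\<tau> (Suc n) - \<tau> n = 1 / (c * g (a + real n))" by (simp add: \<tau>_def)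
    have le: "\<tau> n \<le> \<tau> (Suc n)" using d mult_pos_pos[OF c ga[of n]] by (simp add: \<tau>_def)
    have "c * g (a + real n) * (\<tau> (Suc n) - \<tau> n) \<le> A (\<tau> (Suc n)) - A (\<tau> n)"
    proof (rule inc[OF \<tau>1 le])
      fix r assume r: "r \<in> {\<tau> n..\<tau> (Suc n)}"
      then have r1: "t1 \<le> r" using \<tau>1[of n] by simp
      have "a + real n \<le> A r" using Suc mono[OF \<tau>1, of n r] r by simp
      then have "g (a + real n) \<le> g (A r)" using start by (intro g(1)) (auto simp: a_def)
      then have "c * g (a + real n) \<le> c * g (A r)" using c by simp
      also have "\<dots> \<le> H r" using H[OF r1] above[OF r1] by simp
      finally show "c * g (a + real n) \<le> H r" .
    qed
    moreover have "c * g (a + real n) * (\<tau> (Suc n) - \<tau> n) = 1" using d ga[of n] c by simp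
    ultimately show ?case using Suc by simp
  qed
  \<comment> \<open>By summability all climbing times stay below this finite time, at which
    \<open>A\<close> would have to exceed every level \<open>a + n\<close>.\<close>
  define S where "S = t1 + (\<Sum>k. 1 / g (a + real k)) / c"
  have "\<tau> n \<le> S" for n
  proof -
    have "(\<Sum>k<n. 1 / g (a + real k)) \<le> (\<Sum>k. 1 / g (a + real k))"
      using summ ga by (intro sum_le_suminf) (auto simp: a_def less_imp_le)
    moreover have "(\<Sum>k<n. 1 / (c * g (a + real k))) = (\<Sum>k<n. 1 / g (a + real k)) / c"
      by (simp add: sum_divide_distrib mult.commute)
    ultimately show ?thesis using c by (simp add: \<tau>_def S_def divide_right_mono)
  qed
  then have "a + real n \<le> A S" for n using order_trans[OF climb mono[OF \<tau>1]] by blast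
  moreover obtain n where "A S - a < real n" using reals_Archimedean2 by blast
  ultimately show False by (smt (verit))
qed

text \<open>With \<open>d = 0\<close> this gives monotonicity, and with \<open>d\<close> the slope
  at 0 of a convex function at least linear growth; both are used for \<open>f\<close> and for
  \<open>K\<close>.\<close>

lemma deriv_bound_below:
  fixes h h' :: "real \<Rightarrow> real"
  assumes "\<And>s. (h has_real_derivative h' s) (at s)" "\<And>s. 0 \<le> s \<Longrightarrow> d \<le> h' s" "0 \<le> a" "a \<le> s"
  shows "h a + d * (s - a) \<le> h s"
proof (cases "a = s")
  case False
  then obtain z where z: "a < z" "z < s" "h s - h a = (s - a) * h' z"
    using MVT2[of a s h h'] assms by auto
  have "(s - a) * d \<le> (s - a) * h' z" using assms z by (intro mult_left_mono) auto
  with z(3) have "(s - a) * d \<le> h s - h a" by simp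
  then show ?thesis by (simp add: mult.commute)
qed simp

context eigen_problem
begin

lemma f_growth: "0 \<le> a \<Longrightarrow> a \<le> s \<Longrightarrow> f a \<le> f s" "0 \<le> s \<Longrightarrow> f 0 + deriv f 0 * s \<le> f s"
proof -
  show "f a \<le> f s" if "0 \<le> a" "a \<le> s"
    using deriv_bound_below[OF f_deriv(1), of 0 a s] fd(1) that by (simp add: less_imp_le)
  have "deriv f 0 \<le> deriv f s" if "0 \<le> s" for s
    using deriv_bound_below[OF f_deriv(2), of 0 0 s] fd(2) that by (simp add: less_imp_le)
  then show "f 0 + deriv f 0 * s \<le> f s" if "0 \<le> s"
    using deriv_bound_below[OF f_deriv(1), of "deriv f 0" 0 s] that by simp
qed

lemma K_growth: "0 \<le> a \<Longrightarrow> a \<le> s \<Longrightarrow> K a \<le> K s" "0 \<le> s \<Longrightarrow> K 0 + deriv K 0 * s \<le> K s"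
  "0 \<le> s \<Longrightarrow> deriv K 0 \<le> deriv K s"
proof -
  show "K a \<le> K s" if "0 \<le> a" "a \<le> s"
    using deriv_bound_below[OF K_deriv(1), of 0 a s] Kd(1) that by (simp add: less_imp_le)
  show *: "deriv K 0 \<le> deriv K s" if "0 \<le> s" for s
    using deriv_bound_below[OF K_deriv(2), of 0 0 s] Kd(2) that by (simp add: less_imp_le)
  show "K 0 + deriv K 0 * s \<le> K s" if "0 \<le> s"
    using deriv_bound_below[OF K_deriv(1), of "deriv K 0" 0 s] * that by simp
qed

text \<open>The bound \<open>1 \<le> s0\<close> is part of the conclusion because \<open>s0\<close>
  becomes the threshold for the mass: Jensen's inequality is applied to positive masses, and
  \<open>1 / K\<close> is integrable from 1 on.\<close>

lemma eventually_large:
  fixes h :: "real \<Rightarrow> real"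
  assumes "\<And>s. 0 \<le> s \<Longrightarrow> h 0 + d * s \<le> h s" "0 < d"
  obtains s0 where "1 \<le> s0" "\<And>s. s0 \<le> s \<Longrightarrow> N \<le> h s"
proof (rule that[of "max 1 ((N - h 0) / d)"])
  fix s assume s: "max 1 ((N - h 0) / d) \<le> s"
  then have "N - h 0 \<le> d * s" using assms(2) by (simp add: pos_divide_le_eq mult.commute)
  then show "N \<le> h s" using assms(1)[of s] s by simp
qed simp

lemma f_convex: "convex_on {0..} f" and K_convex: "convex_on {0..} K"
  by (rule f''_ge0_imp_convex[OF _ f_deriv] f''_ge0_imp_convex[OF _ K_deriv];
      use fd(2) Kd(2) in \<open>simp add: less_imp_le\<close>)+

text \<open>A non-integrable function has Bochner integral 0 by convention, which the normalisation
  excludes.\<close>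

lemma \<phi>_integrable: "integrable M \<phi>"
  using \<phi>1 not_integrable_integral_eq by fastforce

end

context solution
begin

lemma u_slice_bound:
  assumes "t \<in> I"
  obtains C where "0 < C" "\<And>x. x \<in> \<Omega> \<Longrightarrow> 0 < u x t \<and> u x t \<le> C"
proof -
  obtain C where "0 \<le> C" "\<And>x. x \<in> closure \<Omega> \<Longrightarrow> \<bar>u x t\<bar> \<le> C"
    by (rule compact_abs_bound[OF compact_cl u_slice[OF assms]]) blast
  then show ?thesis using that[of "C + 1"] u_pos[OF _ assms] \<Omega>_closure by fastforce
qed

text \<open>Convexity gives continuity in the interior of the half-line only, so \<open>h\<close> is
  taken continuous on \<open>{0<..}\<close>, where \<open>u\<close> has its values. Near 0 the bound
  \<open>B\<close> takes over.\<close>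

lemma weighted_integrable:
  assumes "t \<in> I" "continuous_on {0<..} h" "\<And>s. 0 < s \<Longrightarrow> s \<le> C \<Longrightarrow> \<bar>h s\<bar> \<le> B"
    and C: "\<And>x. x \<in> \<Omega> \<Longrightarrow> u x t \<le> C"
  shows "integrable M (\<lambda>x. h (u x t) * \<phi> x)"
proof -
  obtain B4 where B4: "0 \<le> B4" "\<And>x. x \<in> closure \<Omega> \<Longrightarrow> \<bar>\<phi> x\<bar> \<le> B4"
    by (rule compact_abs_bound[OF compact_cl \<phi>cont]) blast
  show ?thesis
  proof (rule integrable_vol[OF open\<Omega> bdd measurable_vol])
    have "continuous_on \<Omega> (\<lambda>x. h (u x t))"
      by (rule continuous_on_compose2[OF assms(2) continuous_on_subset[OF u_slice[OF assms(1)] closure_subset]])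
         (use u_pos assms(1) in auto)
    then show "continuous_on \<Omega> (\<lambda>x. h (u x t) * \<phi> x)" by (intro continuous_intros \<phi>D(2))
    fix x assume x: "x \<in> \<Omega>"
    have "\<bar>h (u x t)\<bar> \<le> B" using assms(3) C[OF x] u_pos[OF x assms(1)] by blast
    then show "\<bar>h (u x t) * \<phi> x\<bar> \<le> B * B4"
      unfolding abs_mult using B4(2)[OF \<Omega>_closure[OF x]] by (intro mult_mono) auto
  qed
qed

lemma f_integrable: "t \<in> I \<Longrightarrow> integrable M (\<lambda>x. f (u x t) * \<phi> x)"
  and K_integrable: "t \<in> I \<Longrightarrow> integrable M (\<lambda>x. K (u x t) * \<phi> x)"
  and u_integrable: "t \<in> I \<Longrightarrow> integrable M (\<lambda>x. u x t * \<phi> x)"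
proof -
  assume t: "t \<in> I"
  obtain C where C: "0 < C" "\<And>x. x \<in> \<Omega> \<Longrightarrow> 0 < u x t \<and> u x t \<le> C" by (rule u_slice_bound[OF t]) blast
  show "integrable M (\<lambda>x. f (u x t) * \<phi> x)"
    by (rule weighted_integrable[OF t f_cont, of C "f C"])
       (use C fp f_growth(1) in \<open>auto simp: less_imp_le abs_of_pos\<close>)
  show "integrable M (\<lambda>x. K (u x t) * \<phi> x)"
    by (rule weighted_integrable[OF t K_cont(1), of C "K C"])
       (use C K_nonneg K_growth(1) in \<open>auto simp: less_imp_le\<close>)
  show "integrable M (\<lambda>x. u x t * \<phi> x)"
    by (rule weighted_integrable[OF t, of "\<lambda>s. s" C C]) (use C in auto)
qed

lemma jensen_f: "t \<in> I \<Longrightarrow> 0 < mass t \<Longrightarrow> f (mass t) \<le> (\<integral>x. f (u x t) * \<phi> x \<partial>M)"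
  and jensen_K: "t \<in> I \<Longrightarrow> 0 < mass t \<Longrightarrow> K (mass t) \<le> (\<integral>x. K (u x t) * \<phi> x \<partial>M)"
  unfolding mass_def
  by (rule jensen_weighted[OF f_convex] jensen_weighted[OF K_convex];
      use \<phi>_integrable f_integrable K_integrable u_integrable \<phi>1 \<phi>_pos u_pos in
        \<open>auto simp: less_imp_le\<close>)+

lemma rate_eq: "t \<in> I \<Longrightarrow> rate t = lam * (\<integral>x. f (u x t) * \<phi> x \<partial>M) - \<mu> * (\<integral>x. K (u x t) * \<phi> x \<partial>M)"
  unfolding rate_def using f_integrable K_integrable
  by (simp add: left_diff_distrib mult.assoc)

text \<open>For a global solution the mass at some small positive time still exceeds
  \<open>M1 + 1\<close>, and growth from there on is contradictory. Of the 2 in the hypothesis, one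
  unit is the margin required by the integral test; the other leaves room for the passage from time
  0 to a positive time.\<close>

lemma maximal_time_finite:
  assumes rate: "\<And>t. t \<in> I \<Longrightarrow> M1 \<le> mass t \<Longrightarrow> c * g (mass t) \<le> rate t" and c: "0 < c"
    and g: "\<And>x y. M1 \<le> x \<Longrightarrow> x \<le> y \<Longrightarrow> g x \<le> g y" "0 < g M1"
    and int: "set_integrable lborel {M1..} (\<lambda>s. 1 / g s)"
    and start: "M1 + 2 \<le> (\<integral>x. u0 x * \<phi> x \<partial>M)"
  shows "T < \<infinity>"
proof (rule ccontr)
  assume "\<not> T < \<infinity>"
  then have I: "I = {0<..}" by (auto simp: existence_times_def)
  have mc: "continuous_on {0..} mass"
    by (rule continuous_on_subset[OF mass_continuous]) (auto simp: I)
  then have "(mass \<longlongrightarrow> mass 0) (at 0 within {0..})" by (auto simp: continuous_on_def)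
  then have "(mass \<longlongrightarrow> mass 0) (at_right 0)" by (rule tendsto_within_subset) auto
  then have "\<forall>\<^sub>F t in at_right 0. M1 + 1 < mass t"
    by (rule order_tendstoD(1)) (use start mass_0 in simp)
  moreover have "\<forall>\<^sub>F t in at_right (0::real). 0 < t" by (rule eventually_at_right_less)
  ultimately have "\<forall>\<^sub>F t in at_right 0. M1 + 1 < mass t \<and> 0 < t" by eventually_elim simp
  then obtain t1 where t1: "M1 + 1 < mass t1" "0 < t1"
    using eventually_happens[of _ "at_right (0::real)"] by auto
  show False
  proof (rule no_global_growth[of t1 mass rate M1 c g])
    show "continuous_on {t1..} mass" by (rule continuous_on_subset[OF mc]) (use t1 in auto)
    show "m * (t - s) \<le> mass t - mass s" if "t1 \<le> s" "s \<le> t" "\<And>r. r \<in> {s..t} \<Longrightarrow> m \<le> rate r" for s t m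
      by (rule mass_increment) (use that t1 in \<open>auto simp: I\<close>)
    show "summable (\<lambda>k. 1 / g (mass t1 + real k))"
      by (rule summable_inverse_of_integrable[OF g int]) (use t1 in auto)
  qed (use rate c g t1 in \<open>auto simp: I\<close>)
qed

end

section \<open>The structural conditions and the growth rate they yield\<close>

context eigen_problem
begin

text \<open>Since \<open>deriv K\<close> is nondecreasing and positive at 0, the quotient
  \<open>deriv K s / f s\<close> dominates a multiple of \<open>1 / f s\<close>.\<close>

lemma inverse_f_integrable:
  assumes "set_integrable lborel {0..} (\<lambda>s. deriv K s / f s)" "0 \<le> b"
  shows "set_integrable lborel {b..} (\<lambda>s. 1 / f s)"
proof (rule set_integrable_subset)
  show "set_integrable lborel {0..} (\<lambda>s. 1 / f s)"
  proof (rule set_integrable_bound)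
    show "set_integrable lborel {0..} (\<lambda>s. 1 / deriv K 0 * (deriv K s / f s))"
      by (intro set_integrable_mult_right assms(1))
    have "continuous_on {0..} (\<lambda>s. 1 / f s)"
      using fp by (intro continuous_intros f_cont) (auto simp: less_imp_neq[THEN not_sym])
    then show "set_borel_measurable lborel {0..} (\<lambda>s. 1 / f s)"
      using borel_measurable_continuous_on_indicator[of "{0..}" "\<lambda>s. 1 / f s"]
      by (simp add: set_borel_measurable_def)
    show "AE s in lborel. s \<in> {0..} \<longrightarrow> norm (1 / f s) \<le> norm (1 / deriv K 0 * (deriv K s / f s))"
    proof (rule AE_I2, rule impI)
      fix s :: real assume "s \<in> {0..}"
      then have s: "0 < f s" "deriv K 0 \<le> deriv K s" "0 < deriv K 0" using fp K_growth(3) Kd(1) by auto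
      then have "1 \<le> deriv K s / deriv K 0" by simp
      then have "1 / f s \<le> (deriv K s / deriv K 0) / f s" using s by (intro divide_right_mono) auto
      then show "norm (1 / f s) \<le> norm (1 / deriv K 0 * (deriv K s / f s))" using s by simp
    qed
  qed
qed (use assms(2) in auto)

text \<open>The upper limit is nonnegative along with \<open>\<psi>\<close>, so the strict
  inequality forces the quotient of \<open>lam\<close> and \<open>\<mu>\<close> to be positive,
  whence the sign of \<open>\<mu>\<close>. A number \<open>q\<close> strictly in between then
  provides the gain \<open>\<delta> = lam - \<mu> * q\<close>.\<close>

lemma concave_slope_bound:
  assumes \<psi>: "\<forall>s\<ge>0. 0 \<le> \<psi> s" and lim: "Limsup at_top (\<lambda>s. ereal (\<psi> s / s)) < ereal lam / ereal \<mu>"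
  obtains \<delta> N where "0 < \<delta>" "0 \<le> \<mu>" "\<And>s. N \<le> s \<Longrightarrow> \<mu> * \<psi> s \<le> (lam - \<delta>) * s"
proof -
  have "\<forall>\<^sub>F s in at_top. 0 \<le> ereal (\<psi> s / s)"
    using eventually_ge_at_top[of 0] by eventually_elim (use \<psi> in auto)
  then have "0 \<le> Limsup at_top (\<lambda>s. ereal (\<psi> s / s))" by (intro le_Limsup) auto
  then have pos: "0 < ereal lam / ereal \<mu>" using lim by simp
  show ?thesis
  proof (cases "\<mu> = 0")
    \<comment> \<open>For extended reals the inverse of 0 is infinite, which agrees with the reading
      of the quotient in the Neumann case. The slope bound is then trivial with
      \<open>\<delta> = lam\<close>.\<close>
    case True
    then show ?thesis using that[of lam 0] lam by simp
  next
    case False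
    then have "0 < lam / \<mu>" using pos by (simp add: zero_ereal_def)
    then have \<mu>: "0 < \<mu>" using lam by (simp add: zero_less_divide_iff)
    obtain q where q: "Limsup at_top (\<lambda>s. ereal (\<psi> s / s)) < ereal q" "ereal q < ereal lam / ereal \<mu>"
      using ereal_dense2[OF lim] by blast
    then have "q < lam / \<mu>" using False by simp
    then have d: "0 < lam - \<mu> * q" using \<mu> by (simp add: field_simps)
    obtain N where N: "\<And>s. N \<le> s \<Longrightarrow> \<psi> s / s < q"
      using Limsup_lessD[OF q(1)] by (auto simp: eventually_at_top_linorder)
    show ?thesis
    proof (rule that[OF d, of "max N 1"])
      fix s assume s: "max N 1 \<le> s"
      then have "\<psi> s \<le> q * s" using N[of s] by (simp add: field_simps)
      then have "\<mu> * \<psi> s \<le> \<mu> * (q * s)" using \<mu> by simp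
      then show "\<mu> * \<psi> s \<le> (lam - (lam - \<mu> * q)) * s" by simp
    qed (use \<mu> in simp)
  qed
qed

lemma convex_slope_bound:
  assumes "ereal (\<mu> / lam) < Liminf at_top (\<lambda>r. ereal (\<Phi> r / r))"
  obtains \<delta> N where "0 < \<delta>" "\<And>r. N \<le> r \<Longrightarrow> (\<mu> + \<delta>) * r \<le> lam * \<Phi> r"
proof -
  obtain q where q: "ereal (\<mu> / lam) < ereal q" "ereal q < Liminf at_top (\<lambda>r. ereal (\<Phi> r / r))"
    using ereal_dense2[OF assms] by blast
  then have d: "0 < lam * q - \<mu>" using lam by (simp add: field_simps)
  obtain N where N: "\<And>r. N \<le> r \<Longrightarrow> q < \<Phi> r / r"
    using less_LiminfD[OF q(2)] by (auto simp: eventually_at_top_linorder)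
  show ?thesis
  proof (rule that[OF d, of "max N 1"])
    fix r assume r: "max N 1 \<le> r"
    then have "q * r \<le> \<Phi> r" using N[of r] by (simp add: field_simps)
    then have "lam * (q * r) \<le> lam * \<Phi> r" using lam by simp
    then show "(\<mu> + (lam * q - \<mu>)) * r \<le> lam * \<Phi> r" by simp
  qed
qed

end

context solution
begin

text \<open>Let F be the weighted mean of f(u). The condition and Jensen's inequality for the
  concave \<open>\<psi>\<close> bound the mean of K(u) by \<psi>(F), so the diffusion term is at
  most (lam - \<delta>) F and the rate at least \<delta> F. Jensen's inequality for \<open>f\<close>
  gives F \<ge> f(mass), which also puts F into the range where the slope bound holds.\<close>

lemma rate_bound_concave:
  assumes \<psi>: "concave_on {0..} \<psi>" and \<mu>: "0 \<le> \<mu>" and N: "\<And>s. N \<le> s \<Longrightarrow> \<mu> * \<psi> s \<le> (lam - \<delta>) * s" and \<delta>: "0 < \<delta>"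
    and t: "t \<in> I" and cond: "0 \<le> (\<integral>x. (\<psi> (f (u x t)) - K (u x t)) * \<phi> x \<partial>M)"
    and m: "0 < mass t" "N \<le> f (mass t)"
  shows "\<delta> * f (mass t) \<le> rate t"
proof -
  define F where "F = (\<integral>x. f (u x t) * \<phi> x \<partial>M)"
  have F: "f (mass t) \<le> F" unfolding F_def by (rule jensen_f[OF t m(1)])
  have F0: "0 < F" using F fp[of "mass t"] m(1) by simp
  obtain C where C: "0 < C" "\<And>x. x \<in> \<Omega> \<Longrightarrow> 0 < u x t \<and> u x t \<le> C" by (rule u_slice_bound[OF t]) blast
  have \<psi>c: "convex_on {0..} (\<lambda>s. - \<psi> s)" using \<psi> by (simp add: concave_on_def)
  have "continuous_on {0<..} (\<lambda>s. - \<psi> s)"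
    by (rule convex_on_continuous[OF open_greaterThan convex_on_subset[OF \<psi>c]]) (auto simp: convex_real_interval)
  then have cont: "continuous_on {0<..} \<psi>" using continuous_on_minus by fastforce
  have cont': "continuous_on {0..C} (\<lambda>s. \<psi> (f s))"
    by (rule continuous_on_compose2[OF cont f_cont]) (use fp in auto)
  \<comment> \<open>The bound serves to prove integrability, without which the assumed integral
    could not be split: a non-integrable integrand would have integral 0 and satisfy the condition
    vacuously.\<close>
  obtain B where "0 \<le> B" "\<And>s. s \<in> {0..C} \<Longrightarrow> \<bar>\<psi> (f s)\<bar> \<le> B"
    by (rule compact_abs_bound[OF compact_Icc cont']) blast
  then have i\<psi>: "integrable M (\<lambda>x. \<psi> (f (u x t)) * \<phi> x)"
    using C by (intro weighted_integrable[OF t, of "\<lambda>s. \<psi> (f s)" C B] continuous_on_compose2[OF cont f_cont])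
      (use fp in \<open>auto simp: less_imp_le\<close>)
  have "- \<psi> F \<le> (\<integral>x. - \<psi> (f (u x t)) * \<phi> x \<partial>M)"
    unfolding F_def
    by (rule jensen_weighted[OF \<psi>c])
       (use \<phi>_integrable f_integrable[OF t] i\<psi> \<phi>1 \<phi>_pos fp u_pos[OF _ t] F0 in
         \<open>auto simp: less_imp_le F_def\<close>)
  then have "(\<integral>x. \<psi> (f (u x t)) * \<phi> x \<partial>M) \<le> \<psi> F" by simp
  moreover have "0 \<le> (\<integral>x. \<psi> (f (u x t)) * \<phi> x \<partial>M) - (\<integral>x. K (u x t) * \<phi> x \<partial>M)"
    using cond i\<psi> K_integrable[OF t] by (simp add: left_diff_distrib)
  ultimately have "(\<integral>x. K (u x t) * \<phi> x \<partial>M) \<le> \<psi> F" by linarith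
  then have "\<mu> * (\<integral>x. K (u x t) * \<phi> x \<partial>M) \<le> \<mu> * \<psi> F" using \<mu> by (rule mult_left_mono)
  also have "\<dots> \<le> (lam - \<delta>) * F" using N m(2) F by simp
  finally have "\<delta> * F \<le> rate t" using rate_eq[OF t] by (simp add: F_def algebra_simps)
  then show ?thesis using F \<delta> by (meson mult_left_mono less_imp_le order_trans)
qed

text \<open>Dual to the concave case: with G the weighted mean of K(u), the condition and Jensen's
  inequality for \<open>\<Phi>\<close> give mean f(u) \<ge> \<Phi>(G), so the reaction term is at
  least (\<mu> + \<delta>) G. The growth is now measured by \<open>K\<close> at the mass, which is
  why 1/K has to be integrable.\<close>

lemma rate_bound_convex:
  assumes \<Phi>: "convex_on {0..} \<Phi>" "\<forall>r\<ge>0. 0 \<le> \<Phi> r" "\<Phi> 0 = 0"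
    and N: "\<And>r. N \<le> r \<Longrightarrow> (\<mu> + \<delta>) * r \<le> lam * \<Phi> r" and \<delta>: "0 < \<delta>"
    and t: "t \<in> I" and cond: "0 \<le> (\<integral>x. (f (u x t) - \<Phi> (K (u x t))) * \<phi> x \<partial>M)"
    and m: "0 < mass t" "N \<le> K (mass t)"
  shows "\<delta> * K (mass t) \<le> rate t"
proof -
  define G where "G = (\<integral>x. K (u x t) * \<phi> x \<partial>M)"
  have G: "K (mass t) \<le> G" unfolding G_def by (rule jensen_K[OF t m(1)])
  have G0: "0 < G" using G K0(2)[of "mass t"] m(1) by simp
  obtain C where C: "0 < C" "\<And>x. x \<in> \<Omega> \<Longrightarrow> 0 < u x t \<and> u x t \<le> C" by (rule u_slice_bound[OF t]) blast
  have cont: "continuous_on {0<..} \<Phi>"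
    by (rule convex_on_continuous[OF open_greaterThan convex_on_subset[OF \<Phi>(1)]]) (auto simp: convex_real_interval)
  \<comment> \<open>Convexity together with \<Phi>(0) = 0 places \<Phi> below its chord from 0 to
    \<open>K C\<close>, which bounds it near 0 as well.\<close>
  have b: "\<bar>\<Phi> (K s)\<bar> \<le> \<Phi> (K C)" if "0 < s" "s \<le> C" for s
  proof -
    have k: "0 < K s" "K s \<le> K C" using that K0 K_growth(1) by auto
    define r where "r = K s / K C"
    have r: "0 \<le> r" "r \<le> 1" using k by (auto simp: r_def)
    have "\<Phi> ((1 - r) *\<^sub>R 0 + r *\<^sub>R K C) \<le> (1 - r) * \<Phi> 0 + r * \<Phi> (K C)"
      by (rule convex_onD[OF \<Phi>(1)]) (use r k in auto)
    then have "\<Phi> (K s) \<le> r * \<Phi> (K C)" using \<Phi>(3) k by (simp add: r_def)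
    also have "\<dots> \<le> 1 * \<Phi> (K C)" using r \<Phi>(2) k by (intro mult_right_mono) auto
    finally show ?thesis using \<Phi>(2) k by simp
  qed
  have i\<Phi>: "integrable M (\<lambda>x. \<Phi> (K (u x t)) * \<phi> x)"
    using C b by (intro weighted_integrable[OF t, of "\<lambda>s. \<Phi> (K s)" C "\<Phi> (K C)"] continuous_on_compose2[OF cont K_cont(1)])
      (use K0 in auto)
  have "\<Phi> G \<le> (\<integral>x. \<Phi> (K (u x t)) * \<phi> x \<partial>M)"
    unfolding G_def
    by (rule jensen_weighted[OF \<Phi>(1)])
       (use \<phi>_integrable K_integrable[OF t] i\<Phi> \<phi>1 \<phi>_pos K_nonneg u_pos[OF _ t] G0 in
         \<open>auto simp: less_imp_le G_def\<close>)
  moreover have "0 \<le> (\<integral>x. f (u x t) * \<phi> x \<partial>M) - (\<integral>x. \<Phi> (K (u x t)) * \<phi> x \<partial>M)"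
    using cond i\<Phi> f_integrable[OF t] by (simp add: left_diff_distrib)
  ultimately have "\<Phi> G \<le> (\<integral>x. f (u x t) * \<phi> x \<partial>M)" by linarith
  then have "lam * \<Phi> G \<le> lam * (\<integral>x. f (u x t) * \<phi> x \<partial>M)" using lam by simp
  moreover have "(\<mu> + \<delta>) * G \<le> lam * \<Phi> G" using N m(2) G by simp
  ultimately have "\<delta> * G \<le> rate t" using rate_eq[OF t] by (simp add: G_def algebra_simps)
  then show ?thesis using G \<delta> by (meson mult_left_mono less_imp_le order_trans)
qed

end

text \<open>Large initial data means that the mean of \<open>u0\<close> with weight
  \<open>\<phi>\<close> is at least a threshold \<open>M\<close>. The threshold is quantified before
  \<open>u0\<close>, \<open>T\<close> and \<open>u\<close>, so it depends only on the data of the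
  problem and on the comparison function. Local well-posedness and positivity of the solution, which
  are taken as known, enter as hypotheses.\<close>

theorem theorem1:
  fixes \<Omega> :: "'a::euclidean_space set" and \<beta> :: "'a \<Rightarrow> ennreal"
    and f K :: "real \<Rightarrow> real" and lam \<mu> \<alpha> :: real and \<phi> :: "'a \<Rightarrow> real"
  assumes domain: "open \<Omega>" "connected \<Omega>" "\<Omega> \<noteq> {}" "bounded \<Omega>" "Ck_boundary 2 \<Omega>"
    and lam: "0 < lam"
    and beta: "0 < \<alpha>" "\<alpha> \<le> 1" "C1_holder_where_bounded \<alpha> \<Omega> \<beta>"
    and smooth: "Ck_on 3 UNIV f" "Ck_on 3 UNIV K"
    and K: "0 \<le> K 0" "\<And>s. 0 < s \<Longrightarrow> 0 < K s"
           "\<And>s. 0 \<le> s \<Longrightarrow> 0 < deriv K s" "\<And>s. 0 \<le> s \<Longrightarrow> 0 < deriv (deriv K) s"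
    and f: "\<And>s. 0 \<le> s \<Longrightarrow> 0 < f s"
           "\<And>s. 0 \<le> s \<Longrightarrow> 0 < deriv f s" "\<And>s. 0 \<le> s \<Longrightarrow> 0 < deriv (deriv f) s"
    and Kf: "set_integrable lborel {0..} (\<lambda>s. deriv K s / f s)"
    and eigen: "first_eigenvalue \<Omega> \<beta> \<mu>" "eigenfunction \<Omega> \<beta> \<mu> \<phi>"
               "\<And>x. x \<in> \<Omega> \<Longrightarrow> 0 < \<phi> x" "(LINT x:\<Omega>|lborel. \<phi> x) = 1"
    and wp: "locally_well_posed \<Omega> \<beta> lam f K"
  shows
    "(\<forall>\<psi>. concave_on {0..} \<psi> \<and> (\<forall>s\<ge>0. 0 \<le> \<psi> s) \<and>
          Limsup at_top (\<lambda>s. ereal (\<psi> s / s)) < ereal lam / ereal \<mu> \<longrightarrow>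
        (\<exists>M. \<forall>u0 T u.
           maximal_solution \<Omega> \<beta> lam f K u0 T u \<and> (\<forall>x\<in>\<Omega>. 0 \<le> u0 x) \<and>
           (\<forall>x\<in>\<Omega>. \<forall>t\<in>existence_times T. 0 < u x t) \<and>
           (\<forall>t\<in>existence_times T. 0 \<le> (LINT x:\<Omega>|lborel. (\<psi> (f (u x t)) - K (u x t)) * \<phi> x)) \<and>
           M \<le> (LINT x:\<Omega>|lborel. u0 x * \<phi> x) \<longrightarrow>
           blows_up_in_finite_time \<Omega> T u)) \<and>
     (\<forall>\<Phi>. convex_on {0..} \<Phi> \<and> (\<forall>r\<ge>0. 0 \<le> \<Phi> r) \<and> \<Phi> 0 = 0 \<and>
          ereal (\<mu> / lam) < Liminf at_top (\<lambda>r. ereal (\<Phi> r / r)) \<and>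
          set_integrable lborel {1..} (\<lambda>s. 1 / K s) \<longrightarrow>
        (\<exists>M. \<forall>u0 T u.
           maximal_solution \<Omega> \<beta> lam f K u0 T u \<and> (\<forall>x\<in>\<Omega>. 0 \<le> u0 x) \<and>
           (\<forall>x\<in>\<Omega>. \<forall>t\<in>existence_times T. 0 < u x t) \<and>
           (\<forall>t\<in>existence_times T. 0 \<le> (LINT x:\<Omega>|lborel. (f (u x t) - \<Phi> (K (u x t))) * \<phi> x)) \<and>
           M \<le> (LINT x:\<Omega>|lborel. u0 x * \<phi> x) \<longrightarrow>
           blows_up_in_finite_time \<Omega> T u))"
proof -
  interpret P: eigen_problem \<Omega> \<beta> f K lam \<mu> \<phi>
    by unfold_locales (use domain lam smooth K f eigen in \<open>auto simp: set_integral_vol\<close>)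
  note [simp] = set_integral_vol[OF domain(1)]
  have sol: "solution \<Omega> \<beta> f K lam \<mu> \<phi> u0 T u"
    if "maximal_solution \<Omega> \<beta> lam f K u0 T u" "\<forall>x\<in>\<Omega>. \<forall>t\<in>existence_times T. 0 < u x t" for u0 T u
    by unfold_locales (use that in \<open>auto simp: maximal_solution_def\<close>)
  have blowup: "blows_up_in_finite_time \<Omega> T u"
    if "maximal_solution \<Omega> \<beta> lam f K u0 T u" "\<forall>x\<in>\<Omega>. \<forall>t\<in>existence_times T. 0 < u x t" "T < \<infinity>" for u0 T u
    by (rule blows_up_if_maximal_time_finite[OF domain(1) wp that(1) _ that(3)]) (use that(2) in auto)
  show ?thesis
  proof (intro conjI allI impI; elim conjE)
    fix \<psi> assume \<psi>: "concave_on {0..} \<psi>" "\<forall>s\<ge>0. 0 \<le> \<psi> s"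
      "Limsup at_top (\<lambda>s. ereal (\<psi> s / s)) < ereal lam / ereal \<mu>"
    obtain \<delta> N where \<delta>: "0 < \<delta>" "0 \<le> \<mu>" "\<And>s. N \<le> s \<Longrightarrow> \<mu> * \<psi> s \<le> (lam - \<delta>) * s"
      by (rule P.concave_slope_bound[OF \<psi>(2,3)]) blast
    \<comment> \<open>Beyond \<open>M1\<close> the values of \<open>f\<close> lie in the range
      \<open>{N..}\<close> in which the slope bound is valid. \<open>M1\<close> is also the left end
      point of the integral of \<open>1 / f\<close>.\<close>
    obtain M1 where M1: "1 \<le> M1" "\<And>s. M1 \<le> s \<Longrightarrow> N \<le> f s"
      by (rule P.eventually_large[OF P.f_growth(2) f(2)[OF order_refl], of N]) auto
    show "\<exists>M. \<forall>u0 T u.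
           maximal_solution \<Omega> \<beta> lam f K u0 T u \<and> (\<forall>x\<in>\<Omega>. 0 \<le> u0 x) \<and>
           (\<forall>x\<in>\<Omega>. \<forall>t\<in>existence_times T. 0 < u x t) \<and>
           (\<forall>t\<in>existence_times T. 0 \<le> (LINT x:\<Omega>|lborel. (\<psi> (f (u x t)) - K (u x t)) * \<phi> x)) \<and>
           M \<le> (LINT x:\<Omega>|lborel. u0 x * \<phi> x) \<longrightarrow>
           blows_up_in_finite_time \<Omega> T u"
    proof (intro exI[of _ "M1 + 2"] allI impI, elim conjE)
      fix u0 T u
      assume max: "maximal_solution \<Omega> \<beta> lam f K u0 T u"
        and pos: "\<forall>x\<in>\<Omega>. \<forall>t\<in>existence_times T. 0 < u x t"
        and cond: "\<forall>t\<in>existence_times T. 0 \<le> (LINT x:\<Omega>|lborel. (\<psi> (f (u x t)) - K (u x t)) * \<phi> x)"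
        and start: "M1 + 2 \<le> (LINT x:\<Omega>|lborel. u0 x * \<phi> x)"
      interpret S: solution \<Omega> \<beta> f K lam \<mu> \<phi> u0 T u by (rule sol[OF max pos])
      have "T < \<infinity>"
      proof (rule S.maximal_time_finite[of M1 \<delta> f])
        show "\<delta> * f (S.mass t) \<le> S.rate t" if "t \<in> existence_times T" "M1 \<le> S.mass t" for t
          by (rule S.rate_bound_concave[OF \<psi>(1) \<delta>(2,3,1) that(1)])
             (use cond that M1 in auto)
        show "set_integrable lborel {M1..} (\<lambda>s. 1 / f s)"
          by (rule P.inverse_f_integrable[OF Kf]) (use M1 in simp)
      qed (use \<delta> M1 f start P.f_growth(1) in auto)
      then show "blows_up_in_finite_time \<Omega> T u" by (rule blowup[OF max pos])
    qed
  next
    fix \<Phi> assume \<Phi>: "convex_on {0..} \<Phi>" "\<forall>r\<ge>0. 0 \<le> \<Phi> r" "\<Phi> 0 = 0"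
      "ereal (\<mu> / lam) < Liminf at_top (\<lambda>r. ereal (\<Phi> r / r))"
      and Ki: "set_integrable lborel {1..} (\<lambda>s. 1 / K s)"
    obtain \<delta> N where \<delta>: "0 < \<delta>" "\<And>r. N \<le> r \<Longrightarrow> (\<mu> + \<delta>) * r \<le> lam * \<Phi> r"
      by (rule P.convex_slope_bound[OF \<Phi>(4)]) blast
    \<comment> \<open>The same choice with \<open>K\<close> in place of \<open>f\<close>; here
      \<open>1 \<le> M1\<close> also places \<open>{M1..}\<close> inside the half-line on which
      \<open>1 / K\<close> is integrable.\<close>
    obtain M1 where M1: "1 \<le> M1" "\<And>s. M1 \<le> s \<Longrightarrow> N \<le> K s"
      by (rule P.eventually_large[OF P.K_growth(2) K(3)[OF order_refl], of N]) auto
    show "\<exists>M. \<forall>u0 T u.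
           maximal_solution \<Omega> \<beta> lam f K u0 T u \<and> (\<forall>x\<in>\<Omega>. 0 \<le> u0 x) \<and>
           (\<forall>x\<in>\<Omega>. \<forall>t\<in>existence_times T. 0 < u x t) \<and>
           (\<forall>t\<in>existence_times T. 0 \<le> (LINT x:\<Omega>|lborel. (f (u x t) - \<Phi> (K (u x t))) * \<phi> x)) \<and>
           M \<le> (LINT x:\<Omega>|lborel. u0 x * \<phi> x) \<longrightarrow>
           blows_up_in_finite_time \<Omega> T u"
    proof (intro exI[of _ "M1 + 2"] allI impI, elim conjE)
      fix u0 T u
      assume max: "maximal_solution \<Omega> \<beta> lam f K u0 T u"
        and pos: "\<forall>x\<in>\<Omega>. \<forall>t\<in>existence_times T. 0 < u x t"
        and cond: "\<forall>t\<in>existence_times T. 0 \<le> (LINT x:\<Omega>|lborel. (f (u x t) - \<Phi> (K (u x t))) * \<phi> x)"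
        and start: "M1 + 2 \<le> (LINT x:\<Omega>|lborel. u0 x * \<phi> x)"
      interpret S: solution \<Omega> \<beta> f K lam \<mu> \<phi> u0 T u by (rule sol[OF max pos])
      have "T < \<infinity>"
      proof (rule S.maximal_time_finite[of M1 \<delta> K])
        show "\<delta> * K (S.mass t) \<le> S.rate t" if "t \<in> existence_times T" "M1 \<le> S.mass t" for t
          by (rule S.rate_bound_convex[OF \<Phi>(1-3) \<delta>(2,1) that(1)])
             (use cond that M1 in auto)
        show "set_integrable lborel {M1..} (\<lambda>s. 1 / K s)"
          by (rule set_integrable_subset[OF Ki]) (use M1 in auto)
      qed (use \<delta> M1 K start P.K_growth(1) in auto)
      then show "blows_up_in_finite_time \<Omega> T u" by (rule blowup[OF max pos])
    qed
  qed
qed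

end
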